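(* Let $E$ be a sign-normalized Drinfeld–Hayes $A$-module over $H$ such that the divisor $V$ is not supported on $\operatorname{Spm}\mathbb{T}$. Let $\mathfrak{p}\subset A$ be a nonzero prime ideal and $\mathfrak{P}$ a maximal ideal of $\overline{\mathbb{F}}\otimes A$ above $\mathfrak{p}$. Then for every nonzero $\lambda\in\Lambda_E\subset\mathbb{C}_\infty$ and every integer $n\geq0$, \[L(\chi_{\mathfrak{P}},q^n)\in\mathbb{F}_{\mathfrak{p}}H\cdot\frac{\lambda^{q^n}}{g(\chi_{\mathfrak{P}},\psi_\lambda)},\] where $g(\chi_{\mathfrak{P}},\psi_\lambda)$ is regarded as a (tensorless) element of $\mathbb{C}_\infty$.
   Context: $\mathbb{F}$ is a finite field with $q$ elements, $C$ an elliptic curve over $\mathbb{F}$ with origin $\infty$, $A=H^0(C\setminus\{\infty\},\mathcal{O}_C)=\mathbb{F}[t,y]$ with $W(y,t):=y^2+a_1ty+a_3y-(t^3+a_2t^2+a_4t+a_6)=0$ ($a_i\in\mathbb{F}$), so $\{t^i,t^jy: i,j\geq0\}$ is an $\mathbb{F}$-basis of $A$. $K=\operatorname{Frac}A$, $\mathbb{C}_\infty$ the completion of an algebraic closure of $K$ at $\infty$, $H\subset\mathbb{C}_\infty$ the Hilbert class field of $K$; tensors over $\mathbb{F}$. For $0\neq a\in A$, $\operatorname{sgn}(a)\in\mathbb{F}^\times$ is the coefficient of the basis element of highest degree (pole order at $\infty$) in its expansion; $A_+=\{a\neq0:\operatorname{sgn}(a)=1\}$. A sign-normalized Drinfeld–Hayes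 module over $H$ is $E=\mathbb{G}_{a,H}$ with the $A$-action $\phi$ determined by $\phi_t=t+x_1\tau+\tau^2$, $\phi_y=y+y_1\tau+y_2\tau^2+\tau^3$ in $H\{\tau\}$ ($\tau$ the $q$-Frobenius, $x_1,y_1,y_2\in H$ with $W(\phi_t,\phi_y)=0$). Its motive $\mathsf{M}=\operatorname{Hom}_{\mathbb{F},H}(E,\mathbb{G}_{a,H})=H\{\tau\}$ is a projective rank-one $A\otimes H$-module ($a$ acts by precomposition with $\phi_a$, $H$ by left multiplication); $\mathfrak{v}\subseteq A\otimes H$ is the ideal with $(A\otimes H)\cdot\mathrm{id}=\mathfrak{v}\mathsf{M}$ and $V$ its associated effective divisor on $C\times_{\mathbb{F}}\operatorname{Spec}H$. $\mathbb{T}=A\hat\otimes\mathbb{C}_\infty$ is the completion of $A\otimes\mathbb{C}_\infty$ for $\|x\|=\inf\max|c_i|$ over representations $\sum a_i\otimes c_i$; $\operatorname{Spm}\mathbb{T}$ is the set of maximal ideals $\mathfrak{m}$ of $A\otimes\mathbb{C}_\infty$ with $\mathfrak{m}\mathbb{T}\neq\mathbb{T}$; "$V$ not supported on $\operatorname{Spm}\mathbb{T}$" means no $\mathfrak{m}\in\operatorname{Spm}\mathbb{T}$ contains $\mathfrak{v}(A\otimes\mathbb{C}_\infty)$. $\Lambda_E$ is the kernel of the exponential of $E$ (the unique $\mathbb{F}$-linear entire function $\exp_E(z)=z+\sum_{i\geq1}e_iz^{q^i}$ with $\exp_E(az)=\phi_a(\exp_E(z))$). $\mathbb{F}_{\mathfrak{p}}=A/\mathfrak{p}$;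 $\chi_{\mathfrak{P}}:A\to\overline{\mathbb{F}}\subset\mathbb{C}_\infty$ sends $a$ to the class of $1\otimes a$ in $(\overline{\mathbb{F}}\otimes A)/\mathfrak{P}\cong\overline{\mathbb{F}}$; its image, a field with $|A/\mathfrak{p}|$ elements, is identified with $\mathbb{F}_{\mathfrak{p}}$, and $\mathbb{F}_{\mathfrak{p}}H$ is the compositum in $\mathbb{C}_\infty$. $L(\chi_{\mathfrak{P}},m)=\sum_{a\in A_+}\chi_{\mathfrak{P}}(a)/a^m\in\mathbb{C}_\infty$. Fix a uniformizer $u_{\mathfrak{p}}\in A$ of $\mathfrak{p}$ and $z_{\mathfrak{p}}\in\mathfrak{p}^{-1}$ with $u_{\mathfrak{p}}z_{\mathfrak{p}}\equiv1\bmod\mathfrak{p}$; $\psi_\lambda(a+\mathfrak{p})=\exp_E(az_{\mathfrak{p}}\lambda)$; $g(\chi_{\mathfrak{P}},\psi_\lambda)=-\sum_{x\in(A/\mathfrak{p})^\times}\chi_{\mathfrak{P}}(x)^{-1}\psi_\lambda(x)\in\mathbb{C}_\infty$ (products taken in $\mathbb{C}_\infty$).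
   Formalization: The formal theorem assumes in addition that λ does not lie in 𝔭Λ_E; for nonzero λ in 𝔭Λ_E one has z_𝔭λ in Λ_E, so ψ_λ and g(χ_𝔓,ψ_λ) vanish and the quotient λ^{q^n}/g is undefined. For all other λ, g ≠ 0 is proved. *)

theory Defs
  imports
    "HOL-Analysis.Infinite_Sum"
    "HOL-Analysis.Product_Vector"
    "HOL-Algebra.QuotRing"
    "HOL-Algebra.Ideal_Product"
    "HOL-Computational_Algebra.Polynomial"
begin

section \<open>Complete non-archimedean fields\<close>

class complete_nonarch_field = field + complete_space +
  assumes dist_diff: "dist x y = dist (x - y) 0"
    and dist_mult_0: "dist (x * y) 0 = dist x 0 * dist y 0"
    and dist_add_0_ultra: "dist (x + y) 0 \<le> max (dist x 0) (dist y 0)"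

definition absv :: "'c::complete_nonarch_field \<Rightarrow> real"
  where "absv x = dist x 0"

section \<open>Subfields, algebraic elements, finite abelian extensions\<close>

definition is_subring :: "'c::field set \<Rightarrow> bool" where
  "is_subring S \<longleftrightarrow> 1 \<in> S \<and> (\<forall>x\<in>S. \<forall>y\<in>S. x - y \<in> S \<and> x * y \<in> S)"

definition is_subfield :: "'c::field set \<Rightarrow> bool" where
  "is_subfield S \<longleftrightarrow> is_subring S \<and> (\<forall>x\<in>S. inverse x \<in> S)"

definition polys_over :: "'c::field set \<Rightarrow> 'c poly set" where
  "polys_over S = {p. \<forall>n. coeff p n \<in> S}"

definition algebraic_closure_in :: "'c::field set \<Rightarrow> 'c set" where
  "algebraic_closure_in S = {x. \<exists>p\<in>polys_over S. p \<noteq> 0 \<and> poly p x = 0}"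

definition finite_extension :: "'c::field set \<Rightarrow> 'c set \<Rightarrow> bool" where
  "finite_extension K L \<longleftrightarrow> is_subfield L \<and> K \<subseteq> L \<and>
     (\<exists>B. finite B \<and> B \<subseteq> L \<and> (\<forall>x\<in>L. \<exists>c. (\<forall>b\<in>B. c b \<in> K) \<and> x = (\<Sum>b\<in>B. c b * b)))"

definition field_auts :: "'c::field set \<Rightarrow> 'c set \<Rightarrow> ('c \<Rightarrow> 'c) set" where
  "field_auts K L = {\<sigma>. bij_betw \<sigma> L L \<and>
     (\<forall>x\<in>L. \<forall>y\<in>L. \<sigma> (x + y) = \<sigma> x + \<sigma> y \<and> \<sigma> (x * y) = \<sigma> x * \<sigma> y) \<and> (\<forall>x\<in>K. \<sigma> x = x)}"

definition finite_abelian_extension :: "'c::field set \<Rightarrow> 'c set \<Rightarrow> bool" where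
  "finite_abelian_extension K L \<longleftrightarrow> finite_extension K L \<and>
     {x\<in>L. \<forall>\<sigma>\<in>field_auts K L. \<sigma> x = x} = K \<and>
     (\<forall>\<sigma>\<in>field_auts K L. \<forall>\<rho>\<in>field_auts K L. \<forall>x\<in>L. \<sigma> (\<rho> x) = \<rho> (\<sigma> x))"

text \<open>Places of a field are given by their valuation rings. The residue fields of the function
  fields considered here are finite, hence perfect, so that a place is unramified over the
  subfield \<open>K\<close> iff its ramification index is 1, i.e. iff its maximal ideal is generated by an
  element of \<open>K\<close>.\<close>

definition place :: "'c::field set \<Rightarrow> 'c set \<Rightarrow> bool" where
  "place L R \<longleftrightarrow> is_subring R \<and> R \<subset> L \<and> (\<forall>x\<in>L. x \<in> R \<or> inverse x \<in> R)"

definition place_ideal :: "'c::field set \<Rightarrow> 'c set" where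
  "place_ideal R = {x\<in>R. x = 0 \<or> inverse x \<notin> R}"

definition unramified_place :: "'c::field set \<Rightarrow> 'c set \<Rightarrow> bool" where
  "unramified_place K R \<longleftrightarrow> (\<exists>\<pi>\<in>K. place_ideal R = (\<lambda>x. \<pi> * x) ` R)"

definition residue_degree_one :: "'c::field set \<Rightarrow> 'c set \<Rightarrow> bool" where
  "residue_degree_one K R \<longleftrightarrow> (\<forall>x\<in>R. \<exists>c\<in>K \<inter> R. x - c \<in> place_ideal R)"

section \<open>The curve, its coordinate ring and the base changes of the latter\<close>

text \<open>All data live in \<open>\<complex>\<^sub>\<infinity>\<close>, which is the type \<open>'c\<close>: the finite
  field \<open>\<bbbF>\<close>, the Weierstrass coefficients, and the images of \<open>t\<close>
  and \<open>y\<close> under \<open>A \<subseteq> K \<subseteq> \<complex>\<^sub>\<infinity>\<close>.\<close>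

record 'c curve_data =
  const_field :: "'c set"
  wa1 :: 'c
  wa2 :: 'c
  wa3 :: 'c
  wa4 :: 'c
  wa6 :: 'c
  t_elt :: 'c
  y_elt :: 'c

text \<open>For a field \<open>L\<close> between \<open>\<bbbF>\<close> and \<open>\<complex>\<^sub>\<infinity>\<close>,
  \<open>A \<otimes> L = L[T,Y]/(W)\<close> is free over \<open>L[T]\<close> on \<open>1, Y\<close>;
  the pair \<open>(f, g)\<close> stands for \<open>f(T) + g(T) Y\<close>. In particular
  \<open>A\<close> itself is the case \<open>L = \<bbbF>\<close>, and \<open>a \<mapsto> a \<otimes> 1\<close>
  is the inclusion of carriers. That this is the tensor product over \<open>\<bbbF>\<close> is
  checked in \<open>tens_universal\<close> and \<open>tens_unique\<close> below.\<close>

type_synonym 'c reg = "'c poly \<times> 'c poly"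

definition reg_mult :: "'c::field curve_data \<Rightarrow> 'c reg \<Rightarrow> 'c reg \<Rightarrow> 'c reg" where
  "reg_mult X a b =
     (fst a * fst b + snd a * snd b * [:wa6 X, wa4 X, wa2 X, 1:],
      fst a * snd b + snd a * fst b - snd a * snd b * [:wa3 X, wa1 X:])"

definition coord_ring :: "'c::field curve_data \<Rightarrow> 'c set \<Rightarrow> 'c reg ring" where
  "coord_ring X L =
     \<lparr>carrier = polys_over L \<times> polys_over L, mult = reg_mult X, one = (1, 0), zero = 0, add = (+)\<rparr>"

abbreviation ring_A :: "'c::field curve_data \<Rightarrow> 'c reg ring" where
  "ring_A X \<equiv> coord_ring X (const_field X)"

abbreviation ring_AC :: "'c::field curve_data \<Rightarrow> 'c reg ring" where
  "ring_AC X \<equiv> coord_ring X UNIV"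

definition tens :: "'c::field reg \<Rightarrow> 'c \<Rightarrow> 'c reg" where
  "tens a c = (smult c (fst a), smult c (snd a))"

text \<open>The embedding \<open>A \<subseteq> \<complex>\<^sub>\<infinity>\<close>.\<close>

definition emb :: "'c::field curve_data \<Rightarrow> 'c reg \<Rightarrow> 'c" where
  "emb X a = poly (fst a) (t_elt X) + poly (snd a) (t_elt X) * y_elt X"

text \<open>Pole order at \<open>\<infinity>\<close>, where \<open>t\<close> and \<open>y\<close> have poles of
  order 2 and 3 (only meaningful for nonzero arguments).\<close>

definition pole_order :: "'c::field reg \<Rightarrow> nat" where
  "pole_order a = max (2 * degree (fst a)) (if snd a = 0 then 0 else 2 * degree (snd a) + 3)"

definition sgn_A :: "'c::field reg \<Rightarrow> 'c" where
  "sgn_A a = (if even (pole_order a) then coeff (fst a) (pole_order a div 2)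
              else coeff (snd a) ((pole_order a - 3) div 2))"

definition A_plus :: "'c::field curve_data \<Rightarrow> 'c reg set" where
  "A_plus X = {a \<in> carrier (ring_A X). a \<noteq> 0 \<and> sgn_A a = 1}"

definition qq :: "'c curve_data \<Rightarrow> nat" where
  "qq X = card (const_field X)"

definition Fbar :: "'c::field curve_data \<Rightarrow> 'c set" where
  "Fbar X = algebraic_closure_in (const_field X)"

definition field_K :: "'c::field curve_data \<Rightarrow> 'c set" where
  "field_K X = {emb X a / emb X b | a b. a \<in> carrier (ring_A X) \<and> b \<in> carrier (ring_A X) \<and> b \<noteq> 0}"

text \<open>\<open>elliptic_curve\<close>: the affine Weierstrass equation has no singular geometric point (the
  point at infinity of a Weierstrass cubic is always smooth).\<close>

definition elliptic_curve :: "'c::field curve_data \<Rightarrow> bool" where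
  "elliptic_curve X \<longleftrightarrow>
     is_subfield (const_field X) \<and> finite (const_field X) \<and>
     {wa1 X, wa2 X, wa3 X, wa4 X, wa6 X} \<subseteq> const_field X \<and>
     (\<forall>x\<in>Fbar X. \<forall>y\<in>Fbar X. \<not>
        (y^2 + wa1 X * x * y + wa3 X * y - (x^3 + wa2 X * x^2 + wa4 X * x + wa6 X) = 0 \<and>
         wa1 X * y - (3 * x^2 + 2 * wa2 X * x + wa4 X) = 0 \<and>
         2 * y + wa1 X * x + wa3 X = 0))"

text \<open>\<open>'c\<close> is the completion of an algebraic closure of \<open>K\<close> at \<open>\<infinity>\<close>: it is
  complete, its absolute value restricts to the \<open>\<infinity>\<close>-adic one of \<open>K\<close>, and the
  elements algebraic over \<open>K\<close> form a dense algebraically closed subfield. The formula for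
  \<open>absv\<close> makes \<open>emb\<close> injective on \<open>A\<close>.\<close>

definition elliptic_setting :: "'c::complete_nonarch_field curve_data \<Rightarrow> bool" where
  "elliptic_setting X \<longleftrightarrow> elliptic_curve X \<and>
     (y_elt X)^2 + wa1 X * t_elt X * y_elt X + wa3 X * y_elt X
       = (t_elt X)^3 + wa2 X * (t_elt X)^2 + wa4 X * t_elt X + wa6 X \<and>
     (\<forall>a\<in>carrier (ring_A X). a \<noteq> 0 \<longrightarrow> absv (emb X a) = real (qq X) ^ pole_order a) \<and>
     (\<forall>p\<in>polys_over (algebraic_closure_in (field_K X)).
        degree p > 0 \<longrightarrow> (\<exists>x\<in>algebraic_closure_in (field_K X). poly p x = 0)) \<and>
     closure (algebraic_closure_in (field_K X)) = UNIV"

section \<open>The Hilbert class field\<close>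

text \<open>The maximal abelian extension of \<open>K\<close> in \<open>\<complex>\<^sub>\<infinity>\<close> that is
  unramified everywhere and in which \<open>\<infinity>\<close> splits completely.\<close>

definition infinite_place :: "'c::complete_nonarch_field curve_data \<Rightarrow> 'c set" where
  "infinite_place X = {x \<in> field_K X. absv x \<le> 1}"

definition unramified_split_abelian :: "'c::complete_nonarch_field curve_data \<Rightarrow> 'c set \<Rightarrow> bool" where
  "unramified_split_abelian X L \<longleftrightarrow> finite_abelian_extension (field_K X) L \<and>
     (\<forall>R. place L R \<longrightarrow> unramified_place (field_K X) R) \<and>
     (\<forall>R. place L R \<and> R \<inter> field_K X = infinite_place X \<longrightarrow> residue_degree_one (field_K X) R)"

definition hilbert_class_field :: "'c::complete_nonarch_field curve_data \<Rightarrow> 'c set" where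
  "hilbert_class_field X = is_subfield hull (\<Union>{L. unramified_split_abelian X L})"

section \<open>Sign-normalized Drinfeld-Hayes modules\<close>

text \<open>A twisted polynomial is given by its coefficients on the left of the powers of
  \<open>\<tau>\<close>; \<open>\<tau> c = c\<^sup>q \<tau>\<close>.\<close>

definition tw_mult :: "nat \<Rightarrow> 'c::field poly \<Rightarrow> 'c poly \<Rightarrow> 'c poly" where
  "tw_mult q f g =
     (\<Sum>i\<le>degree f. \<Sum>j\<le>degree g. monom (coeff f i * coeff g j ^ (q ^ i)) (i + j))"

definition tw_ring :: "nat \<Rightarrow> 'c::field set \<Rightarrow> 'c poly ring" where
  "tw_ring q L = \<lparr>carrier = polys_over L, mult = tw_mult q, one = 1, zero = 0, add = (+)\<rparr>"

definition tw_eval :: "nat \<Rightarrow> 'c::field poly \<Rightarrow> 'c \<Rightarrow> 'c" where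
  "tw_eval q f z = (\<Sum>i\<le>degree f. coeff f i * z ^ (q ^ i))"

definition drinfeld_hayes ::
    "'c::complete_nonarch_field curve_data \<Rightarrow> ('c reg \<Rightarrow> 'c poly) \<Rightarrow> bool" where
  "drinfeld_hayes X \<phi> \<longleftrightarrow>
     \<phi> \<in> ring_hom (ring_A X) (tw_ring (qq X) (hilbert_class_field X)) \<and>
     (\<forall>c\<in>const_field X. \<phi> ([:c:], 0) = [:c:]) \<and>
     (\<exists>x1\<in>hilbert_class_field X. \<phi> ([:0, 1:], 0) = [:t_elt X, x1, 1:]) \<and>
     (\<exists>y1\<in>hilbert_class_field X. \<exists>y2\<in>hilbert_class_field X.
        \<phi> (0, 1) = [:y_elt X, y1, y2, 1:])"

subsection \<open>The motive and the ideal of the divisor V\<close>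

text \<open>The motive is the set \<open>polys_over H\<close> of twisted polynomials; \<open>a \<otimes> h\<close> acts by
  \<open>m \<mapsto> h m \<phi>\<^sub>a\<close>, extended linearly along the basis
  \<open>t\<^sup>i, t\<^sup>i y\<close> of \<open>A\<close>.\<close>

definition motive_act ::
    "'c::field curve_data \<Rightarrow> ('c reg \<Rightarrow> 'c poly) \<Rightarrow> 'c reg \<Rightarrow> 'c poly \<Rightarrow> 'c poly" where
  "motive_act X \<phi> x m =
     (\<Sum>i\<le>degree (fst x). smult (coeff (fst x) i) (tw_mult (qq X) m (\<phi> (monom 1 i, 0)))) +
     (\<Sum>i\<le>degree (snd x). smult (coeff (snd x) i) (tw_mult (qq X) m (\<phi> (0, monom 1 i))))"

definition is_V_ideal ::
    "'c::complete_nonarch_field curve_data \<Rightarrow> ('c reg \<Rightarrow> 'c poly) \<Rightarrow> 'c reg set \<Rightarrow> bool" where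
  "is_V_ideal X \<phi> v \<longleftrightarrow> (let H = hilbert_class_field X in
     ideal v (coord_ring X H) \<and>
     {motive_act X \<phi> x 1 | x. x \<in> carrier (coord_ring X H)} =
     {\<Sum>i<n. motive_act X \<phi> (x i) (m i) | (n::nat) x m. \<forall>i<n. x i \<in> v \<and> m i \<in> polys_over H})"

subsection \<open>The completion of the tensor product\<close>

definition tens_norm :: "'c::complete_nonarch_field curve_data \<Rightarrow> 'c reg \<Rightarrow> real" where
  "tens_norm X x = Inf {Max (insert 0 ((\<lambda>(a, c). absv c) ` set r)) | r.
     (\<forall>(a, c)\<in>set r. a \<in> carrier (ring_A X)) \<and> x = (\<Sum>(a, c)\<leftarrow>r. tens a c)}"

definition cauchy_ring :: "'c::complete_nonarch_field curve_data \<Rightarrow> (nat \<Rightarrow> 'c reg) ring" where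
  "cauchy_ring X =
     \<lparr>carrier = {s. (\<forall>n. s n \<in> carrier (ring_AC X)) \<and>
                   (\<forall>\<epsilon>>0. \<exists>N. \<forall>m\<ge>N. \<forall>n\<ge>N. tens_norm X (s m - s n) < \<epsilon>)},
      mult = (\<lambda>r s n. reg_mult X (r n) (s n)), one = (\<lambda>n. (1, 0)),
      zero = (\<lambda>n. 0), add = (\<lambda>r s n. r n + s n)\<rparr>"

definition null_seqs :: "'c::complete_nonarch_field curve_data \<Rightarrow> (nat \<Rightarrow> 'c reg) set" where
  "null_seqs X = {s \<in> carrier (cauchy_ring X). (\<lambda>n. tens_norm X (s n)) \<longlonglongrightarrow> 0}"

definition ring_T :: "'c::complete_nonarch_field curve_data \<Rightarrow> (nat \<Rightarrow> 'c reg) set ring" where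
  "ring_T X = cauchy_ring X Quot null_seqs X"

definition to_T :: "'c::complete_nonarch_field curve_data \<Rightarrow> 'c reg \<Rightarrow> (nat \<Rightarrow> 'c reg) set" where
  "to_T X x = null_seqs X +>\<^bsub>cauchy_ring X\<^esub> (\<lambda>n. x)"

definition Spm_T :: "'c::complete_nonarch_field curve_data \<Rightarrow> 'c reg set set" where
  "Spm_T X = {\<mm>. maximalideal \<mm> (ring_AC X) \<and>
                   Idl\<^bsub>ring_T X\<^esub> (to_T X ` \<mm>) \<noteq> carrier (ring_T X)}"

definition V_supported_on_Spm_T :: "'c::complete_nonarch_field curve_data \<Rightarrow> 'c reg set \<Rightarrow> bool" where
  "V_supported_on_Spm_T X v \<longleftrightarrow> (\<exists>\<mm>\<in>Spm_T X. Idl\<^bsub>ring_AC X\<^esub> v \<subseteq> \<mm>)"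

subsection \<open>The exponential and its kernel\<close>

definition exp_fun ::
    "'c::complete_nonarch_field curve_data \<Rightarrow> (nat \<Rightarrow> 'c) \<Rightarrow> 'c \<Rightarrow> 'c" where
  "exp_fun X e z = (\<Sum>i. e i * z ^ (qq X ^ i))"

definition is_exponential ::
    "'c::complete_nonarch_field curve_data \<Rightarrow> ('c reg \<Rightarrow> 'c poly) \<Rightarrow> (nat \<Rightarrow> 'c) \<Rightarrow> bool" where
  "is_exponential X \<phi> e \<longleftrightarrow> e 0 = 1 \<and>
     (\<forall>z. summable (\<lambda>i. e i * z ^ (qq X ^ i))) \<and>
     (\<forall>a\<in>carrier (ring_A X). \<forall>z.
        exp_fun X e (emb X a * z) = tw_eval (qq X) (\<phi> a) (exp_fun X e z))"

definition period_lattice ::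
    "'c::complete_nonarch_field curve_data \<Rightarrow> (nat \<Rightarrow> 'c) \<Rightarrow> 'c set" where
  "period_lattice X e = {z. exp_fun X e z = 0}"

text \<open>The product \<open>I \<Lambda>\<close>. For a period \<open>lam\<close> in \<open>\<pp> \<Lambda>\<close> and \<open>z\<close> in
  the inverse of \<open>\<pp>\<close>, all \<open>a z lam\<close> are periods, so that \<open>psi\<close> and the Gauss sum below
  vanish identically and one cannot divide by the latter.\<close>

definition ideal_lattice ::
    "'c::field curve_data \<Rightarrow> 'c reg set \<Rightarrow> 'c set \<Rightarrow> 'c set" where
  "ideal_lattice X I \<Lambda> =
     {\<Sum>i<n. emb X (a i) * l i | (n::nat) a l. \<forall>i<n. a i \<in> I \<and> l i \<in> \<Lambda>}"

section \<open>Characters, L-values and Gauss-Thakur sums\<close>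

text \<open>\<open>(\<bbbF>bar \<otimes> A)/P\<close> is \<open>\<bbbF>bar\<close>, so the class of \<open>1 \<otimes> a\<close> is the
  class of a unique constant.\<close>

definition chi :: "'c::field curve_data \<Rightarrow> 'c reg set \<Rightarrow> 'c reg \<Rightarrow> 'c" where
  "chi X P a = (THE c. c \<in> Fbar X \<and> a - ([:c:], 0) \<in> P)"

definition field_Fp_H :: "'c::complete_nonarch_field curve_data \<Rightarrow> 'c reg set \<Rightarrow> 'c set" where
  "field_Fp_H X P = is_subfield hull (chi X P ` carrier (ring_A X) \<union> hilbert_class_field X)"

definition L_value :: "'c::complete_nonarch_field curve_data \<Rightarrow> 'c reg set \<Rightarrow> nat \<Rightarrow> 'c" where
  "L_value X P m = (\<Sum>\<^sub>\<infinity>a\<in>A_plus X. chi X P a / emb X a ^ m)"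

text \<open>A uniformizer has \<open>\<pp>\<close>-adic valuation exactly 1.\<close>

definition is_uniformizer :: "'c::field curve_data \<Rightarrow> 'c reg set \<Rightarrow> 'c reg \<Rightarrow> bool" where
  "is_uniformizer X \<pp> u \<longleftrightarrow> u \<in> \<pp> \<and> u \<notin> \<pp> \<cdot>\<^bsub>ring_A X\<^esub> \<pp>"

definition inverse_ideal :: "'c::field curve_data \<Rightarrow> 'c reg set \<Rightarrow> 'c set" where
  "inverse_ideal X \<pp> = {z \<in> field_K X. \<forall>a\<in>\<pp>. z * emb X a \<in> emb X ` carrier (ring_A X)}"

text \<open>Elements of \<open>A/\<pp>\<close> are cosets, and a function on \<open>A\<close> that is constant on
  cosets is evaluated on a coset as the single element of its image.\<close>

definition on_coset :: "('a \<Rightarrow> 'b) \<Rightarrow> 'a set \<Rightarrow> 'b" where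
  "on_coset f x = the_elem (f ` x)"

definition psi ::
    "'c::complete_nonarch_field curve_data \<Rightarrow> (nat \<Rightarrow> 'c) \<Rightarrow> 'c \<Rightarrow> 'c \<Rightarrow> 'c reg set \<Rightarrow> 'c" where
  "psi X e z lam = on_coset (\<lambda>a. exp_fun X e (emb X a * z * lam))"

definition gauss_sum ::
    "'c::complete_nonarch_field curve_data \<Rightarrow> (nat \<Rightarrow> 'c) \<Rightarrow> 'c reg set \<Rightarrow> 'c reg set
      \<Rightarrow> 'c \<Rightarrow> 'c \<Rightarrow> 'c" where
  "gauss_sum X e \<pp> P z lam =
     - (\<Sum>x\<in>Units (ring_A X Quot \<pp>). inverse (on_coset (chi X P) x) * psi X e z lam x)"

section \<open>Consistency of the encoding\<close>

lemma is_subringD: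
  assumes "is_subring S"
  shows "0 \<in> S" "1 \<in> S" "x \<in> S \<Longrightarrow> - x \<in> S" "x \<in> S \<Longrightarrow> y \<in> S \<Longrightarrow> x + y \<in> S"
    "x \<in> S \<Longrightarrow> y \<in> S \<Longrightarrow> x - y \<in> S" "x \<in> S \<Longrightarrow> y \<in> S \<Longrightarrow> x * y \<in> S"
proof -
  have d: "x - y \<in> S" if "x \<in> S" "y \<in> S" for x y using assms that by (auto simp: is_subring_def)
  show 1: "1 \<in> S" using assms by (auto simp: is_subring_def)
  show 0: "0 \<in> S" using d[OF 1 1] by simp
  show m: "x \<in> S \<Longrightarrow> - x \<in> S" for x using d[OF 0, of x] by simp
  show "x \<in> S \<Longrightarrow> y \<in> S \<Longrightarrow> x + y \<in> S" using d[of x "- y"] m[of y] by simp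
  show "x \<in> S \<Longrightarrow> y \<in> S \<Longrightarrow> x - y \<in> S" by (rule d)
  show "x \<in> S \<Longrightarrow> y \<in> S \<Longrightarrow> x * y \<in> S" using assms by (auto simp: is_subring_def)
qed

lemma sum_in_subring:
  assumes "is_subring S" "\<And>i. i \<in> I \<Longrightarrow> f i \<in> S"
  shows "sum f I \<in> S"
  using assms(2) by (induction I rule: infinite_finite_induct) (auto simp: is_subringD[OF assms(1)])

lemma polys_over_closed:
  assumes "is_subring S"
  shows "0 \<in> polys_over S" "1 \<in> polys_over S"
    "p \<in> polys_over S \<Longrightarrow> - p \<in> polys_over S"
    "p \<in> polys_over S \<Longrightarrow> r \<in> polys_over S \<Longrightarrow> p + r \<in> polys_over S"
    "p \<in> polys_over S \<Longrightarrow> r \<in> polys_over S \<Longrightarrow> p - r \<in> polys_over S"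
    "p \<in> polys_over S \<Longrightarrow> r \<in> polys_over S \<Longrightarrow> p * r \<in> polys_over S"
    "c \<in> S \<Longrightarrow> p \<in> polys_over S \<Longrightarrow> pCons c p \<in> polys_over S"
    "c \<in> S \<Longrightarrow> p \<in> polys_over S \<Longrightarrow> smult c p \<in> polys_over S"
    "monom 1 n \<in> polys_over S"
  using is_subringD[OF assms]
  by (auto simp: polys_over_def coeff_mult coeff_pCons split: nat.splits intro!: sum_in_subring[OF assms])

lemma coord_ring_cring:
  assumes "is_subring L" "{wa1 X, wa2 X, wa3 X, wa4 X, wa6 X} \<subseteq> L"
  shows "cring (coord_ring X L)"
proof (rule cringI)
  note cl = polys_over_closed[OF assms(1)] is_subringD[OF assms(1)]
  show "abelian_group (coord_ring X L)"
  proof (rule abelian_groupI)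
    fix x assume "x \<in> carrier (coord_ring X L)"
    then show "\<exists>y\<in>carrier (coord_ring X L). y \<oplus>\<^bsub>coord_ring X L\<^esub> x = \<zero>\<^bsub>coord_ring X L\<^esub>"
      by (intro bexI[of _ "- x"]) (auto simp: coord_ring_def cl)
  qed (auto simp: coord_ring_def cl zero_prod_def algebra_simps)
  show "comm_monoid (coord_ring X L)"
    by (rule comm_monoidI)
      (use assms(2) in \<open>auto simp: coord_ring_def reg_mult_def cl algebra_simps simp del: mult_pCons_right mult_pCons_left\<close>)
qed (auto simp: coord_ring_def reg_mult_def algebra_simps simp del: mult_pCons_right mult_pCons_left)

lemma tens_in_carrier:
  assumes "is_subring L" "const_field X \<subseteq> L" "a \<in> carrier (ring_A X)" "c \<in> L"
  shows "tens a c \<in> carrier (coord_ring X L)"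
  using assms
  by (auto simp: coord_ring_def tens_def polys_over_def intro!: is_subringD(6)[OF assms(1)])

lemma reg_decompose:
  fixes x :: "'c::field reg"
  shows "x = (\<Sum>i\<le>degree (fst x). tens (monom 1 i, 0) (coeff (fst x) i))
           + (\<Sum>i\<le>degree (snd x). tens (0, monom 1 i) (coeff (snd x) i))"
proof -
  have "(\<Sum>i\<le>n. (monom (c i) i :: 'c poly, 0 :: 'c poly)) = (\<Sum>i\<le>n. monom (c i) i, 0)" for n c
    by (induction n) auto
  moreover have "(\<Sum>i\<le>n. (0 :: 'c poly, monom (c i) i :: 'c poly)) = (0, \<Sum>i\<le>n. monom (c i) i)" for n c
    by (induction n) auto
  ultimately show ?thesis
    by (simp add: tens_def smult_monom poly_as_sum_of_monoms)
qed

lemma tens_unique: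
  fixes h h' :: "'c::field reg \<Rightarrow> 'm::ab_group_add"
  assumes L: "is_subring L" "const_field X \<subseteq> L" and F: "is_subring (const_field X)"
    and h: "\<And>x y. x \<in> carrier (coord_ring X L) \<Longrightarrow> y \<in> carrier (coord_ring X L) \<Longrightarrow> h (x + y) = h x + h y"
    and h': "\<And>x y. x \<in> carrier (coord_ring X L) \<Longrightarrow> y \<in> carrier (coord_ring X L) \<Longrightarrow> h' (x + y) = h' x + h' y"
    and eq: "\<And>a c. a \<in> carrier (ring_A X) \<Longrightarrow> c \<in> L \<Longrightarrow> h (tens a c) = h' (tens a c)"
    and x: "x \<in> carrier (coord_ring X L)"
  shows "h x = h' x"
proof -
  let ?C = "carrier (coord_ring X L)"
  have C0: "0 \<in> ?C" and Cadd: "\<And>x y. x \<in> ?C \<Longrightarrow> y \<in> ?C \<Longrightarrow> x + y \<in> ?C"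
    using polys_over_closed[OF L(1)] by (auto simp: coord_ring_def zero_prod_def)
  have z: "h 0 = 0" "h' 0 = 0" using h[OF C0 C0] h'[OF C0 C0] by auto
  have *: "sum f {..n} \<in> ?C \<and> h (sum f {..n}) = h' (sum f {..n})"
    if "\<And>i. f i \<in> ?C \<and> h (f i) = h' (f i)" for f :: "nat \<Rightarrow> 'c reg" and n
    by (induction n) (use that Cadd h h' in auto)
  have mon: "(monom 1 i, 0) \<in> carrier (ring_A X)" "(0, monom 1 i) \<in> carrier (ring_A X)" for i
    using polys_over_closed[OF F] by (auto simp: coord_ring_def)
  have co: "coeff (fst x) i \<in> L" "coeff (snd x) i \<in> L" for i
    using x by (auto simp: coord_ring_def polys_over_def)
  let ?a = "\<Sum>i\<le>degree (fst x). tens (monom 1 i, 0) (coeff (fst x) i)"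
  let ?b = "\<Sum>i\<le>degree (snd x). tens (0, monom 1 i) (coeff (snd x) i)"
  have a: "?a \<in> ?C \<and> h ?a = h' ?a"
    by (rule *) (use tens_in_carrier[OF L mon(1) co(1)] eq[OF mon(1) co(1)] in auto)
  have b: "?b \<in> ?C \<and> h ?b = h' ?b"
    by (rule *) (use tens_in_carrier[OF L mon(2) co(2)] eq[OF mon(2) co(2)] in auto)
  show ?thesis
    using a b h h' by (subst (1 2) reg_decompose) auto
qed

lemma tens_universal:
  fixes \<beta> :: "'c::field reg \<Rightarrow> 'c \<Rightarrow> 'm::ab_group_add"
  assumes L: "is_subring L" "const_field X \<subseteq> L" and F: "is_subring (const_field X)"
    and b1: "\<And>a b c. a \<in> carrier (ring_A X) \<Longrightarrow> b \<in> carrier (ring_A X) \<Longrightarrow> c \<in> L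
           \<Longrightarrow> \<beta> (a + b) c = \<beta> a c + \<beta> b c"
    and b2: "\<And>a c d. a \<in> carrier (ring_A X) \<Longrightarrow> c \<in> L \<Longrightarrow> d \<in> L
           \<Longrightarrow> \<beta> a (c + d) = \<beta> a c + \<beta> a d"
    and b3: "\<And>a c r. a \<in> carrier (ring_A X) \<Longrightarrow> c \<in> L \<Longrightarrow> r \<in> const_field X
           \<Longrightarrow> \<beta> (tens a r) c = \<beta> a (r * c)"
  shows "\<exists>h. (\<forall>x\<in>carrier (coord_ring X L). \<forall>y\<in>carrier (coord_ring X L). h (x + y) = h x + h y) \<and>
             (\<forall>a\<in>carrier (ring_A X). \<forall>c\<in>L. h (tens a c) = \<beta> a c)"
proof -
  define S1 where "S1 n p = (\<Sum>i\<le>n. \<beta> (monom 1 i, 0) (coeff p i))" for n p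
  define S2 where "S2 n p = (\<Sum>i\<le>n. \<beta> (0, monom 1 i) (coeff p i))" for n p
  define h where "h x = S1 (degree (fst x)) (fst x) + S2 (degree (snd x)) (snd x)" for x
  have mon: "(monom 1 i, 0) \<in> carrier (ring_A X)" "(0, monom 1 i) \<in> carrier (ring_A X)" for i
    using polys_over_closed[OF F] by (auto simp: coord_ring_def)
  have L0: "0 \<in> L" using is_subringD[OF L(1)] by blast
  have z: "\<beta> a 0 = 0" if "a \<in> carrier (ring_A X)" for a using b2[OF that L0 L0] by simp
  have ext1: "S1 (degree p) p = S1 n p" if "degree p \<le> n" for p n
    unfolding S1_def by (rule sum.mono_neutral_left) (use that z mon in \<open>auto simp: coeff_eq_0\<close>)
  have ext2: "S2 (degree p) p = S2 n p" if "degree p \<le> n" for p n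
    unfolding S2_def by (rule sum.mono_neutral_left) (use that z mon in \<open>auto simp: coeff_eq_0\<close>)
  have add1: "S1 n (p + r) = S1 n p + S1 n r" "S2 n (p + r) = S2 n p + S2 n r"
    if "p \<in> polys_over L" "r \<in> polys_over L" for n p r
    using that b2 mon by (auto simp: S1_def S2_def polys_over_def sum.distrib)
  have "h (x + y) = h x + h y"
    if "x \<in> carrier (coord_ring X L)" "y \<in> carrier (coord_ring X L)" for x y
  proof -
    have m: "fst x \<in> polys_over L" "snd x \<in> polys_over L" "fst y \<in> polys_over L" "snd y \<in> polys_over L"
      using that by (auto simp: coord_ring_def)
    define n1 where "n1 = max (degree (fst x)) (degree (fst y))"
    define n2 where "n2 = max (degree (snd x)) (degree (snd y))"
    have d: "degree (fst x) \<le> n1" "degree (fst y) \<le> n1" "degree (fst x + fst y) \<le> n1"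
      "degree (snd x) \<le> n2" "degree (snd y) \<le> n2" "degree (snd x + snd y) \<le> n2"
      by (auto simp: n1_def n2_def degree_add_le)
    show ?thesis
      unfolding h_def fst_add snd_add ext1[OF d(1)] ext1[OF d(2)] ext1[OF d(3)]
        ext2[OF d(4)] ext2[OF d(5)] ext2[OF d(6)]
      using m by (simp add: add1)
  qed
  moreover have "h (tens a c) = \<beta> a c" if a: "a \<in> carrier (ring_A X)" and c: "c \<in> L" for a c
  proof -
    let ?A = "carrier (ring_A X)"
    have A0: "0 \<in> ?A" and Aadd: "\<And>x y. x \<in> ?A \<Longrightarrow> y \<in> ?A \<Longrightarrow> x + y \<in> ?A"
      using polys_over_closed[OF F] by (auto simp: coord_ring_def zero_prod_def)
    have add: "sum f {..n} \<in> ?A \<and> \<beta> (sum f {..n}) c = (\<Sum>i\<le>n. \<beta> (f i) c)"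
      if "\<And>i. f i \<in> ?A" for f :: "nat \<Rightarrow> 'c reg" and n
      by (induction n) (use that Aadd b1 c in auto)
    have co: "coeff (fst a) i \<in> const_field X" "coeff (snd a) i \<in> const_field X" for i
      using a by (auto simp: coord_ring_def polys_over_def)
    note tA = tens_in_carrier[OF F order_refl]
    let ?f = "\<lambda>i. tens (monom 1 i, 0) (coeff (fst a) i)"
    let ?g = "\<lambda>i. tens (0, monom 1 i) (coeff (snd a) i)"
    have f: "\<And>i. ?f i \<in> ?A" and g: "\<And>i. ?g i \<in> ?A" using tA mon co by auto
    have "\<beta> a c = \<beta> (sum ?f {..degree (fst a)} + sum ?g {..degree (snd a)}) c"
      by (subst reg_decompose[of a]) simp
    also have "\<dots> = (\<Sum>i\<le>degree (fst a). \<beta> (?f i) c) + (\<Sum>i\<le>degree (snd a). \<beta> (?g i) c)"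
      using add[OF f] add[OF g] b1 c by simp
    also have "\<dots> = S1 (degree (fst a)) (smult c (fst a)) + S2 (degree (snd a)) (smult c (snd a))"
      by (simp add: S1_def S2_def b3 mon co c mult.commute)
    also have "\<dots> = h (tens a c)"
      by (simp add: h_def tens_def ext1[OF degree_smult_le] ext2[OF degree_smult_le] del: degree_smult_eq)
    finally show ?thesis ..
  qed
  ultimately show ?thesis by blast
qed

end

theory Submission
  imports
    Defs
    "HOL-Analysis.Elementary_Metric_Spaces"
    "HOL-Computational_Algebra.Primes"
    "HOL-Number_Theory.Cong"
begin

text \<open>
  Write \<open>\<Lambda>\<close> for the period lattice, \<open>E\<close> for the exponential and \<open>\<chi>\<close> for the character. Grouping the
  nonzero \<open>a \<in> A\<close> by the torsion point \<open>v = E(a\<lambda>/B)\<close>, where \<open>B \<in> \<pp>\<close> is chosen such that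
  \<open>B\<Lambda> \<subseteq> \<pp>\<lambda>\<close>, the partial fraction expansion \<open>1/E(w) = \<Sum>\<^sub>l 1/(w+l)\<close> turns \<open>L(\<chi>,1)\<close> into a finite sum of
  terms \<open>\<lambda>\<chi>(a)/(Bv)\<close> over a finite cyclic module \<open>W\<close> of torsion points. The Gauss sum times \<open>\<chi>(a)\<close> is the
  value at \<open>v\<close> of a polynomial over \<open>\<bbbF>\<^sub>\<pp>H\<close>, so that \<open>L(\<chi>,1)g(\<chi>,\<psi>\<^sub>\<lambda>)/\<lambda>\<close> is a symmetric function of the
  points of \<open>W\<close>. It lies in \<open>\<bbbF>\<^sub>\<pp>H\<close> as soon as the polynomial with roots \<open>W\<close> has coefficients in \<open>H\<close>.

  The latter, as well as the nonvanishing of the Gauss sum, comes from the hypothesis on \<open>V\<close>. This divisor is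
  a single point \<open>(\<alpha>,\<beta>)\<close>, characterized by \<open>\<tau>\<phi>\<^sub>t \<in> \<alpha>\<tau> + \<Sum>\<^sub>a H\<phi>\<^sub>a\<close>, and the hypothesis says \<open>|\<alpha>| > 1\<close>. Since
  \<open>t\<close> acts on \<open>W\<close> and on residue fields with eigenvalues in \<open>\<bbbF>bar\<close>, hence different from \<open>\<alpha>\<close>, the Frobenius
  can there be expressed through the \<open>\<phi>\<^sub>a\<close>. The same relation compares the Gauss sums of \<open>\<chi>\<close> and of its
  Frobenius twists, which reduces \<open>L(\<chi>,q\<^sup>n)\<close> to the value at 1 for a twist of \<open>\<chi>\<close>.
\<close>

section \<open>Non-archimedean absolute values\<close>

text \<open>Three reasons behind the steps. The field is not assumed algebraically closed; only the
  closure of K inside it is, and that is dense. The torsion polynomials, on whose splitting the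
  partial fraction expansion rests, are therefore split by approximation. The point of V arises
  because \<phi>_a has degree in \<tau> equal to the pole order of a, and the pole orders are all
  numbers except 1. So the motive modulo (A \<otimes> H) id is a line spanned by \<tau>, on which A
  acts through a ring homomorphism A -> H, a point of the curve. The ideal of V annihilates the
  line, hence vanishes at this point. If |\<alpha>| <= 1, evaluation there is bounded by the norm
  and extends to the Tate algebra, which would put the point into its spectrum. The Gauss sum is
  nonzero because \<psi>(1) = E(z lam) is, and that is what keeping \<open>lam\<close> out of
  \<pp>\<Lambda> ensures.\<close>

lemma dist_eq_absv: "dist x y = absv (x - y)"
  unfolding absv_def by (rule dist_diff)

lemma absv_nonneg [simp]: "0 \<le> absv x"
  by (simp add: absv_def)

lemma absv_not_neg [simp]: "\<not> absv x < 0"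
  by (simp add: absv_def)

lemma absv_eq_0_iff [simp]: "absv x = 0 \<longleftrightarrow> x = 0"
  by (simp add: absv_def)

lemma absv_0 [simp]: "absv 0 = 0"
  by simp

lemma absv_pos_iff [simp]: "0 < absv x \<longleftrightarrow> x \<noteq> 0"
  by (simp add: absv_def)

lemma absv_mult: "absv (x * y) = absv x * absv y"
  by (simp add: absv_def dist_mult_0)

lemma absv_1 [simp]: "absv (1 :: 'c::complete_nonarch_field) = 1"
proof -
  have "absv (1 :: 'c) * absv (1 :: 'c) = absv (1 :: 'c)" by (simp flip: absv_mult)
  then show ?thesis using absv_eq_0_iff[of "1 :: 'c"] by auto
qed

lemma absv_minus [simp]: "absv (- x) = absv x"
  using dist_commute[of x 0] by (simp add: dist_eq_absv)

lemma absv_minus_commute: "absv (x - y) = absv (y - x)"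
  by (metis absv_minus minus_diff_eq)

lemma absv_add_le: "absv (x + y) \<le> max (absv x) (absv y)"
  by (simp add: absv_def dist_add_0_ultra)

lemma absv_add_le_bound: "absv x \<le> b \<Longrightarrow> absv y \<le> b \<Longrightarrow> absv (x + y) \<le> b"
  using absv_add_le[of x y] by linarith

lemma absv_diff_le_bound: "absv x \<le> b \<Longrightarrow> absv y \<le> b \<Longrightarrow> absv (x - y) \<le> b"
  using absv_add_le_bound[of x b "- y"] by simp

lemma absv_add_less_bound: "absv x < b \<Longrightarrow> absv y < b \<Longrightarrow> absv (x + y) < b"
  using absv_add_le[of x y] by linarith

lemma absv_diff_less_bound: "absv x < b \<Longrightarrow> absv y < b \<Longrightarrow> absv (x - y) < b"
  using absv_add_less_bound[of x b "- y"] by simp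

lemma absv_add_dominant: "absv x < absv y \<Longrightarrow> absv (x + y) = absv y"
  using absv_add_le[of x y] absv_diff_le_bound[of "x + y" "max (absv (x + y)) (absv x)" x] by auto

lemma absv_sum_le_bound:
  assumes "\<And>i. i \<in> I \<Longrightarrow> absv (f i) \<le> b" "0 \<le> b"
  shows "absv (sum f I) \<le> b"
  using assms by (induction I rule: infinite_finite_induct) (auto intro: absv_add_le_bound)

lemma absv_power: "absv (x ^ n) = absv x ^ n"
  by (induction n) (auto simp: absv_mult)

lemma absv_inverse: "absv (inverse x) = inverse (absv x)"
proof (cases "x = 0")
  case False
  then have "absv (inverse x) * absv x = 1" by (simp flip: absv_mult)
  then show ?thesis by (metis inverse_unique mult.commute)
qed simp

lemma absv_divide: "absv (x / y) = absv x / absv y"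
  by (simp add: divide_inverse absv_mult absv_inverse)

text \<open>This instance and the next open the theory of infinite sums: regrouping a series over
  disjoint pieces uses continuity of addition, scaling it uses continuity of multiplication.\<close>

instance complete_nonarch_field \<subseteq> topological_ab_group_add
proof
  fix a b :: 'a
  let ?F = "nhds a \<times>\<^sub>F nhds b"
  have "((\<lambda>x. dist (fst x) a + dist (snd x) b) \<longlongrightarrow> dist a a + dist b b) ?F"
    by (intro tendsto_add tendsto_dist tendsto_const filterlim_fst filterlim_snd)
  moreover have "dist (x + y) (a + b) \<le> dist x a + dist y b" for x y
    using absv_add_le[of "x - a" "y - b"] absv_nonneg[of "x - a"] absv_nonneg[of "y - b"]
    unfolding dist_eq_absv add_diff_add by linarith
  ultimately have "((\<lambda>x. dist (fst x + snd x) (a + b)) \<longlongrightarrow> 0) ?F"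
    by - (rule tendsto_sandwich[where f = "\<lambda>_. 0" and h = "\<lambda>x. dist (fst x) a + dist (snd x) b"], simp_all)
  then show "((\<lambda>x. fst x + snd x) \<longlongrightarrow> a + b) ?F"
    by (subst tendsto_dist_iff)
  have "dist (- x) (- a) = dist x a" for x
    by (simp add: dist_eq_absv absv_minus_commute)
  moreover have "((\<lambda>x. dist x a) \<longlongrightarrow> dist a a) (nhds a)"
    by (intro tendsto_dist tendsto_const filterlim_ident)
  ultimately show "(uminus \<longlongrightarrow> - a) (nhds a)"
    by (subst tendsto_dist_iff) simp
qed

instance complete_nonarch_field \<subseteq> topological_semigroup_mult
proof
  fix a b :: 'a
  let ?F = "nhds a \<times>\<^sub>F nhds b"
  have "((\<lambda>x. dist (fst x) a * dist (snd x) 0 + dist a 0 * dist (snd x) b) \<longlongrightarrow> dist a a * dist b 0 + dist a 0 * dist b b) ?F"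
    by (intro tendsto_add tendsto_mult tendsto_dist tendsto_const filterlim_fst filterlim_snd)
  moreover have "dist (x * y) (a * b) \<le> dist x a * dist y 0 + dist a 0 * dist y b" for x y
  proof -
    have "absv (x * y - a * b) = absv ((x - a) * y + a * (y - b))" by (simp add: algebra_simps)
    also have "\<dots> \<le> max (absv ((x - a) * y)) (absv (a * (y - b)))" by (rule absv_add_le)
    also have "\<dots> \<le> absv ((x - a) * y) + absv (a * (y - b))" by simp
    finally show ?thesis by (simp add: dist_eq_absv absv_mult)
  qed
  ultimately have "((\<lambda>x. dist (fst x * snd x) (a * b)) \<longlongrightarrow> 0) ?F"
    by - (rule tendsto_sandwich[where f = "\<lambda>_. 0" and h = "\<lambda>x. dist (fst x) a * dist (snd x) 0 + dist a 0 * dist (snd x) b"], simp_all)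
  then show "((\<lambda>x. fst x * snd x) \<longlongrightarrow> a * b) ?F"
    by (subst tendsto_dist_iff)
qed

text \<open>Banach's fixed point theorem on the ball of radius \<open>absv x\<close>.\<close>

lemma local_inverse:
  fixes g :: "'c::complete_nonarch_field \<Rightarrow> 'c"
  assumes add: "\<And>s s'. g (s - s') = g s - g s'"
    and near: "\<And>s. absv s \<le> absv x \<Longrightarrow> absv (g s - s) \<le> c * absv s"
    and c: "0 \<le> c" "c < 1"
  shows "\<exists>s. absv s \<le> absv x \<and> g s = x"
proof -
  let ?B = "cball (0::'c) (absv x)"
  let ?h = "\<lambda>s. x - (g s - s)"
  have B: "s \<in> ?B \<longleftrightarrow> absv s \<le> absv x" for s
    by (simp add: dist_eq_absv absv_minus_commute[of 0])
  have "\<exists>!s. s \<in> ?B \<and> ?h s = s"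
  proof (rule Banach_fix[of ?B c ?h])
    show "?h ` ?B \<subseteq> ?B"
    proof safe
      fix s assume s: "s \<in> ?B"
      have "absv (g s - s) \<le> 1 * absv s"
        using near[of s] s c B mult_right_mono[of c 1 "absv s"] by auto
      then show "?h s \<in> ?B"
        using s unfolding B by (intro absv_diff_le_bound[of x "absv x" "g s - s"]) linarith+
    qed
    \<comment> \<open>Since \<open>g\<close> is additive, the bound \<open>near\<close> at the
      single point \<open>s - s'\<close> is already a Lipschitz bound for \<open>?h\<close>.\<close>
    show "dist (?h s) (?h s') \<le> c * dist s s'" if "s \<in> ?B" "s' \<in> ?B" for s s'
    proof -
      have "absv (s - s') \<le> absv x" using that unfolding B by (rule absv_diff_le_bound)
      then have "absv (g (s - s') - (s - s')) \<le> c * absv (s - s')" by (rule near)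
      moreover have "?h s - ?h s' = - (g (s - s') - (s - s'))" by (simp add: add algebra_simps)
      ultimately show ?thesis unfolding dist_eq_absv by (metis absv_minus)
    qed
  qed (use c in \<open>auto simp: complete_eq_closed\<close>)
  then obtain s where "s \<in> ?B" "x - (g s - s) = s" by blast
  then show ?thesis using B by (intro exI[of _ s]) (auto simp: algebra_simps)
qed

text \<open>For a + X r the difference of two values is (x - y) r(x) + y (r(x) - r(y)), which
  involves both the size and the increments of the tail r. Hence the two bounds are proved
  together.\<close>

lemma poly_lipschitz_on_ball:
  fixes p :: "'c::complete_nonarch_field poly"
  assumes "1 \<le> M"
  shows "\<exists>C\<ge>0. \<forall>x y. absv x \<le> M \<longrightarrow> absv y \<le> M \<longrightarrow> absv (poly p x) \<le> C \<and> absv (poly p x - poly p y) \<le> C * absv (x - y)"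
proof (induction p)
  case (pCons a p)
  then obtain C where C: "C \<ge> 0" and h: "\<And>x y. absv x \<le> M \<Longrightarrow> absv y \<le> M \<Longrightarrow>
      absv (poly p x) \<le> C \<and> absv (poly p x - poly p y) \<le> C * absv (x - y)" by blast
  let ?C = "absv a + M * C"
  show ?case
  proof (intro exI[of _ ?C] conjI allI impI)
    have MC: "0 \<le> M * C" using C assms by simp
    show "0 \<le> ?C" using MC by (simp add: add_nonneg_nonneg)
    fix x y :: 'c assume x: "absv x \<le> M" and y: "absv y \<le> M"
    have 1: "absv (x * poly p x) \<le> M * C"
      unfolding absv_mult using h[OF x y] x C assms by (intro mult_mono) auto
    then show "absv (poly (pCons a p) x) \<le> ?C"
      using MC by (auto intro!: absv_add_le_bound simp: add_increasing)
    have "poly (pCons a p) x - poly (pCons a p) y = (x - y) * poly p x + y * (poly p x - poly p y)"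
      by (simp add: algebra_simps)
    moreover have "absv ((x - y) * poly p x) \<le> ?C * absv (x - y)"
    proof -
      have "absv (x - y) * absv (poly p x) \<le> absv (x - y) * ?C"
      proof (intro mult_left_mono)
        have "C \<le> M * C" using C assms mult_right_mono[of 1 M C] by simp
        then show "absv (poly p x) \<le> ?C" using h[OF x y] absv_nonneg[of a] by linarith
      qed simp
      then show ?thesis by (simp add: absv_mult mult.commute)
    qed
    moreover have "absv (y * (poly p x - poly p y)) \<le> ?C * absv (x - y)"
    proof -
      have "absv y * absv (poly p x - poly p y) \<le> M * (C * absv (x - y))"
        using h[OF x y] y assms by (intro mult_mono) auto
      also have "\<dots> \<le> ?C * absv (x - y)"
        unfolding mult.assoc[symmetric] by (intro mult_right_mono) auto
      finally show ?thesis by (simp add: absv_mult)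
    qed
    ultimately show "absv (poly (pCons a p) x - poly (pCons a p) y) \<le> ?C * absv (x - y)"
      by (auto intro: absv_add_le_bound)
  qed
qed (auto intro: exI[of _ 0])

text \<open>Replacing the lower coefficients of \<open>p\<close> by nearby elements of
  \<open>D\<close> gives a polynomial with an exact root, at which \<open>p\<close> is small. The
  root stays in a ball that does not depend on the precision.\<close>

lemma approximate_root:
  fixes p :: "'c::complete_nonarch_field poly"
  assumes dense: "closure D = (UNIV :: 'c set)" and one: "1 \<in> D" "0 \<in> D"
    and root: "\<And>p. p \<in> polys_over D \<Longrightarrow> degree p > 0 \<Longrightarrow> \<exists>x. poly p x = 0"
    and p: "lead_coeff p = 1" "degree p > 0"
  shows "\<exists>M\<ge>1. \<forall>\<epsilon>>0. \<exists>x. absv x \<le> M \<and> absv (poly p x) < \<epsilon>"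
proof -
  define n where "n = degree p"
  \<comment> \<open>A root bound for every monic polynomial of this degree whose lower coefficients
    are within 1 of those of \<open>p\<close>.\<close>
  define M where "M = 1 + (\<Sum>i\<le>n. absv (coeff p i))"
  have M: "M \<ge> 1" unfolding M_def by (simp add: sum_nonneg)
  have cM: "absv (coeff p i) \<le> M" if "i \<le> n" for i
    using member_le_sum[of i "{..n}" "\<lambda>i. absv (coeff p i)"] that by (simp add: M_def)
  have "\<exists>x. absv x \<le> M \<and> absv (poly p x) < \<epsilon>" if e: "\<epsilon> > 0" for \<epsilon>
  proof -
    \<comment> \<open>The bound 1 keeps the perturbed coefficients below \<open>M\<close>; the other
      makes the error \<delta> M^n at the root less than \<epsilon>.\<close>
    define \<delta> where "\<delta> = min 1 (\<epsilon> / (2 * M ^ n))"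
    have \<delta>: "\<delta> > 0" "\<delta> \<le> 1" "\<delta> * M ^ n < \<epsilon>" using e M by (auto simp: \<delta>_def min_def field_simps)
    have "\<exists>d\<in>D. absv (coeff p i - d) < \<delta>" for i
    proof -
      have "coeff p i \<in> closure D" using dense by simp
      then obtain d where "d \<in> D" "dist d (coeff p i) < \<delta>"
        using \<delta>(1) by (auto simp: closure_approachable)
      then show ?thesis by (auto simp: dist_eq_absv absv_minus_commute)
    qed
    then obtain d where d: "\<And>i. d i \<in> D" "\<And>i. absv (coeff p i - d i) < \<delta>" by metis
    define r where "r = monom 1 n + (\<Sum>i<n. monom (d i) i)"
    have cr: "coeff r i = (if i = n then 1 else if i < n then d i else 0)" for i
      by (auto simp: r_def coeff_sum)
    have "degree r = n"
      by (intro antisym degree_le le_degree) (auto simp: cr)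
    have "r \<in> polys_over D" using d one by (auto simp: polys_over_def cr)
    then obtain x where x: "poly r x = 0" using root[of r] \<open>degree r = n\<close> p(2) n_def by auto
    have diff: "absv (coeff p i - coeff r i) \<le> \<delta>" for i
      using d(2)[of i] p \<delta>(1) by (auto simp: cr n_def[symmetric] coeff_eq_0)
    have xM: "absv x \<le> M"
    proof (rule ccontr)
      assume "\<not> absv x \<le> M"
      then have x1: "absv x > M" "absv x > 1" "absv x > 0" using M by auto
      have "0 = x ^ n + (\<Sum>i<n. d i * x ^ i)"
        using x by (simp add: r_def poly_monom poly_sum)
      then have "x ^ n = - (\<Sum>i<n. d i * x ^ i)" by (simp add: eq_neg_iff_add_eq_0)
      then have "absv x ^ n = absv (\<Sum>i<n. d i * x ^ i)" by (metis absv_minus absv_power)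
      also have "\<dots> \<le> M * absv x ^ (n - 1)"
      proof (rule absv_sum_le_bound)
        fix i assume i: "i \<in> {..<n}"
        have "absv (d i) \<le> M"
          using absv_diff_le_bound[of "coeff p i" M "coeff p i - d i"] d(2)[of i] cM[of i] i \<delta>(2) M by auto
        then show "absv (d i * x ^ i) \<le> M * absv x ^ (n - 1)"
          unfolding absv_mult absv_power using i x1 M by (intro mult_mono power_increasing) auto
      qed (use M in auto)
      also have "\<dots> < absv x * absv x ^ (n - 1)" using x1 by (intro mult_strict_right_mono) auto
      also have "\<dots> = absv x ^ n" using p(2) power_minus_mult[of n "absv x"] by (simp add: n_def mult.commute)
      finally show False by simp
    qed
    have "poly p x = poly (p - r) x" using x by simp
    also have "\<dots> = (\<Sum>i\<le>n. coeff (p - r) i * x ^ i)"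
    proof -
      have "degree (p - r) \<le> n" using degree_diff_le[of p n r] \<open>degree r = n\<close> n_def by simp
      then show ?thesis
        unfolding poly_altdef
        by (intro sum.mono_neutral_left) (auto intro: le_degree)
    qed
    also have "absv \<dots> \<le> \<delta> * M ^ n"
    proof (rule absv_sum_le_bound)
      fix i assume i: "i \<in> {..n}"
      have "absv x ^ i \<le> M ^ i" using xM by (intro power_mono) auto
      also have "\<dots> \<le> M ^ n" using i M by (intro power_increasing) auto
      finally show "absv (coeff (p - r) i * x ^ i) \<le> \<delta> * M ^ n"
        unfolding absv_mult absv_power using diff[of i] \<delta> by (intro mult_mono) auto
    qed (use M \<delta> in auto)
    finally show ?thesis using xM \<delta>(3) by auto
  qed
  then show ?thesis using M by blast
qed

lemma prod_linear_factors_dvd: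
  fixes f :: "'a::field poly"
  assumes "finite U" "\<And>v. v \<in> U \<Longrightarrow> poly f v = 0"
  shows "(\<Prod>v\<in>U. [:- v, 1:]) dvd f"
  using assms
proof (induction U rule: finite_induct)
  case (insert v U)
  then obtain Q where Q: "f = (\<Prod>v\<in>U. [:- v, 1:]) * Q" by (auto elim: dvdE)
  moreover have "poly (\<Prod>v\<in>U. [:- v, 1:]) v \<noteq> 0"
    using insert by (auto simp: poly_prod)
  ultimately have "poly Q v = 0" using insert.prems[of v] by auto
  then have "[:- v, 1:] dvd Q" by (simp add: poly_eq_0_iff_dvd)
  then have "[:- v, 1:] * (\<Prod>v\<in>U. [:- v, 1:]) dvd f"
    unfolding Q mult.commute[of _ Q] by (rule mult_dvd_mono) simp
  then show ?case using insert.hyps by (simp del: mult_pCons_left)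
qed simp

text \<open>A separable additive polynomial splits. Write \<open>f = (\<Prod>v\<in>U. X - v) * Q\<close> over its roots \<open>U\<close>.
  An approximate root \<open>w\<close> of \<open>Q\<close> is an approximate root of \<open>f\<close>, hence by local inversion close to
  some \<open>v \<in> U\<close>; but \<open>Q\<close> does not vanish on \<open>U\<close> because the roots of \<open>f\<close> are simple.\<close>

lemma card_roots_additive_poly:
  fixes f :: "'c::complete_nonarch_field poly"
  assumes dense: "closure D = (UNIV :: 'c set)" "1 \<in> D" "0 \<in> D"
    and root: "\<And>p. p \<in> polys_over D \<Longrightarrow> degree p > 0 \<Longrightarrow> \<exists>x. poly p x = 0"
    and monic: "lead_coeff f = 1" and der: "pderiv f = [:c:]" "c \<noteq> 0"
    and add: "\<And>x y. poly f (x - y) = poly f x - poly f y"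
  shows "f = (\<Prod>v | poly f v = 0. [:- v, 1:])"
proof -
  define U where "U = {v. poly f v = 0}"
  have f0: "f \<noteq> 0" using monic by auto
  have finU: "finite U" unfolding U_def by (rule poly_roots_finite[OF f0])
  define P where "P = (\<Prod>v\<in>U. [:- v, 1:])"
  have "P dvd f" unfolding P_def
    using finU by (rule prod_linear_factors_dvd) (auto simp: U_def)
  then obtain Q where Q: "f = P * Q" by (auto elim: dvdE)
  have lP: "lead_coeff P = 1" unfolding P_def by (simp add: lead_coeff_prod)
  have lQ: "lead_coeff Q = 1" using monic Q lP by (simp add: lead_coeff_mult)
  have Qv: "poly Q v \<noteq> 0" if "v \<in> U" for v
  proof
    assume "poly Q v = 0"
    moreover have "poly P v = 0" using that finU by (auto simp: P_def poly_prod)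
    ultimately have "poly (pderiv f) v = 0" by (simp add: Q pderiv_mult)
    then show False using der by simp
  qed
  have "degree Q = 0"
  proof (rule ccontr)
    assume "degree Q \<noteq> 0"
    then obtain M where M: "M \<ge> 1" "\<And>\<epsilon>. \<epsilon> > 0 \<Longrightarrow> \<exists>x. absv x \<le> M \<and> absv (poly Q x) < \<epsilon>"
      using approximate_root[OF dense root lQ] by blast
    have f0: "poly f 0 = 0" using add[of 0 0] by simp
    then have U0: "0 \<in> U" by (simp add: U_def)
    define M' where "M' = M + (\<Sum>v\<in>U. absv v)"
    have M': "1 \<le> M'" "M \<le> M'" using M by (auto simp: M'_def sum_nonneg add_increasing2)
    have UM: "absv v \<le> M'" if "v \<in> U" for v
      using member_le_sum[of v U absv] that finU M by (simp add: M'_def)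
    obtain CQ where CQ: "CQ \<ge> 0" "\<And>x y. absv x \<le> M' \<Longrightarrow> absv y \<le> M' \<Longrightarrow>
        absv (poly Q x - poly Q y) \<le> CQ * absv (x - y)"
      using poly_lipschitz_on_ball[OF M'(1), of Q] by blast
    obtain CP where CP: "CP \<ge> 0" "\<And>x. absv x \<le> M' \<Longrightarrow> absv (poly P x) \<le> CP"
      using poly_lipschitz_on_ball[OF M'(1), of P] by blast
    define \<delta> where "\<delta> = Min ((\<lambda>v. absv (poly Q v)) ` U)"
    have "\<delta> \<in> (\<lambda>v. absv (poly Q v)) ` U"
      unfolding \<delta>_def using finU U0 by (intro Min_in) auto
    then have \<delta>: "\<delta> > 0" "\<And>v. v \<in> U \<Longrightarrow> \<delta> \<le> absv (poly Q v)"
      using finU Qv by (auto simp: \<delta>_def)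
    obtain R where R: "f = pCons 0 (pCons c R)"
    proof -
      obtain a g where g: "f = pCons a g" by (cases f)
      obtain b R where R: "g = pCons b R" by (cases g)
      have "a = 0" using f0 g by simp
      moreover have "b = c" using arg_cong[OF der(1), of "\<lambda>p. coeff p 0"]
        by (simp add: g R coeff_pderiv)
      ultimately show ?thesis using that g R by simp
    qed
    obtain CR where CR: "CR \<ge> 0" "\<And>x. absv x \<le> 1 \<Longrightarrow> absv (poly R x) \<le> CR"
      using poly_lipschitz_on_ball[OF order_refl, of R] by blast
    have c0: "absv c > 0" using der by simp
    \<comment> \<open>With f = c X + X^2 R, the map f/c differs from the identity by at most |s| r
      CR / |c| <= |s|/2 on the ball of radius \<open>r\<close>, as \<open>local_inverse\<close>
      requires.\<close>
    define r where "r = min 1 (absv c / (2 * (CR + 1)))"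
    have r: "r > 0" "r \<le> 1" "r * CR \<le> absv c / 2"
    proof -
      show "r > 0" "r \<le> 1" using c0 CR(1) by (auto simp: r_def)
      have "r * CR \<le> absv c / (2 * (CR + 1)) * CR" using CR(1) by (intro mult_right_mono) (auto simp: r_def)
      also have "\<dots> \<le> absv c / 2" using c0 CR(1) by (simp add: field_simps)
      finally show "r * CR \<le> absv c / 2" .
    qed
    \<comment> \<open>The three bounds in turn: |Q(w)| is below \<delta>; f(w)/c falls into the ball
      where f/c can be inverted; and moving from w to the exact root w - s changes Q by less than
      \<delta>. Together they give |Q(w - s)| < \<delta>, below the minimum of |Q| on
      \<open>U\<close>.\<close>
    define \<epsilon> where "\<epsilon> = min (\<delta> / 2) (min (r * absv c / (CP + 1)) (\<delta> * absv c / (2 * (CQ * CP + 1))))"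
    have CQP: "CQ * CP \<ge> 0" using CQ(1) CP(1) by simp
    have \<epsilon>: "\<epsilon> > 0" "\<epsilon> < \<delta>" "CP * \<epsilon> \<le> r * absv c" "CQ * (CP * \<epsilon>) < \<delta> * absv c"
    proof -
      show e: "\<epsilon> > 0" "\<epsilon> < \<delta>" using \<delta> r c0 CP(1) CQP by (auto simp: \<epsilon>_def min_less_iff_disj)
      have "\<epsilon> \<le> r * absv c / (CP + 1)" by (simp add: \<epsilon>_def)
      then have "\<epsilon> * (CP + 1) \<le> r * absv c" using CP(1) by (simp add: pos_le_divide_eq)
      then show "CP * \<epsilon> \<le> r * absv c" using e by (simp add: algebra_simps)
      have "\<epsilon> \<le> \<delta> * absv c / (2 * (CQ * CP + 1))" by (simp add: \<epsilon>_def)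
      then have "\<epsilon> * (2 * (CQ * CP + 1)) \<le> \<delta> * absv c" using CQP by (simp add: pos_le_divide_eq)
      moreover have "CQ * (CP * \<epsilon>) < \<epsilon> * (2 * (CQ * CP + 1))"
      proof -
        have "\<epsilon> * (2 * (CQ * CP + 1)) = CQ * (CP * \<epsilon>) + \<epsilon> * (CQ * CP) + 2 * \<epsilon>" by (simp add: algebra_simps)
        moreover have "\<epsilon> * (CQ * CP) \<ge> 0" using e CQP by simp
        ultimately show ?thesis using e by linarith
      qed
      ultimately show "CQ * (CP * \<epsilon>) < \<delta> * absv c" by linarith
    qed
    obtain w where w: "absv w \<le> M" "absv (poly Q w) < \<epsilon>" using M(2)[OF \<epsilon>(1)] by blast
    have wM: "absv w \<le> M'" using w M' by linarith
    have "absv (poly f w) = absv (poly P w) * absv (poly Q w)" by (simp add: Q absv_mult)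
    also have "\<dots> \<le> CP * \<epsilon>" using CP wM w by (intro mult_mono) auto
    finally have fw: "absv (poly f w) \<le> CP * \<epsilon>" .
    let ?x = "poly f w / c"
    have xr: "absv ?x \<le> r" using fw \<epsilon>(3) c0 by (simp add: absv_divide pos_divide_le_eq)
    have "\<exists>s. absv s \<le> absv ?x \<and> poly f s / c = ?x"
    proof (rule local_inverse[where c = "1/2"])
      fix s :: 'c assume "absv s \<le> absv ?x"
      then have s: "absv s \<le> r" "absv s \<le> 1" using xr r by auto
      have "poly f s / c - s = s * (s * poly R s) / c" using der by (simp add: R field_simps)
      then have "absv (poly f s / c - s) = absv s * (absv s * absv (poly R s)) / absv c"
        by (simp add: absv_mult absv_divide)
      also have "\<dots> \<le> absv s * (r * CR) / absv c"
        using s CR r by (intro divide_right_mono mult_left_mono mult_mono) auto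
      also have "\<dots> \<le> absv s * (absv c / 2) / absv c"
        using r by (intro divide_right_mono mult_left_mono) auto
      finally show "absv (poly f s / c - s) \<le> 1/2 * absv s" using c0 by simp
    qed (simp_all add: add diff_divide_distrib)
    then obtain s where s: "absv s \<le> absv ?x" "poly f s = poly f w" using der by auto
    have vU: "w - s \<in> U" using s by (simp add: U_def add)
    have "absv (poly Q w - poly Q (w - s)) \<le> CQ * absv s" using CQ(2)[OF wM UM[OF vU]] by simp
    also have "\<dots> \<le> CQ * (CP * \<epsilon> / absv c)"
    proof (intro mult_left_mono CQ(1))
      have "absv (poly f w) / absv c \<le> CP * \<epsilon> / absv c" using fw c0 by (intro divide_right_mono) auto
      then show "absv s \<le> CP * \<epsilon> / absv c" using s(1) by (simp add: absv_divide)
    qed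
    also have "\<dots> < \<delta>" using \<epsilon>(4) c0 by (simp add: pos_divide_less_eq)
    finally have "absv (poly Q w - (poly Q w - poly Q (w - s))) < \<delta>"
      using w(2) \<epsilon>(2) by - (rule absv_diff_less_bound, linarith+)
    then show False using \<delta>(2)[OF vU] by simp
  qed
  then have "Q = 1" using degree_0_id[of Q] lQ by (simp add: one_pCons)
  then show ?thesis using Q by (simp add: P_def U_def)
qed

section \<open>Finite subfields, subspaces and subrings of a field\<close>

lemma is_subfieldD:
  assumes "is_subfield S"
  shows "is_subring S" "x \<in> S \<Longrightarrow> inverse x \<in> S" "x \<in> S \<Longrightarrow> y \<in> S \<Longrightarrow> x / y \<in> S"
  using assms is_subringD(6)[of S] by (auto simp: is_subfield_def divide_inverse)

lemma power_in_subring: "is_subring S \<Longrightarrow> x \<in> S \<Longrightarrow> x ^ n \<in> S"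
  by (induction n) (auto simp: is_subringD)

lemma poly_in_subring:
  assumes "is_subring S" "p \<in> polys_over S" "x \<in> S"
  shows "poly p x \<in> S"
  using assms
  by (auto simp: poly_altdef polys_over_def intro!: sum_in_subring is_subringD(6) power_in_subring)

lemma is_subfield_hull: "is_subfield (is_subfield hull S)"
  unfolding hull_def is_subfield_def is_subring_def by auto

definition fspace :: "'c::field set \<Rightarrow> 'c set \<Rightarrow> bool" where
  "fspace F W \<longleftrightarrow> 0 \<in> W \<and> (\<forall>x\<in>W. \<forall>y\<in>W. x + y \<in> W) \<and> (\<forall>c\<in>F. \<forall>x\<in>W. c * x \<in> W)"

lemma fspace_sum:
  assumes "fspace F W" "\<And>i. i \<in> I \<Longrightarrow> c i \<in> F" "\<And>i. i \<in> I \<Longrightarrow> b i \<in> W"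
  shows "(\<Sum>i\<in>I. c i * b i) \<in> W"
  using assms(2,3)
  by (induction I rule: infinite_finite_induct) (use assms(1) in \<open>auto simp: fspace_def\<close>)

text \<open>Independence is expressed by counting: \<open>r\<close> vectors are independent iff they
  have \<open>card F ^ r\<close> combinations. The size of \<open>W\<close> bounds such
  \<open>r\<close>, and a family of maximal length spans, since a vector outside its span would
  multiply the number of combinations by \<open>card F\<close>.\<close>

lemma fspace_basis:
  assumes F: "is_subfield F" "finite F" and W: "fspace F W" "finite W"
  shows "\<exists>r b. (\<forall>i<r. b i \<in> W) \<and> W = {\<Sum>i<r. c i * b i | c. \<forall>i<r. c i \<in> F} \<and> card W = card F ^ r"
proof -
  note FD = is_subringD[OF is_subfieldD(1)[OF F(1)]] is_subfieldD[OF F(1)]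
  define Sp where "Sp b r = {\<Sum>i<r. c i * b i | c. \<forall>i<r. c i \<in> F}" for b :: "nat \<Rightarrow> 'a" and r :: nat
  define Q where "Q r \<longleftrightarrow> (\<exists>b. (\<forall>i<r. b i \<in> W) \<and> card (Sp b r) = card F ^ r)" for r
  have SpW: "Sp b r \<subseteq> W" if "\<forall>i<r. b i \<in> W" for b r
    using that by (auto simp: Sp_def intro!: fspace_sum[OF W(1)])
  have q2: "card F \<ge> 2"
  proof -
    have "card {0, 1::'a} \<le> card F" using FD F(2) by (intro card_mono) auto
    then show ?thesis by simp
  qed
  have bound: "r \<le> card W" if "Q r" for r
  proof -
    obtain b where b: "\<forall>i<r. b i \<in> W" "card (Sp b r) = card F ^ r"
      using \<open>Q r\<close> by (auto simp: Q_def)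
    have "r < 2 ^ r" by simp
    also have "(2::nat) ^ r \<le> card F ^ r" using q2 by (intro power_mono) auto
    also have "\<dots> \<le> card W" using card_mono[OF W(2) SpW[OF b(1)]] b(2) by simp
    finally show ?thesis by simp
  qed
  have "Q 0" by (simp add: Q_def Sp_def)
  then obtain r where r: "Q r" "\<And>k. Q k \<Longrightarrow> k \<le> r"
    using GreatestI_nat[of Q 0 "card W"] Greatest_le_nat[of Q _ "card W"] bound by blast
  obtain b where b: "\<forall>i<r. b i \<in> W" "card (Sp b r) = card F ^ r" using r(1) by (auto simp: Q_def)
  have "Sp b r = W"
  proof (rule ccontr)
    assume "Sp b r \<noteq> W"
    then obtain x where x: "x \<in> W" "x \<notin> Sp b r" using SpW[OF b(1)] by blast
    let ?b = "b(r := x)"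
    have Sp': "Sp ?b (Suc r) = (\<lambda>(s, c). s + c * x) ` (Sp b r \<times> F)"
    proof safe
      fix y assume "y \<in> Sp ?b (Suc r)"
      then obtain c where c: "\<forall>i<Suc r. c i \<in> F" "y = (\<Sum>i<Suc r. c i * ?b i)" by (auto simp: Sp_def)
      then have "y = (\<Sum>i<r. c i * b i) + c r * x" by simp
      moreover have "(\<Sum>i<r. c i * b i) \<in> Sp b r" "c r \<in> F" using c by (auto simp: Sp_def)
      ultimately show "y \<in> (\<lambda>(s, c). s + c * x) ` (Sp b r \<times> F)" by (auto intro!: image_eqI)
    next
      fix s d assume "s \<in> Sp b r" "d \<in> F"
      then obtain c where c: "\<forall>i<r. c i \<in> F" "s = (\<Sum>i<r. c i * b i)" by (auto simp: Sp_def)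
      then have "s + d * x = (\<Sum>i<Suc r. (c(r := d)) i * ?b i)" by simp
      then show "s + d * x \<in> Sp ?b (Suc r)"
        using c \<open>d \<in> F\<close> unfolding Sp_def by (auto intro!: exI[of _ "c(r := d)"] simp: less_Suc_eq)
    qed
    have lin: "c * y + c' * y' \<in> Sp b r" if yy: "y \<in> Sp b r" "y' \<in> Sp b r" and cc: "c \<in> F" "c' \<in> F" for c c' y y'
    proof -
      obtain d d' where d: "\<forall>i<r. d i \<in> F" "y = (\<Sum>i<r. d i * b i)" "\<forall>i<r. d' i \<in> F" "y' = (\<Sum>i<r. d' i * b i)"
        using yy by (auto simp: Sp_def)
      then have "c * y + c' * y' = (\<Sum>i<r. (c * d i + c' * d' i) * b i)"
        by (simp add: sum_distrib_left sum.distrib algebra_simps)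
      then show ?thesis using d cc FD unfolding Sp_def by (auto intro!: exI[of _ "\<lambda>i. c * d i + c' * d' i"])
    qed
    have "inj_on (\<lambda>(s, c). s + c * x) (Sp b r \<times> F)"
    proof (rule inj_onI, clarsimp)
      fix s c s' c' assume h: "s \<in> Sp b r" "c \<in> F" "s' \<in> Sp b r" "c' \<in> F" "s + c * x = s' + c' * x"
      have "c = c'"
      proof (rule ccontr)
        assume "c \<noteq> c'"
        have "(c - c') * x = s' - s" using h(5) by (simp add: algebra_simps)
        then have "x = inverse (c - c') * (s' - s)"
          using \<open>c \<noteq> c'\<close> by (metis eq_iff_diff_eq_0 left_inverse mult.assoc mult_1)
        then have "x = inverse (c - c') * s' + (- inverse (c - c')) * s" by (simp add: algebra_simps)
        moreover have "inverse (c - c') \<in> F" "- inverse (c - c') \<in> F" using h FD by auto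
        ultimately show False using lin[OF h(3) h(1)] x(2) by metis
      qed
      then show "s = s' \<and> c = c'" using h by simp
    qed
    then have "card (Sp ?b (Suc r)) = card F ^ Suc r"
      unfolding Sp' by (simp add: card_image b(2) card_cartesian_product mult.commute)
    then have "Q (Suc r)" using b(1) x(1) unfolding Q_def by (intro exI[of _ ?b]) (auto simp: less_Suc_eq)
    then show False using r(2) by force
  qed
  then show ?thesis using b unfolding Sp_def by (intro exI[of _ r] exI[of _ b]) auto
qed

text \<open>\<open>F\<close> is a vector space over its prime field, so its cardinality is a power
  of the characteristic; this is what makes raising to the power \<open>card F\<close>
  additive.\<close>

lemma card_finite_subfield:
  fixes F :: "'c::field set"
  assumes F: "is_subfield F" "finite F"
  shows "prime CHAR('c)" "\<exists>m. card F = CHAR('c) ^ m" "card F \<ge> 2" "of_nat (card F) = (0::'c)"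
proof -
  note FD = is_subringD[OF is_subfieldD(1)[OF F(1)]] is_subfieldD[OF F(1)]
  have ofF: "of_nat k \<in> F" for k by (induction k) (auto simp: FD)
  have "\<not> inj (of_nat :: nat \<Rightarrow> 'c)"
  proof
    assume "inj (of_nat :: nat \<Rightarrow> 'c)"
    then have "infinite (range (of_nat :: nat \<Rightarrow> 'c))" by (simp add: finite_image_iff)
    moreover have "range (of_nat :: nat \<Rightarrow> 'c) \<subseteq> F" using ofF by auto
    ultimately show False using F(2) finite_subset by blast
  qed
  then obtain i j where ij: "i \<noteq> j" "(of_nat i :: 'c) = of_nat j" by (auto simp: inj_def)
  have "\<exists>n>0. of_nat n = (0::'c)"
  proof (cases "i < j")
    case True then show ?thesis using ij by (intro exI[of _ "j - i"]) (simp add: of_nat_diff)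
  next
    case False then show ?thesis using ij by (intro exI[of _ "i - j"]) (simp add: of_nat_diff)
  qed
  then have pos: "CHAR('c) > 0" by (simp add: CHAR_pos_iff)
  then show pr: "prime CHAR('c)" by (rule prime_CHAR_semidom)
  define F0 where "F0 = (of_nat ` {..<CHAR('c)} :: 'c set)"
  have in0: "of_nat k \<in> F0" for k
  proof -
    have "(of_nat k :: 'c) = of_nat (k mod CHAR('c))"
      by (metis (no_types, lifting) add_cancel_left_left mult_div_mod_eq mult_eq_0_iff of_nat_CHAR of_nat_add of_nat_mult)
    then show ?thesis using pos by (auto simp: F0_def)
  qed
  have "is_subfield F0"
    unfolding is_subfield_def is_subring_def
  proof (intro conjI ballI)
    show "1 \<in> F0" using in0[of 1] by simp
    fix x assume "x \<in> F0"
    then obtain i where i: "x = of_nat i" "i < CHAR('c)" by (auto simp: F0_def)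
    show "inverse x \<in> F0"
    proof (cases "i = 0")
      case True then show ?thesis using i in0[of 0] by simp
    next
      case False
      then have "coprime i CHAR('c)" using pr i
        by (metis coprime_commute nat_dvd_not_less neq0_conv prime_imp_coprime)
      then obtain k where "[i * k = 1] (mod CHAR('c))" using cong_solve_coprime_nat by auto
      then have "(of_nat (i * k) :: 'c) = of_nat 1" by (simp only: of_nat_eq_iff_cong_CHAR)
      then have "inverse x = of_nat k" using i by (simp add: inverse_unique)
      then show ?thesis using in0 by simp
    qed
    fix y assume "y \<in> F0"
    then obtain j where j: "y = of_nat j" "j < CHAR('c)" by (auto simp: F0_def)
    show "x * y \<in> F0" using i j in0[of "i * j"] by simp
    have "x - y = of_nat (i + (CHAR('c) - j))" using i j by (simp add: of_nat_diff)
    then show "x - y \<in> F0" using in0 by metis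
  qed
  moreover have "finite F0" by (simp add: F0_def)
  moreover have "fspace F0 F" unfolding fspace_def F0_def using FD ofF by auto
  ultimately obtain r where "card F = card F0 ^ r" using fspace_basis[of F0 F] F by blast
  moreover have "card F0 = CHAR('c)"
    unfolding F0_def by (subst card_image) (auto simp: inj_on_def of_nat_eq_iff_cong_CHAR cong_def)
  ultimately show pw: "\<exists>m. card F = CHAR('c) ^ m" by metis
  have "card {0, 1::'c} \<le> card F" using FD F(2) by (intro card_mono) auto
  then show q2: "card F \<ge> 2" by simp
  obtain m where m: "card F = CHAR('c) ^ m" using pw by blast
  then show "of_nat (card F) = (0::'c)" using q2 by (cases m) auto
qed

lemma frobenius_add:
  fixes F :: "'c::field set"
  assumes F: "is_subfield F" "finite F"
  shows "(x + y :: 'c) ^ (card F ^ n) = x ^ (card F ^ n) + y ^ (card F ^ n)"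
proof -
  obtain m where m: "card F = CHAR('c) ^ m" using card_finite_subfield[OF F] by blast
  show ?thesis unfolding m power_mult[symmetric]
    by (rule freshmans_dream'[OF card_finite_subfield(1)[OF F]]) (rule refl)
qed

lemma frobenius_diff:
  fixes F :: "'c::field set"
  assumes F: "is_subfield F" "finite F"
  shows "(x - y :: 'c) ^ (card F ^ n) = x ^ (card F ^ n) - y ^ (card F ^ n)"
  using frobenius_add[OF F, of "x - y" y n] by simp

lemma frobenius_sum:
  fixes F :: "'c::field set"
  assumes F: "is_subfield F" "finite F"
  shows "(sum f I :: 'c) ^ (card F ^ n) = (\<Sum>i\<in>I. f i ^ (card F ^ n))"
  using card_finite_subfield(3)[OF F]
  by (induction I rule: infinite_finite_induct) (auto simp: frobenius_add[OF F])

lemma finite_subfield_power_card: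
  fixes F :: "'c::field set"
  assumes F: "is_subfield F" "finite F" and "c \<in> F"
  shows "c ^ card F = c"
proof (cases "c = 0")
  case True
  then show ?thesis using card_finite_subfield(3)[OF F] by (simp add: power_0_left)
next
  case False
  note FD = is_subringD[OF is_subfieldD(1)[OF F(1)]] is_subfieldD[OF F(1)]
  have "bij_betw ((*) c) (F - {0}) (F - {0})"
    by (rule bij_betwI[where g = "\<lambda>x. inverse c * x"]) (use False assms FD in \<open>auto simp: field_simps\<close>)
  then have "(\<Prod>x\<in>F - {0}. x) = (\<Prod>x\<in>F - {0}. c * x)"
    by (subst prod.reindex_bij_betw[symmetric]) auto
  also have "\<dots> = c ^ (card F - 1) * (\<Prod>x\<in>F - {0}. x)"
    using F(2) FD by (simp add: prod.distrib card_Diff_singleton)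
  finally have "c ^ (card F - 1) = 1" using F(2) by simp
  then show ?thesis
    using card_finite_subfield(3)[OF F] power_minus_mult[of "card F" c] by simp
qed

lemma finite_subfield_power_card_power:
  fixes F :: "'c::field set"
  assumes F: "is_subfield F" "finite F" and "c \<in> F"
  shows "c ^ (card F ^ n) = c"
  by (induction n) (auto simp: power_mult finite_subfield_power_card[OF assms])

text \<open>The polynomial X^q - X has at most q = \<open>card F\<close> roots, and the elements of
  \<open>F\<close> are that many. It serves to recognize traces as constants.\<close>

lemma mem_finite_subfieldI:
  fixes F :: "'c::field set"
  assumes F: "is_subfield F" "finite F" and x: "x ^ card F = x"
  shows "x \<in> F"
proof -
  let ?p = "monom 1 (card F) - monom 1 1 :: 'c poly"
  have q2: "card F \<ge> 2" by (rule card_finite_subfield[OF F])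
  then have "coeff ?p 1 = - 1" by simp
  then have p0: "?p \<noteq> 0" by (metis coeff_0 neg_equal_0_iff_equal one_neq_zero)
  have "F = {x. poly ?p x = 0}"
  proof (rule card_subset_eq)
    show "finite {x. poly ?p x = 0}" by (rule poly_roots_finite[OF p0])
    show "F \<subseteq> {x. poly ?p x = 0}" by (auto simp: poly_monom finite_subfield_power_card[OF F])
    then have "card F \<le> card {x. poly ?p x = 0}" using poly_roots_finite[OF p0] by (rule card_mono[rotated])
    moreover have "card {x. poly ?p x = 0} \<le> card F"
      using card_poly_roots_bound[OF p0] q2 by (meson degree_diff_le degree_monom_le le_trans one_le_numeral)
    ultimately show "card F = card {x. poly ?p x = 0}" by simp
  qed
  then show ?thesis using x by (auto simp: poly_monom)
qed

lemma finite_subring_is_subfield: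
  assumes "is_subring S" "finite S"
  shows "is_subfield S"
  unfolding is_subfield_def
proof (intro conjI ballI assms(1))
  fix x assume x: "x \<in> S"
  show "inverse x \<in> S"
  proof (cases "x = 0")
    case True then show ?thesis using x by simp
  next
    case False
    have "range (\<lambda>n::nat. x ^ n) \<subseteq> S" using power_in_subring[OF assms(1) x] by auto
    then have "\<not> inj (\<lambda>n::nat. x ^ n)" using assms(2) finite_subset finite_imageD by blast
    then obtain i j :: nat where ij: "x ^ i = x ^ j" "i < j" unfolding inj_def by (metis nat_neq_iff)
    then have "x ^ i * x ^ (j - i) = x ^ i * 1" by (metis le_add_diff_inverse less_imp_le mult.right_neutral power_add)
    then have "x ^ (j - i) = 1" using False by simp
    then have "x * x ^ (j - i - 1) = 1" using ij by (metis mult.commute power_minus_mult zero_less_diff)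
    then have "inverse x = x ^ (j - i - 1)" by (rule inverse_unique)
    then show ?thesis using power_in_subring[OF assms(1) x] by simp
  qed
qed

text \<open>\<open>S[y]\<close> is spanned over \<open>S\<close> by the powers of \<open>y\<close> below the degree of the equation.\<close>

lemma finite_subring_adjoin_root:
  fixes S :: "'c::field set"
  assumes S: "is_subring S" "finite S" and p: "p \<in> polys_over S" "p \<noteq> 0" "poly p y = 0"
  shows "\<exists>S'. is_subring S' \<and> finite S' \<and> S \<subseteq> S' \<and> y \<in> S'"
proof -
  note SD = is_subringD[OF S(1)]
  note sfS = is_subfieldD[OF finite_subring_is_subfield[OF S]]
  define n where "n = degree p"
  have n: "n > 0"
  proof (rule ccontr)
    assume "\<not> n > 0"
    then have "degree p = 0" by (simp add: n_def)
    then obtain a where "p = [:a:]" by (rule degree_eq_zeroE)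
    then show False using p by simp
  qed
  \<comment> \<open>Extensional coefficient functions exhibit the set as the image of a finite
    one.\<close>
  define S' where "S' = (\<lambda>s. \<Sum>i<n. s i * y ^ i) ` ({..<n} \<rightarrow>\<^sub>E S)"
  have mem: "(\<Sum>i<n. s i * y ^ i) \<in> S'" if "\<And>i. i < n \<Longrightarrow> s i \<in> S" for s
    unfolding S'_def by (rule image_eqI[where x = "restrict s {..<n}"]) (use that in auto)
  have "finite S'" unfolding S'_def using S(2) by (intro finite_imageI finite_PiE) auto
  have elim: "\<exists>s. (\<forall>i<n. s i \<in> S) \<and> x = (\<Sum>i<n. s i * y ^ i)" if "x \<in> S'" for x
    using that by (auto simp: S'_def)
  have lin: "c * x + d * z \<in> S'" if xz: "x \<in> S'" "z \<in> S'" and cd: "c \<in> S" "d \<in> S" for x z c d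
  proof -
    obtain s u where s: "\<forall>i<n. s i \<in> S" "x = (\<Sum>i<n. s i * y ^ i)"
      "\<forall>i<n. u i \<in> S" "z = (\<Sum>i<n. u i * y ^ i)" using elim xz by metis
    then have "c * x + d * z = (\<Sum>i<n. (c * s i + d * u i) * y ^ i)"
      by (simp add: sum_distrib_left sum.distrib algebra_simps)
    then show ?thesis using s cd SD by (auto intro!: mem)
  qed
  have zero: "0 \<in> S'" using mem[of "\<lambda>_. 0"] SD by simp
  have pow: "y ^ k \<in> S'" if "k < n" for k
  proof -
    have "(\<Sum>i<n. (if i = k then 1 else 0) * y ^ i) = y ^ k"
      using that by (simp add: if_distrib[of "\<lambda>c. c * _"] cong: if_cong)
    then show ?thesis using mem[of "\<lambda>i. if i = k then 1 else 0"] SD by auto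
  qed
  have sm: "c * x \<in> S'" if "c \<in> S" "x \<in> S'" for c x
    using lin[of x 0 c 0] that zero SD by auto
  have ad: "x + z \<in> S'" if "x \<in> S'" "z \<in> S'" for x z
    using lin[of x z 1 1] that SD by auto
  have su: "sum f I \<in> S'" if "\<And>i. i \<in> I \<Longrightarrow> f i \<in> S'" for f and I :: "nat set"
    using that by (induction I rule: infinite_finite_induct) (auto simp: zero ad)
  have yn: "y ^ n \<in> S'"
  proof -
    have "0 = lead_coeff p * y ^ n + (\<Sum>i<n. coeff p i * y ^ i)"
      using p(3) by (simp add: poly_altdef n_def lessThan_Suc_atMost[symmetric] add.commute)
    then have "y ^ n = (\<Sum>i<n. (- coeff p i / lead_coeff p) * y ^ i)"
      using p(2) by (simp add: sum_divide_distrib[symmetric] sum_negf field_simps eq_neg_iff_add_eq_0)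
    moreover have "(\<Sum>i<n. (- coeff p i / lead_coeff p) * y ^ i) \<in> S'"
      using p(1) SD sfS by (intro mem) (auto simp: polys_over_def)
    ultimately show ?thesis by simp
  qed
  have my: "y * x \<in> S'" if "x \<in> S'" for x
  proof -
    obtain s where s: "\<forall>i<n. s i \<in> S" "x = (\<Sum>i<n. s i * y ^ i)"
      using elim[OF \<open>x \<in> S'\<close>] by metis
    then have "y * x = (\<Sum>i<n. s i * y ^ Suc i)" by (simp add: sum_distrib_left algebra_simps)
    moreover have "s i * y ^ Suc i \<in> S'" if "i < n" for i
    proof -
      have "y ^ Suc i \<in> S'" using that pow[of "Suc i"] yn by (cases "Suc i = n") auto
      then show ?thesis using s that by (intro sm) auto
    qed
    ultimately show ?thesis using su[of "{..<n}"] by auto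
  qed
  have mul: "x * z \<in> S'" if "x \<in> S'" "z \<in> S'" for x z
  proof -
    obtain s where s: "\<forall>i<n. s i \<in> S" "x = (\<Sum>i<n. s i * y ^ i)"
      using elim[OF \<open>x \<in> S'\<close>] by metis
    have "y ^ i * z \<in> S'" for i by (induction i) (use my that in \<open>auto simp: mult.assoc\<close>)
    then have "(\<Sum>i<n. s i * (y ^ i * z)) \<in> S'" using s by (intro su) (auto intro: sm)
    then show ?thesis using s by (simp add: sum_distrib_right mult.assoc)
  qed
  have one: "1 \<in> S'" using pow[of 0] n by simp
  have "is_subring S'"
    unfolding is_subring_def using one mul lin[of _ _ 1 "-1"] SD by auto
  moreover have "S \<subseteq> S'" using sm[OF _ one] by auto
  moreover have "y \<in> S'" using my[OF one] by simp
  ultimately show ?thesis using \<open>finite S'\<close> by blast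
qed

text \<open>Finite rings take the place of minimal polynomials: finitely many algebraic elements lie
  in a common one, so sums and products need no resultants. Conversely the powers of an element of a
  finite ring repeat, and X^i - X^j is an equation for it.\<close>

lemma algebraic_closure_finite_iff:
  fixes F :: "'c::field set"
  assumes F: "is_subring F" "finite F"
  shows "x \<in> algebraic_closure_in F \<longleftrightarrow> (\<exists>S. is_subring S \<and> finite S \<and> F \<subseteq> S \<and> x \<in> S)"
proof
  assume "x \<in> algebraic_closure_in F"
  then show "\<exists>S. is_subring S \<and> finite S \<and> F \<subseteq> S \<and> x \<in> S"
    using finite_subring_adjoin_root[OF F] by (auto simp: algebraic_closure_in_def)
next
  assume "\<exists>S. is_subring S \<and> finite S \<and> F \<subseteq> S \<and> x \<in> S"
  then obtain S where S: "is_subring S" "finite S" "x \<in> S" by blast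
  have "range (\<lambda>n::nat. x ^ n) \<subseteq> S" using power_in_subring[OF S(1) S(3)] by auto
  then have "\<not> inj (\<lambda>n::nat. x ^ n)" using S(2) finite_subset finite_imageD by blast
  then obtain i j :: nat where ij: "x ^ i = x ^ j" "i < j" unfolding inj_def by (metis nat_neq_iff)
  let ?p = "monom 1 i - monom 1 j :: 'c poly"
  have "?p \<in> polys_over F" using polys_over_closed[OF F(1)] by auto
  moreover have "coeff ?p i \<noteq> 0" using ij by simp
  then have "?p \<noteq> 0" by (metis coeff_0)
  moreover have "poly ?p x = 0" using ij by (simp add: poly_monom)
  ultimately show "x \<in> algebraic_closure_in F" unfolding algebraic_closure_in_def by blast
qed

lemma finite_subset_algebraic_closure:
  fixes F :: "'c::field set"
  assumes F: "is_subring F" "finite F" and T: "finite T" "T \<subseteq> algebraic_closure_in F"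
  shows "\<exists>S. is_subring S \<and> finite S \<and> F \<subseteq> S \<and> T \<subseteq> S"
  using T
proof (induction T rule: finite_induct)
  case empty then show ?case using F by auto
next
  case (insert x T)
  then obtain S where S: "is_subring S" "finite S" "F \<subseteq> S" "T \<subseteq> S" by auto
  obtain p where "p \<in> polys_over F" "p \<noteq> 0" "poly p x = 0"
    using insert.prems by (auto simp: algebraic_closure_in_def)
  moreover have "p \<in> polys_over S" using \<open>p \<in> polys_over F\<close> S(3) by (auto simp: polys_over_def)
  ultimately show ?case using finite_subring_adjoin_root[OF S(1,2), of p x] S(3,4) by blast
qed

lemma algebraic_closure_finite_subring:
  fixes F :: "'c::field set"
  assumes F: "is_subring F" "finite F"
  shows "is_subring (algebraic_closure_in F)"
  unfolding is_subring_def
proof (intro conjI ballI)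
  show "1 \<in> algebraic_closure_in F"
    using F is_subringD by (auto simp: algebraic_closure_finite_iff[OF F])
  fix x y assume "x \<in> algebraic_closure_in F" "y \<in> algebraic_closure_in F"
  then obtain S where "is_subring S" "finite S" "F \<subseteq> S" "x \<in> S" "y \<in> S"
    using finite_subset_algebraic_closure[OF F, of "{x, y}"] by auto
  then show "x - y \<in> algebraic_closure_in F" "x * y \<in> algebraic_closure_in F"
    unfolding algebraic_closure_finite_iff[OF F] by (meson is_subringD(5,6))+
qed

lemma algebraic_closure_finite_root:
  fixes F :: "'c::field set"
  assumes F: "is_subring F" "finite F"
    and p: "p \<in> polys_over (algebraic_closure_in F)" "p \<noteq> 0" "poly p y = 0"
  shows "y \<in> algebraic_closure_in F"
proof -
  have "set (coeffs p) \<subseteq> algebraic_closure_in F"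
    using p(1) by (auto simp: polys_over_def coeffs_def)
  then obtain S where S: "is_subring S" "finite S" "F \<subseteq> S" "set (coeffs p) \<subseteq> S"
    using finite_subset_algebraic_closure[OF F, of "set (coeffs p)"] by auto
  have "coeff p i \<in> S" for i
    using S(4) is_subringD(1)[OF S(1)] coeff_in_coeffs[OF p(2), of i] by (cases "i \<le> degree p") (auto simp: coeff_eq_0)
  then have "p \<in> polys_over S" by (simp add: polys_over_def)
  then show ?thesis
    using finite_subring_adjoin_root[OF S(1,2) _ p(2,3)] S(3)
    by (auto simp: algebraic_closure_finite_iff[OF F])
qed

section \<open>Linear algebra and symmetric functions over a subfield\<close>

text \<open>Gaussian elimination on the column \<open>k\<close>. It will be applied to r + 1
  Frobenius powers expressed through r functions.\<close>

lemma linear_dependence: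
  fixes x :: "'i \<Rightarrow> 'j \<Rightarrow> 'c::field"
  assumes H: "is_subfield H" and "finite J" "finite I" "card J < card I"
    and "\<And>i j. i \<in> I \<Longrightarrow> j \<in> J \<Longrightarrow> x i j \<in> H"
  shows "\<exists>c. (\<forall>i\<in>I. c i \<in> H) \<and> (\<exists>i\<in>I. c i \<noteq> 0) \<and> (\<forall>j\<in>J. (\<Sum>i\<in>I. c i * x i j) = 0)"
  using assms(2-)
proof (induction J arbitrary: I x rule: finite_induct)
  case empty
  then have "I \<noteq> {}" by auto
  then show ?case using is_subringD[OF is_subfieldD(1)[OF H]] by (intro exI[of _ "\<lambda>_. 1"]) auto
next
  case (insert k J)
  note HD = is_subringD[OF is_subfieldD(1)[OF H]] is_subfieldD[OF H]
  show ?case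
  proof (cases "\<forall>i\<in>I. x i k = 0")
    case True
    have "card J < card I" using insert by simp
    then obtain c where c: "\<forall>i\<in>I. c i \<in> H" "\<exists>i\<in>I. c i \<noteq> 0" "\<forall>j\<in>J. (\<Sum>i\<in>I. c i * x i j) = 0"
      using insert.IH[of I x] insert.prems by auto
    moreover have "(\<Sum>i\<in>I. c i * x i k) = 0" using True by simp
    ultimately show ?thesis by (intro exI[of _ c]) auto
  next
    case False
    then obtain m where m: "m \<in> I" "x m k \<noteq> 0" by blast
    define y where "y i j = x i j - x i k / x m k * x m j" for i j
    have "card J < card (I - {m})" using insert m by (simp add: card_Diff_singleton)
    moreover have "y i j \<in> H" if "i \<in> I - {m}" "j \<in> J" for i j
      unfolding y_def using that insert.prems m HD by auto
    ultimately obtain c where c: "\<forall>i\<in>I-{m}. c i \<in> H" "\<exists>i\<in>I-{m}. c i \<noteq> 0"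
        "\<forall>j\<in>J. (\<Sum>i\<in>I-{m}. c i * y i j) = 0"
      using insert.IH[of "I - {m}" y] insert.prems by auto
    \<comment> \<open>The pivot row \<open>m\<close> receives the coefficient that clears column
      \<open>k\<close>.\<close>
    define d where "d = c(m := - (\<Sum>i\<in>I-{m}. c i * (x i k / x m k)))"
    have split: "(\<Sum>i\<in>I. d i * x i j) = (\<Sum>i\<in>I-{m}. c i * y i j)" for j
    proof -
      have "(\<Sum>i\<in>I. d i * x i j) = d m * x m j + (\<Sum>i\<in>I-{m}. d i * x i j)"
        using m insert.prems by (simp add: sum.remove)
      also have "(\<Sum>i\<in>I-{m}. d i * x i j) = (\<Sum>i\<in>I-{m}. c i * x i j)"
        by (rule sum.cong) (auto simp: d_def)
      finally show ?thesis
        by (simp add: d_def y_def algebra_simps sum_subtractf sum_distrib_left)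
    qed
    have "y i k = 0" for i using m by (simp add: y_def)
    then have "\<forall>j\<in>insert k J. (\<Sum>i\<in>I. d i * x i j) = 0" using c(3) by (simp add: split)
    moreover have "d i \<in> H" if "i \<in> I" for i
    proof (cases "i = m")
      case True
      have "(\<Sum>i\<in>I-{m}. c i * (x i k / x m k)) \<in> H"
        using c(1) insert.prems m HD by (intro sum_in_subring) auto
      then show ?thesis using True HD by (simp add: d_def)
    qed (use c(1) that in \<open>auto simp: d_def\<close>)
    moreover have "\<exists>i\<in>I. d i \<noteq> 0" using c(2) by (auto simp: d_def)
    ultimately show ?thesis by blast
  qed
qed

text \<open>Synthetic division: comparing coefficients in R = (X - v) S gives S_j = R_(j+1) + v
  S_(j+1), solved from the top degree downwards. Summed over v, the formula expresses the derivative
  of R by power sums of its roots.\<close>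

lemma coeff_prod_remove:
  fixes W :: "'c::field set"
  assumes W: "finite W" "v \<in> W"
  defines "R \<equiv> \<Prod>v\<in>W. [:- v, 1:]"
  shows "coeff (\<Prod>w\<in>W - {v}. [:- w, 1:]) j = (\<Sum>i\<in>{j<..card W}. coeff R i * v ^ (i - 1 - j))"
proof (induction "card W - j" arbitrary: j)
  case 0
  have "degree (\<Prod>w\<in>W - {v}. [:- w, 1:]) = card W - 1"
    using W by (subst degree_prod_eq_sum_degree) (auto simp: card_Diff_singleton)
  moreover have "card W > 0" using W by (auto simp: card_gt_0_iff)
  ultimately show ?case using 0 by (simp add: coeff_eq_0)
next
  case (Suc k)
  let ?S = "\<Prod>w\<in>W - {v}. [:- w, 1:]"
  have j: "j < card W" using Suc.hyps(2) by simp
  have R: "R = [:- v, 1:] * ?S" unfolding R_def using W by (rule prod.remove)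
  have "coeff R (Suc j) = coeff ?S j - v * coeff ?S (Suc j)" by (simp add: R)
  then have "coeff ?S j = coeff R (Suc j) + v * coeff ?S (Suc j)" by simp
  also have "coeff ?S (Suc j) = (\<Sum>i\<in>{Suc j<..card W}. coeff R i * v ^ (i - 1 - Suc j))"
    by (rule Suc.hyps(1)) (use Suc.hyps(2) in simp)
  also have "v * \<dots> = (\<Sum>i\<in>{Suc j<..card W}. coeff R i * v ^ (i - 1 - j))"
    unfolding sum_distrib_left
  proof (rule sum.cong)
    fix i assume "i \<in> {Suc j<..card W}"
    then have "i - 1 - j = Suc (i - 1 - Suc j)" by auto
    then show "v * (coeff R i * v ^ (i - 1 - Suc j)) = coeff R i * v ^ (i - 1 - j)"
      by (metis mult.left_commute power_Suc)
  qed simp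
  also have "coeff R (Suc j) + \<dots> = (\<Sum>i\<in>insert (Suc j) {Suc j<..card W}. coeff R i * v ^ (i - 1 - j))"
    by simp
  also have "insert (Suc j) {Suc j<..card W} = {j<..card W}" using j by auto
  finally show ?case .
qed

text \<open>Newton's identities.\<close>

lemma power_sum_in_subring:
  fixes W :: "'c::field set"
  assumes L: "is_subring L" and W: "finite W" and R: "(\<Prod>v\<in>W. [:- v, 1:]) \<in> polys_over L"
  shows "(\<Sum>v\<in>W. v ^ k) \<in> L"
proof (induction k rule: less_induct)
  case (less k)
  note LD = is_subringD[OF L]
  define R where "R = (\<Prod>v\<in>W. [:- v, 1:])"
  define n where "n = card W"
  have RL: "coeff R i \<in> L" for i using R by (auto simp: R_def polys_over_def)
  have degR: "degree R = n" unfolding R_def n_def by (subst degree_prod_eq_sum_degree) auto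
  have lc: "coeff R n = 1" using lead_coeff_prod[of "\<lambda>v. [:- v, 1:]" W] degR by (simp add: R_def)
  have natL: "of_nat m \<in> L" for m by (induction m) (auto simp: LD)
  show ?case
  proof (cases "k < n")
    case True
    \<comment> \<open>In coefficient \<open>j\<close> of the derivative of \<open>R\<close> the sum
      of the v^k is the term \<open>i = n\<close>, with coefficient 1. Solving for it needs no
      division, so the argument is valid in positive characteristic.\<close>
    define j where "j = n - 1 - k"
    have jn: "j < n" and kj: "n - 1 - j = k" using True by (auto simp: j_def)
    have "of_nat (Suc j) * coeff R (Suc j) = coeff (pderiv R) j" by (simp add: coeff_pderiv)
    also have "pderiv R = (\<Sum>v\<in>W. \<Prod>w\<in>W - {v}. [:- w, 1:])"
      unfolding R_def pderiv_prod by (simp add: pderiv_pCons)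
    also have "coeff \<dots> j = (\<Sum>v\<in>W. \<Sum>i\<in>{j<..n}. coeff R i * v ^ (i - 1 - j))"
      unfolding coeff_sum n_def R_def using W by (intro sum.cong refl coeff_prod_remove) auto
    also have "\<dots> = (\<Sum>i\<in>{j<..n}. coeff R i * (\<Sum>v\<in>W. v ^ (i - 1 - j)))"
      by (subst sum.swap) (simp add: sum_distrib_left)
    also have "{j<..n} = insert n {j<..<n}" using jn by auto
    finally have "of_nat (Suc j) * coeff R (Suc j) = (\<Sum>v\<in>W. v ^ k) + (\<Sum>i\<in>{j<..<n}. coeff R i * (\<Sum>v\<in>W. v ^ (i - 1 - j)))"
      using lc kj by simp
    then have eq: "(\<Sum>v\<in>W. v ^ k) = of_nat (Suc j) * coeff R (Suc j) - (\<Sum>i\<in>{j<..<n}. coeff R i * (\<Sum>v\<in>W. v ^ (i - 1 - j)))"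
      by simp
    moreover have "(\<Sum>i\<in>{j<..<n}. coeff R i * (\<Sum>v\<in>W. v ^ (i - 1 - j))) \<in> L"
      using kj by (intro sum_in_subring[OF L] LD(6) RL less.IH) auto
    moreover have "of_nat (Suc j) * coeff R (Suc j) \<in> L" by (intro LD(6) RL natL)
    ultimately show ?thesis unfolding eq by (intro LD(5))
  next
    case False
    have "v ^ k = - (\<Sum>i<n. coeff R i * v ^ (i + (k - n)))" if "v \<in> W" for v
    proof -
      have "poly R v = 0" using that W by (auto simp: R_def poly_prod)
      then have "(\<Sum>i<n. coeff R i * v ^ i) + v ^ n = 0"
        by (simp add: poly_altdef degR lc lessThan_Suc_atMost[symmetric])
      then have "v ^ n = - (\<Sum>i<n. coeff R i * v ^ i)" by (simp add: eq_neg_iff_add_eq_0 add.commute)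
      then have "v ^ n * v ^ (k - n) = - (\<Sum>i<n. coeff R i * v ^ i) * v ^ (k - n)" by simp
      then show ?thesis using False by (simp add: sum_distrib_right mult.assoc flip: power_add)
    qed
    then have eq: "(\<Sum>v\<in>W. v ^ k) = - (\<Sum>i<n. coeff R i * (\<Sum>v\<in>W. v ^ (i + (k - n))))"
      by (simp add: sum_negf sum_distrib_left sum.swap[of _ W])
    moreover have "(\<Sum>i<n. coeff R i * (\<Sum>v\<in>W. v ^ (i + (k - n)))) \<in> L"
      using False by (intro sum_in_subring[OF L] LD(6) RL less.IH) auto
    ultimately show ?thesis unfolding eq by (intro LD(3))
  qed
qed

lemma sum_poly_over_roots_in_subring:
  fixes W :: "'c::field set"
  assumes L: "is_subring L" and W: "finite W" and R: "(\<Prod>v\<in>W. [:- v, 1:]) \<in> polys_over L"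
    and p: "p \<in> polys_over L"
  shows "(\<Sum>v\<in>W. poly p v) \<in> L"
proof -
  have "(\<Sum>v\<in>W. poly p v) = (\<Sum>i\<le>degree p. coeff p i * (\<Sum>v\<in>W. v ^ i))"
    by (simp add: poly_altdef sum_distrib_left sum.swap[of _ W])
  then show ?thesis
    using p by (auto simp: polys_over_def intro!: sum_in_subring[OF L] is_subringD(6)[OF L] power_sum_in_subring[OF L W R])
qed

section \<open>Exponentials of rank one modules\<close>

text \<open>The functions induced by (A \<otimes> H) id, the submodule of the motive generated by
  the identity. With functions in place of twisted polynomials, composition and q-th powers are
  ordinary operations on values.\<close>

inductive_set phi_span :: "'c::field set \<Rightarrow> 'c set \<Rightarrow> ('c \<Rightarrow> 'c \<Rightarrow> 'c) \<Rightarrow> ('c \<Rightarrow> 'c) set"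
  for H A \<Phi> where
  zero: "(\<lambda>w. 0) \<in> phi_span H A \<Phi>"
| step: "f \<in> phi_span H A \<Phi> \<Longrightarrow> h \<in> H \<Longrightarrow> a \<in> A \<Longrightarrow> (\<lambda>w. f w + h * \<Phi> a w) \<in> phi_span H A \<Phi>"

lemma phi_span_add:
  assumes f: "f \<in> phi_span H A \<Phi>" and "g \<in> phi_span H A \<Phi>"
  shows "(\<lambda>w. f w + g w) \<in> phi_span H A \<Phi>"
  using assms(2)
proof induction
  case (step g h a)
  then have "(\<lambda>w. (f w + g w) + h * \<Phi> a w) \<in> phi_span H A \<Phi>" by - (rule phi_span.step)
  then show ?case by (simp add: add.assoc)
qed (use f in simp)

lemma phi_span_single: "h \<in> H \<Longrightarrow> a \<in> A \<Longrightarrow> (\<lambda>w. h * \<Phi> a w) \<in> phi_span H A \<Phi>"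
  using phi_span.step[OF phi_span.zero, of h H a A \<Phi>] by simp

lemma phi_span_smult:
  assumes H: "is_subring H" and "f \<in> phi_span H A \<Phi>" "c \<in> H"
  shows "(\<lambda>w. c * f w) \<in> phi_span H A \<Phi>"
  using assms(2)
proof induction
  case (step g h a)
  then have "(\<lambda>w. c * g w + (c * h) * \<Phi> a w) \<in> phi_span H A \<Phi>"
    using is_subringD(6)[OF H \<open>c \<in> H\<close>] by - (rule phi_span.step, auto)
  then show ?case by (simp add: algebra_simps)
qed (auto intro: phi_span.zero)

lemma phi_span_diff:
  assumes H: "is_subring H" and "f \<in> phi_span H A \<Phi>" "g \<in> phi_span H A \<Phi>"
  shows "(\<lambda>w. f w - g w) \<in> phi_span H A \<Phi>"
proof -
  have "(\<lambda>w. f w + (- 1) * g w) \<in> phi_span H A \<Phi>"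
    using assms is_subringD[OF H] by (intro phi_span_add phi_span_smult) auto
  then show ?thesis by simp
qed

text \<open>The counting assumptions stand in for Riemann-Roch. The error in \<open>E_near\<close>
  is quadratic, which is the precision needed for replacing 1/E(s) by 1/s with a bounded
  error.\<close>

locale rank_one_module =
  fixes F A H D :: "'c::complete_nonarch_field set" and q :: nat and t x1 :: 'c
    and \<Phi> :: "'c \<Rightarrow> 'c \<Rightarrow> 'c" and E :: "'c \<Rightarrow> 'c" and \<rho> :: real
  assumes F: "is_subfield F" "finite F" and q_def: "q = card F"
    and A: "is_subring A" "F \<subseteq> A" "t \<in> A" "absv t = real q ^ 2"
    and count_le: "\<And>k. finite {a \<in> A. absv a < real q ^ (2 * k)}"
      "\<And>k. card {a \<in> A. absv a < real q ^ (2 * k)} \<le> q ^ (2 * k)"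
    and count_ge: "\<And>k. q ^ (2 * k) \<le> card {a \<in> A. absv a < real q ^ (2 * k + 2)}"
    and H: "is_subfield H" "A \<subseteq> H"
    and D: "closure D = (UNIV :: 'c set)" "1 \<in> D" "0 \<in> D"
      "\<And>p. p \<in> polys_over D \<Longrightarrow> degree p > 0 \<Longrightarrow> \<exists>x. poly p x = 0"
    and \<Phi>_poly: "\<And>a. a \<in> A \<Longrightarrow> \<exists>p\<in>polys_over H. \<forall>w. \<Phi> a w = poly p w"
    and \<Phi>_add_left: "\<And>a b w. a \<in> A \<Longrightarrow> b \<in> A \<Longrightarrow> \<Phi> (a + b) w = \<Phi> a w + \<Phi> b w"
    and \<Phi>_mult: "\<And>a b w. a \<in> A \<Longrightarrow> b \<in> A \<Longrightarrow> \<Phi> (a * b) w = \<Phi> a (\<Phi> b w)"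
    and \<Phi>_const: "\<And>c w. c \<in> F \<Longrightarrow> \<Phi> c w = c * w"
    and \<Phi>_add: "\<And>a w w'. a \<in> A \<Longrightarrow> \<Phi> a (w + w') = \<Phi> a w + \<Phi> a w'"
    and \<Phi>_t: "\<And>w. \<Phi> t w = t * w + x1 * w ^ q + w ^ (q ^ 2)"
    and E_add: "\<And>z w. E (z + w) = E z + E w"
    and E_\<Phi>: "\<And>a z. a \<in> A \<Longrightarrow> E (a * z) = \<Phi> a (E z)"
    and \<rho>: "\<rho> > 0"
    and E_near: "\<And>z. absv z < \<rho> \<Longrightarrow> absv (E z - z) \<le> absv z * absv z / \<rho>"
begin

definition \<Lambda> :: "'c set" where "\<Lambda> = {l. E l = 0}"

lemmas AD = is_subringD[OF A(1)]
lemmas FD = is_subringD[OF is_subfieldD(1)[OF F(1)]] is_subfieldD[OF F(1)]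
lemmas HD = is_subringD[OF is_subfieldD(1)[OF H(1)]] is_subfieldD[OF H(1)]

lemma q2: "q \<ge> 2" "of_nat q = (0::'c)"
  using card_finite_subfield[OF F] by (auto simp: q_def)

lemma frob_add: "(x + y :: 'c) ^ (q ^ n) = x ^ (q ^ n) + y ^ (q ^ n)"
  unfolding q_def by (rule frobenius_add[OF F])

lemma frob_add1: "(x + y :: 'c) ^ q = x ^ q + y ^ q"
  using frob_add[of x y 1] by simp

lemma frob_diff: "(x - y :: 'c) ^ (q ^ n) = x ^ (q ^ n) - y ^ (q ^ n)"
  unfolding q_def by (rule frobenius_diff[OF F])

lemma frob_sum: "(sum f I :: 'c) ^ (q ^ n) = (\<Sum>i\<in>I. f i ^ (q ^ n))"
  unfolding q_def by (rule frobenius_sum[OF F])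

lemma frob_F: "c \<in> F \<Longrightarrow> c ^ (q ^ n) = c"
  unfolding q_def by (rule finite_subfield_power_card_power[OF F])

lemma E_0 [simp]: "E 0 = 0"
  using E_add[of 0 0] by (metis add.right_neutral add_left_cancel)

lemma E_minus: "E (- z) = - E z"
  using E_add[of z "- z"] by (simp add: eq_neg_iff_add_eq_0 add.commute)

lemma E_diff: "E (z - w) = E z - E w"
  using E_add[of z "- w"] by (simp add: E_minus)

lemma E_sum: "E (sum f I) = (\<Sum>i\<in>I. E (f i))"
  by (induction I rule: infinite_finite_induct) (auto simp: E_add)

lemma E_F: "c \<in> F \<Longrightarrow> E (c * z) = c * E z"
  using A(2) by (auto simp: E_\<Phi> \<Phi>_const)

lemma \<Phi>_0 [simp]: "a \<in> A \<Longrightarrow> \<Phi> a 0 = 0"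
  using \<Phi>_add[of a 0 0] by (metis add.right_neutral add_left_cancel)

lemma \<Phi>_sum: "a \<in> A \<Longrightarrow> \<Phi> a (sum f I) = (\<Sum>i\<in>I. \<Phi> a (f i))"
  by (induction I rule: infinite_finite_induct) (auto simp: \<Phi>_add)

lemma \<Phi>_F: "a \<in> A \<Longrightarrow> c \<in> F \<Longrightarrow> \<Phi> a (c * w) = c * \<Phi> a w"
  using \<Phi>_mult[of a c w] \<Phi>_mult[of c a w] A(2) by (auto simp: \<Phi>_const mult.commute)

lemma \<Phi>_diff: "a \<in> A \<Longrightarrow> \<Phi> a (x - y) = \<Phi> a x - \<Phi> a y"
  using \<Phi>_add[of a "x - y" y] by simp

lemma \<Lambda>_module: "l \<in> \<Lambda> \<Longrightarrow> a \<in> A \<Longrightarrow> a * l \<in> \<Lambda>" "l \<in> \<Lambda> \<Longrightarrow> l' \<in> \<Lambda> \<Longrightarrow> l + l' \<in> \<Lambda>"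
    "l \<in> \<Lambda> \<Longrightarrow> l' \<in> \<Lambda> \<Longrightarrow> l - l' \<in> \<Lambda>" "l \<in> \<Lambda> \<Longrightarrow> - l \<in> \<Lambda>" "0 \<in> \<Lambda>"
  by (auto simp: \<Lambda>_def E_\<Phi> E_add E_diff E_minus)

lemma absv_t_power: "absv (t ^ k) = real q ^ (2 * k)"
  by (simp add: absv_power A(4) power_mult)

lemma t_nonzero: "t \<noteq> 0"
  using A(4) q2 by auto

lemma exists_large_power: "\<exists>k. x < real q ^ (2 * k)"
proof -
  obtain k where "x < real q ^ k" using q2 real_arch_pow[of "real q" x] by auto
  also have "\<dots> \<le> real q ^ (2 * k)" using q2 by (intro power_increasing) auto
  finally show ?thesis by blast
qed

lemma absv_E: "absv z < \<rho> \<Longrightarrow> absv (E z) = absv z"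
proof (cases "z = 0")
  case False
  assume z: "absv z < \<rho>"
  have "absv z * absv z / \<rho> < absv z" using z False \<rho> by (simp add: pos_divide_less_eq mult_strict_left_mono)
  then have "absv (E z - z) < absv z" using E_near[OF z] by linarith
  then have "absv ((E z - z) + z) = absv z" by (rule absv_add_dominant)
  then show ?thesis by simp
qed simp

lemma E_surj_ball:
  assumes x: "absv x < \<rho>"
  shows "\<exists>s. absv s \<le> absv x \<and> E s = x"
proof (rule local_inverse[where c = "absv x / \<rho>"])
  fix s :: 'c assume s: "absv s \<le> absv x"
  then have "absv (E s - s) \<le> absv s * absv s / \<rho>" using x by (intro E_near) simp
  also have "\<dots> \<le> absv x * absv s / \<rho>" using s \<rho> by (intro divide_right_mono mult_right_mono) auto
  finally show "absv (E s - s) \<le> absv x / \<rho> * absv s" by simp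
qed (use x \<rho> in \<open>auto simp: E_diff\<close>)

text \<open>The terms in w^q and w^(q^2) have derivative 0, since q = 0 in the field. The constant
  derivative t^k makes the polynomial separable and its logarithmic derivative a multiple of its
  inverse.\<close>

lemma \<Phi>_t_power_poly:
  "\<exists>p. lead_coeff p = 1 \<and> degree p = q ^ (2 * k) \<and> pderiv p = [:t ^ k:] \<and> (\<forall>w. \<Phi> (t ^ k) w = poly p w)"
proof (induction k)
  case 0
  show ?case using \<Phi>_const[of 1] FD by (intro exI[of _ "[:0, 1:]"]) (auto simp: pderiv_pCons one_pCons)
next
  case (Suc k)
  then obtain p where p: "lead_coeff p = 1" "degree p = q ^ (2 * k)" "pderiv p = [:t ^ k:]"
    "\<And>w. \<Phi> (t ^ k) w = poly p w" by blast
  define P where "P = monom t 1 + monom x1 q + monom 1 (q ^ 2)"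
  have qq: "1 < q" "q < q ^ 2" using q2 by (auto simp: power2_eq_square)
  have dP: "degree P = q ^ 2"
    using qq by (intro antisym degree_le le_degree) (auto simp: P_def)
  have lP: "lead_coeff P = 1" unfolding dP using qq by (simp add: P_def)
  have "of_nat (q ^ 2) = (0::'c)" using q2 by simp
  then have derP: "pderiv P = [:t:]"
    using q2 by (simp add: P_def pderiv_add pderiv_monom monom_0 del: of_nat_power)
  have "lead_coeff (pcompose P p) = 1"
    using p lP q2 by (subst lead_coeff_comp) auto
  moreover have "degree (pcompose P p) = q ^ (2 * Suc k)"
    by (simp add: degree_pcompose dP p(2) power_add[symmetric])
  moreover have "pderiv (pcompose P p) = [:t ^ Suc k:]"
    by (simp add: pderiv_pcompose derP p(3) pcompose_pCons)
  moreover have "\<Phi> (t ^ Suc k) w = poly (pcompose P p) w" for w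
    using \<Phi>_mult[of t "t ^ k" w] A(3) power_in_subring[OF A(1) A(3)] p(4)
    by (simp add: poly_pcompose P_def poly_monom \<Phi>_t)
  ultimately show ?case by blast
qed

section \<open>Torsion points and the density of the period lattice\<close>

definition tor :: "nat \<Rightarrow> 'c set" where "tor k = {v. \<Phi> (t ^ k) v = 0}"

lemma tor_finite: "finite (tor k)" "card (tor k) \<le> q ^ (2 * k)"
proof -
  obtain p where p: "lead_coeff p = 1" "degree p = q ^ (2 * k)" "\<And>w. \<Phi> (t ^ k) w = poly p w"
    using \<Phi>_t_power_poly[of k] by blast
  have "p \<noteq> 0" using p(1) by auto
  then show "finite (tor k)" "card (tor k) \<le> q ^ (2 * k)"
    using poly_roots_finite[of p] card_poly_roots_bound[of p] p by (auto simp: tor_def)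
qed

text \<open>The logarithmic derivative of the polynomial of \<open>\<Phi> (t ^ k)\<close>, which
  splits by \<open>card_roots_additive_poly\<close> and has derivative t^k. The sign of v is changed
  by the symmetry of the torsion group.\<close>

lemma tor_log_derivative:
  assumes "\<Phi> (t ^ k) x \<noteq> 0"
  shows "(\<Sum>v\<in>tor k. 1 / (x + v)) = t ^ k / \<Phi> (t ^ k) x"
proof -
  have tk: "t ^ k \<in> A" by (rule power_in_subring[OF A(1) A(3)])
  obtain p where p: "lead_coeff p = 1" "pderiv p = [:t ^ k:]" "\<And>w. \<Phi> (t ^ k) w = poly p w"
    using \<Phi>_t_power_poly[of k] by blast
  have "p = (\<Prod>v | poly p v = 0. [:- v, 1:])"
    by (rule card_roots_additive_poly[OF D p(1,2)]) (use t_nonzero tk \<Phi>_diff p(3) in \<open>auto simp flip: p(3)\<close>)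
  then have pp: "p = (\<Prod>v\<in>tor k. [:- v, 1:])" by (simp add: tor_def p(3))
  have x: "x \<notin> tor k" using assms by (simp add: tor_def)
  have "t ^ k = poly (pderiv p) x" by (simp add: p(2))
  also have "\<dots> = (\<Sum>v\<in>tor k. \<Prod>w\<in>tor k - {v}. x - w)"
    by (subst pp) (simp add: pderiv_prod pderiv_pCons poly_sum poly_prod)
  also have "\<dots> = (\<Sum>v\<in>tor k. poly p x / (x - v))"
  proof (rule sum.cong)
    fix v assume v: "v \<in> tor k"
    have "poly p x = (\<Prod>w\<in>tor k. x - w)" by (subst pp) (simp add: poly_prod)
    also have "\<dots> = (x - v) * (\<Prod>w\<in>tor k - {v}. x - w)" using v tor_finite by (simp add: prod.remove)
    finally show "(\<Prod>w\<in>tor k - {v}. x - w) = poly p x / (x - v)" using x v by auto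
  qed simp
  also have "\<dots> = poly p x * (\<Sum>v\<in>tor k. 1 / (x - v))" by (simp add: sum_distrib_left)
  also have "(\<Sum>v\<in>tor k. 1 / (x - v)) = (\<Sum>v\<in>tor k. 1 / (x + v))"
    by (rule sum.reindex_bij_witness[of _ uminus uminus])
      (use tk \<Phi>_diff[of "t ^ k" 0] in \<open>auto simp: tor_def\<close>)
  finally have "t ^ k = poly p x * (\<Sum>v\<in>tor k. 1 / (x + v))" .
  then show ?thesis using assms p(3)[of x] by (metis nonzero_mult_div_cancel_left)
qed

text \<open>Division by t^k brings differences of such periods into the ball where E is an isometry,
  so different periods give different torsion points. Counting torsion points thus bounds the
  density of the lattice from above.\<close>

lemma \<Lambda>_ball_inj:
  "inj_on (\<lambda>l. E (l / t ^ k)) {l \<in> \<Lambda>. absv (w + l) < \<rho> * absv (t ^ k)}"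
  "(\<lambda>l. E (l / t ^ k)) ` \<Lambda> \<subseteq> tor k"
proof -
  have tk0: "t ^ k \<noteq> 0" using t_nonzero by simp
  have tk: "t ^ k \<in> A" by (rule power_in_subring[OF A(1) A(3)])
  show "inj_on (\<lambda>l. E (l / t ^ k)) {l \<in> \<Lambda>. absv (w + l) < \<rho> * absv (t ^ k)}"
  proof (rule inj_onI, clarsimp)
    fix l l' assume h: "absv (w + l) < \<rho> * absv (t ^ k)" "absv (w + l') < \<rho> * absv (t ^ k)"
      "E (l / t ^ k) = E (l' / t ^ k)"
    have "absv ((w + l) - (w + l')) < \<rho> * absv (t ^ k)" using h(1,2) by (rule absv_diff_less_bound)
    then have "absv ((l - l') / t ^ k) < \<rho>" using tk0 by (simp add: absv_divide pos_divide_less_eq)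
    then have "absv (E ((l - l') / t ^ k)) = absv ((l - l') / t ^ k)" by (rule absv_E)
    moreover have "E ((l - l') / t ^ k) = 0" using h(3) by (simp add: diff_divide_distrib E_diff)
    ultimately show "l = l'" using t_nonzero by (simp add: absv_divide)
  qed
  show "(\<lambda>l. E (l / t ^ k)) ` \<Lambda> \<subseteq> tor k"
  proof safe
    fix l assume "l \<in> \<Lambda>"
    moreover have "\<Phi> (t ^ k) (E (l / t ^ k)) = E l" using E_\<Phi>[OF tk, of "l / t ^ k"] t_nonzero by simp
    ultimately show "E (l / t ^ k) \<in> tor k" by (simp add: tor_def \<Lambda>_def)
  qed
qed

lemma \<Lambda>_ball_finite:
  "finite {l \<in> \<Lambda>. absv (w + l) < \<rho> * absv (t ^ k)}"
  "card {l \<in> \<Lambda>. absv (w + l) < \<rho> * absv (t ^ k)} \<le> q ^ (2 * k)"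
proof -
  let ?B = "{l \<in> \<Lambda>. absv (w + l) < \<rho> * absv (t ^ k)}"
  have im: "(\<lambda>l. E (l / t ^ k)) ` ?B \<subseteq> tor k" using \<Lambda>_ball_inj(2)[of k] by auto
  show "finite ?B" using inj_on_finite[OF \<Lambda>_ball_inj(1) im tor_finite(1)] .
  show "card ?B \<le> q ^ (2 * k)"
    using card_inj_on_le[OF \<Lambda>_ball_inj(1) im tor_finite(1)] tor_finite(2)[of k] by simp
qed

text \<open>The logarithmic derivative is evaluated at X = E(w/t^k), where \<Phi>(t^k) X = E w.
  Torsion points v with |X + v| < \<rho> come from the periods near -w and give 1/(w + l) up to the
  allowed error; every other one contributes at most 1/(\<rho> |t^k|).\<close>

lemma inverse_E_approx:
  assumes "E w \<noteq> 0"
  shows "absv (1 / E w - (\<Sum>l | l \<in> \<Lambda> \<and> absv (w + l) < \<rho> * absv (t ^ k). 1 / (w + l))) \<le> 1 / (\<rho> * absv (t ^ k))"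
proof -
  define N where "N = t ^ k"
  have N: "N \<in> A" "N \<noteq> 0" using power_in_subring[OF A(1) A(3)] t_nonzero by (auto simp: N_def)
  define X where "X = E (w / N)"
  have PhiX: "\<Phi> N X = E w" using E_\<Phi>[OF N(1), of "w / N"] N(2) by (simp add: X_def)
  define B where "B = {l. l \<in> \<Lambda> \<and> absv (w + l) < \<rho> * absv N}"
  define K1 where "K1 = {v \<in> tor k. absv (X + v) < \<rho>}"
  let ?e = "1 / (\<rho> * absv N)"
  have e0: "?e \<ge> 0" using \<rho> by simp
  have XE: "X + E (l / N) = E ((w + l) / N)" for l by (simp add: X_def E_add[symmetric] add_divide_distrib)
  have small: "absv ((w + l) / N) < \<rho>" if "l \<in> B" for l
    using that N by (simp add: B_def absv_divide pos_divide_less_eq)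
  have bij: "bij_betw (\<lambda>l. E (l / N)) B K1"
  proof (rule bij_betw_imageI)
    show "inj_on (\<lambda>l. E (l / N)) B" using \<Lambda>_ball_inj(1)[of k w] by (simp add: B_def N_def)
    show "(\<lambda>l. E (l / N)) ` B = K1"
    proof safe
      fix l assume l: "l \<in> B"
      have "E (l / N) \<in> tor k" using \<Lambda>_ball_inj(2)[of k] l by (auto simp: B_def N_def)
      moreover have "absv (X + E (l / N)) < \<rho>" using small[OF l] by (simp add: XE absv_E)
      ultimately show "E (l / N) \<in> K1" by (simp add: K1_def)
    next
      fix v assume v: "v \<in> K1"
      then obtain s where s: "absv s \<le> absv (X + v)" "E s = X + v"
        using E_surj_ball[of "X + v"] by (auto simp: K1_def)
      \<comment> \<open>The period belonging to \<open>v\<close>: E s = X + v with s small, and E(N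
        s) = E w because N kills the torsion point \<open>v\<close>.\<close>
      define l where "l = N * s - w"
      have "\<Phi> N (X + v) = E w + \<Phi> N v" using \<Phi>_add[OF N(1)] PhiX by simp
      then have "E (N * s) = E w" using v s(2) E_\<Phi>[OF N(1)] by (simp add: K1_def tor_def N_def)
      then have "l \<in> \<Lambda>" by (simp add: \<Lambda>_def l_def E_diff)
      moreover have "absv (w + l) < \<rho> * absv N"
        using s(1) v N by (simp add: l_def absv_mult K1_def mult.commute)
      moreover have "v = E (l / N)"
        using s(2) N by (simp add: l_def diff_divide_distrib E_diff X_def)
      ultimately show "v \<in> (\<lambda>l. E (l / N)) ` B" by (auto simp: B_def)
    qed
  qed
  have "N * (1 / E w) = (\<Sum>v\<in>tor k. 1 / (X + v))"
    using tor_log_derivative[of k X] assms by (simp flip: N_def add: PhiX)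
  also have "\<dots> = (\<Sum>v\<in>K1. 1 / (X + v)) + (\<Sum>v\<in>tor k - K1. 1 / (X + v))"
    using tor_finite(1) by (intro sum.subset_diff[of K1, THEN trans, OF _ _ add.commute]) (auto simp: K1_def)
  also have "(\<Sum>v\<in>K1. 1 / (X + v)) = (\<Sum>l\<in>B. 1 / E ((w + l) / N))"
    by (subst sum.reindex_bij_betw[OF bij, symmetric]) (simp add: XE)
  finally have "N * (1 / E w) = (\<Sum>l\<in>B. 1 / E ((w + l) / N)) + (\<Sum>v\<in>tor k - K1. 1 / (X + v))" .
  moreover have "1 / E w = (1 / N) * (N * (1 / E w))" using N by simp
  ultimately have "1 / E w = (1 / N) * ((\<Sum>l\<in>B. 1 / E ((w + l) / N)) + (\<Sum>v\<in>tor k - K1. 1 / (X + v)))"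
    by (simp only:)
  then have "1 / E w = (\<Sum>l\<in>B. 1 / (N * E ((w + l) / N))) + (\<Sum>v\<in>tor k - K1. 1 / (N * (X + v)))"
    by (simp only: distrib_left[of "1 / N"] sum_distrib_left times_divide_times_eq mult_1)
  then have "1 / E w - (\<Sum>l\<in>B. 1 / (w + l)) =
      (\<Sum>l\<in>B. 1 / (N * E ((w + l) / N)) - 1 / (w + l)) + (\<Sum>v\<in>tor k - K1. 1 / (N * (X + v)))"
    by (simp add: sum_subtractf)
  also have "absv \<dots> \<le> ?e"
  proof (intro absv_add_le_bound absv_sum_le_bound e0)
    fix v assume "v \<in> tor k - K1"
    then have "\<rho> * absv N \<le> absv (X + v) * absv N" using \<rho> N by (auto simp: K1_def)
    then show "absv (1 / (N * (X + v))) \<le> ?e"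
      using \<rho> N by (auto simp: absv_divide absv_mult mult.commute intro!: divide_left_mono mult_pos_pos)
  next
    fix l assume l: "l \<in> B"
    define s where "s = (w + l) / N"
    have "w \<noteq> - l" using l assms by (auto simp: B_def \<Lambda>_def E_minus)
    then have s0: "s \<noteq> 0" using N by (simp add: s_def add_eq_0_iff2)
    have sr: "absv s < \<rho>" using small[OF l] by (simp add: s_def)
    have Es: "absv (E s) = absv s" "E s \<noteq> 0" using absv_E[OF sr] s0 by (auto simp flip: absv_eq_0_iff)
    \<comment> \<open>Here w + l = N s, and the quadratic bound \<open>E_near\<close> cancels both
      factors |s| in the denominator.\<close>
    have "1 / (N * E s) - 1 / (w + l) = 1 / (N * E s) - 1 / (N * s)" using N by (simp add: s_def)
    also have "\<dots> = - (E s - s) / (N * s * E s)" using Es(2) s0 N by (simp add: field_simps)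
    finally have "absv (1 / (N * E s) - 1 / (w + l)) = absv (E s - s) / (absv N * absv s * absv s)"
      by (simp add: absv_divide absv_mult Es(1) absv_minus_commute)
    also have "\<dots> \<le> (absv s * absv s / \<rho>) / (absv N * absv s * absv s)"
      using E_near[OF sr] by (intro divide_right_mono) auto
    also have "\<dots> = ?e" using s0 N \<rho> by (simp add: field_simps)
    finally show "absv (1 / (N * E ((w + l) / N)) - 1 / (w + l)) \<le> ?e" by (simp add: s_def)
  qed
  finally show ?thesis by (simp add: B_def N_def)
qed

text \<open>The non-archimedean analogue of the partial fraction expansion of the cotangent.\<close>

lemma has_sum_inverse_E:
  assumes w: "E w \<noteq> 0"
  shows "((\<lambda>l. 1 / (w + l)) has_sum (1 / E w)) \<Lambda>"
  unfolding has_sum_def tendsto_iff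
proof safe
  fix \<epsilon> :: real assume \<epsilon>: "\<epsilon> > 0"
  obtain k where k: "1 / (\<rho> * \<epsilon>) < real q ^ (2 * k)" using exists_large_power by blast
  define N where "N = absv (t ^ k)"
  have N: "1 / (\<rho> * N) < \<epsilon>" "N > 0"
  proof -
    show "N > 0" using t_nonzero by (simp add: N_def)
    then show "1 / (\<rho> * N) < \<epsilon>" using k \<epsilon> \<rho> by (simp add: N_def absv_t_power field_simps)
  qed
  let ?B = "{l. l \<in> \<Lambda> \<and> absv (w + l) < \<rho> * N}"
  show "\<forall>\<^sub>F X in finite_subsets_at_top \<Lambda>. dist (\<Sum>l\<in>X. 1 / (w + l)) (1 / E w) < \<epsilon>"
    unfolding eventually_finite_subsets_at_top
  proof (intro exI[of _ ?B] conjI allI impI)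
    show "finite ?B" using \<Lambda>_ball_finite(1)[of w k] by (simp add: N_def)
    show "?B \<subseteq> \<Lambda>" by auto
    fix Y assume Y: "finite Y \<and> ?B \<subseteq> Y \<and> Y \<subseteq> \<Lambda>"
    have "(\<Sum>l\<in>Y. 1 / (w + l)) - 1 / E w = (\<Sum>l\<in>Y - ?B. 1 / (w + l)) - (1 / E w - (\<Sum>l\<in>?B. 1 / (w + l)))"
      using Y by (simp add: sum_diff)
    also have "absv \<dots> \<le> 1 / (\<rho> * N)"
    proof (rule absv_diff_le_bound)
      show "absv (\<Sum>l\<in>Y - ?B. 1 / (w + l)) \<le> 1 / (\<rho> * N)"
      proof (rule absv_sum_le_bound)
        fix l assume "l \<in> Y - ?B"
        then have "\<rho> * N \<le> absv (w + l)" using Y by auto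
        then show "absv (1 / (w + l)) \<le> 1 / (\<rho> * N)"
          using mult_pos_pos[OF \<rho> N(2)] by (simp add: absv_divide frac_le)
      qed (use \<rho> N in auto)
      show "absv (1 / E w - (\<Sum>l\<in>?B. 1 / (w + l))) \<le> 1 / (\<rho> * N)"
        using inverse_E_approx[OF w, of k] by (simp add: N_def)
    qed
    finally show "dist (\<Sum>l\<in>Y. 1 / (w + l)) (1 / E w) < \<epsilon>" using N(1) by (simp add: dist_eq_absv)
  qed
qed

text \<open>\<open>A\<close> has positive density, so every discrete group containing \<open>\<lambda>A\<close> and of comparable
  density contains it with finite index.\<close>

lemma finite_index:
  assumes V: "\<And>x y. x \<in> V \<Longrightarrow> y \<in> V \<Longrightarrow> x + y \<in> V" "\<And>a. a \<in> A \<Longrightarrow> lam * a \<in> V" "lam \<noteq> 0" and r: "r > 0"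
    and fin: "\<And>k. finite {v \<in> V. absv v < r * real q ^ (2 * k)}"
    and card: "\<And>k. card {v \<in> V. absv v < r * real q ^ (2 * k)} \<le> q ^ (2 * k)"
  shows "\<exists>s. \<forall>S. S \<subseteq> V \<longrightarrow> finite S \<longrightarrow> (\<forall>x\<in>S. \<forall>y\<in>S. \<forall>a\<in>A. x - y = lam * a \<longrightarrow> x = y) \<longrightarrow> card S \<le> s"
proof -
  \<comment> \<open>Multiplication by \<open>lam\<close> enlarges balls by a factor below r q^(2j);
    hence an index bound q^(2j+2) independent of \<open>S\<close>.\<close>
  obtain j where j: "absv lam / r < real q ^ (2 * j)" using exists_large_power by blast
  have "card S \<le> q ^ (2 * j + 2)" if S: "S \<subseteq> V" "finite S"
    and inc: "\<forall>x\<in>S. \<forall>y\<in>S. \<forall>a\<in>A. x - y = lam * a \<longrightarrow> x = y" for S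
  proof -
    obtain k0 where k0: "(\<Sum>x\<in>S. absv x) / r < real q ^ (2 * k0)" using exists_large_power by blast
    \<comment> \<open>\<open>k\<close> is so large that the ball of radius r q^(2k) contains
      \<open>S\<close>. For |a| < q^(2m+2) the translates x + lam a remain in it, because 2k = (2m +
      2) + 2j.\<close>
    define k where "k = k0 + j + 1"
    define m where "m = k - j - 1"
    have q1: "real q \<ge> 1" using q2 by simp
    have big: "absv x < r * real q ^ (2 * k)" if "x \<in> S" for x
    proof -
      have "absv x \<le> (\<Sum>x\<in>S. absv x)" using that S(2) by (intro member_le_sum) auto
      also have "\<dots> < r * real q ^ (2 * k0)" using k0 r by (simp add: pos_divide_less_eq mult.commute)
      also have "\<dots> \<le> r * real q ^ (2 * k)" using q1 r by (intro mult_left_mono power_increasing) (auto simp: k_def)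
      finally show ?thesis .
    qed
    have km: "2 * k = (2 * m + 2) + 2 * j" by (simp add: m_def k_def)
    let ?A = "{a \<in> A. absv a < real q ^ (2 * m + 2)}"
    let ?V = "{v \<in> V. absv v < r * real q ^ (2 * k)}"
    have "inj_on (\<lambda>(x, a). x + lam * a) (S \<times> ?A)"
    proof (rule inj_onI)
      fix u v assume "u \<in> S \<times> ?A" "v \<in> S \<times> ?A" "(\<lambda>(x, a). x + lam * a) u = (\<lambda>(x, a). x + lam * a) v"
      then obtain x a y b where uv: "u = (x, a)" "v = (y, b)"
        and h: "x \<in> S" "y \<in> S" "a \<in> A" "b \<in> A" "x + lam * a = y + lam * b" by auto
      have "x - y = lam * (b - a)" using h(5) by (simp add: algebra_simps)
      then have "x = y" using inc h AD by blast
      then show "u = v" using h V(3) uv by simp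
    qed
    moreover have "(\<lambda>(x, a). x + lam * a) ` (S \<times> ?A) \<subseteq> ?V"
    proof
      fix v assume "v \<in> (\<lambda>(x, a). x + lam * a) ` (S \<times> ?A)"
      then obtain x a where v: "v = x + lam * a"
        and h: "x \<in> S" "a \<in> A" "absv a < real q ^ (2 * m + 2)" by auto
      have "absv (lam * a) < (r * real q ^ (2 * j)) * real q ^ (2 * m + 2)"
        unfolding absv_mult
        using j h r q2 by (intro mult_strict_mono) (auto simp: pos_divide_less_eq mult.commute)
      also have "\<dots> = r * real q ^ (2 * k)" unfolding km power_add by (simp add: mult_ac)
      finally show "v \<in> ?V"
        using V h S big[OF h(1)] unfolding v by (auto intro: absv_add_less_bound)
    qed
    ultimately have "card (S \<times> ?A) \<le> card ?V" using fin by (rule card_inj_on_le)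
    also have "\<dots> \<le> q ^ (2 * k)" by (rule card)
    finally have "card S * card ?A \<le> q ^ (2 * k)" by (simp add: card_cartesian_product)
    moreover have "card S * q ^ (2 * m) \<le> card S * card ?A" using count_ge by (intro mult_left_mono) auto
    moreover have "q ^ (2 * k) = q ^ (2 * j + 2) * q ^ (2 * m)" unfolding km power_add by (simp add: mult_ac)
    ultimately have "card S * q ^ (2 * m) \<le> q ^ (2 * j + 2) * q ^ (2 * m)" by linarith
    then show ?thesis using q2 by simp
  qed
  then show ?thesis by blast
qed

text \<open>Pigeonhole: the s + 1 elements v 0, ..., v s cannot be pairwise incongruent modulo lam
  A.\<close>

lemma finite_index_eventually_periodic:
  assumes S: "\<And>S. S \<subseteq> V \<Longrightarrow> finite S \<Longrightarrow> (\<forall>x\<in>S. \<forall>y\<in>S. \<forall>a\<in>A. x - y = lam * a \<longrightarrow> x = y) \<Longrightarrow> card S \<le> s"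
    and v: "\<And>i. v i \<in> V"
  shows "\<exists>i j. i < j \<and> j \<le> s \<and> (\<exists>a\<in>A. v i - v j = lam * a)"
proof (rule ccontr)
  assume "\<not> ?thesis"
  then have n: "v i - v j \<noteq> lam * a" if "i < j" "j \<le> s" "a \<in> A" for i j a using that by blast
  have n': "v i - v j \<noteq> lam * a" if "i \<noteq> j" "i \<le> s" "j \<le> s" "a \<in> A" for i j a
  proof (cases "i < j")
    case False
    then have "v j - v i \<noteq> lam * (- a)" using that AD by (intro n) auto
    then show ?thesis by (metis minus_diff_eq minus_mult_right)
  qed (use that n in auto)
  have inj: "inj_on v {..s}"
    using n'[of _ _ 0] AD by (intro inj_onI) (metis atMost_iff cancel_comm_monoid_add_class.diff_cancel mult_zero_right)
  have "card (v ` {..s}) \<le> s"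
  proof (rule S)
    show "\<forall>x\<in>v ` {..s}. \<forall>y\<in>v ` {..s}. \<forall>a\<in>A. x - y = lam * a \<longrightarrow> x = y"
      using n' by (metis atMost_iff imageE)
  qed (use v in auto)
  then show False using inj by (simp add: card_image)
qed

text \<open>By finite index each period l has (t^i - t^j) l in lam A for some i < j <= s. The pairs
  are bounded independently of l, so the product over all of them serves the whole lattice, without
  any choice of generators.\<close>

lemma lattice_multiplier:
  assumes lam: "lam \<in> \<Lambda>" "lam \<noteq> 0"
  shows "\<exists>B\<in>A. B \<noteq> 0 \<and> (\<forall>l\<in>\<Lambda>. \<exists>a\<in>A. B * l = lam * a)"
proof -
  have "\<exists>s. \<forall>S. S \<subseteq> \<Lambda> \<longrightarrow> finite S \<longrightarrow> (\<forall>x\<in>S. \<forall>y\<in>S. \<forall>a\<in>A. x - y = lam * a \<longrightarrow> x = y) \<longrightarrow> card S \<le> s"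
  proof (rule finite_index[where r = \<rho>])
    show "finite {v \<in> \<Lambda>. absv v < \<rho> * real q ^ (2 * k)}" "card {v \<in> \<Lambda>. absv v < \<rho> * real q ^ (2 * k)} \<le> q ^ (2 * k)" for k
      using \<Lambda>_ball_finite[of 0 k] by (auto simp: absv_t_power)
  qed (use \<Lambda>_module lam \<rho> in \<open>auto simp: mult.commute[of lam]\<close>)
  then obtain s where s: "\<And>S. S \<subseteq> \<Lambda> \<Longrightarrow> finite S \<Longrightarrow> (\<forall>x\<in>S. \<forall>y\<in>S. \<forall>a\<in>A. x - y = lam * a \<longrightarrow> x = y) \<Longrightarrow> card S \<le> s"
    by blast
  define I where "I = {(i, j). i < j \<and> j \<le> s}"
  have finI: "finite I" by (rule finite_subset[of _ "{..s} \<times> {..s}"]) (auto simp: I_def)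
  define B where "B = (\<Prod>(i, j)\<in>I. t ^ i - t ^ j)"
  have tk: "t ^ k \<in> A" for k by (rule power_in_subring[OF A(1) A(3)])
  have prodA: "(\<Prod>(i, j)\<in>I'. t ^ i - t ^ j) \<in> A" for I'
    by (induction I' rule: infinite_finite_induct) (use AD tk in auto)
  have "t ^ i \<noteq> t ^ j" if "i < j" for i j
  proof
    assume "t ^ i = t ^ j"
    then have "real q ^ (2 * i) = real q ^ (2 * j)" by (metis absv_t_power)
    then show False using q2 that by (simp add: power_inject_exp)
  qed
  then have "B \<noteq> 0" using finI by (auto simp: B_def I_def prod_zero_iff)
  moreover have "\<exists>a\<in>A. B * l = lam * a" if l: "l \<in> \<Lambda>" for l
  proof -
    have "\<exists>i j. i < j \<and> j \<le> s \<and> (\<exists>a\<in>A. t ^ i * l - t ^ j * l = lam * a)"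
      by (rule finite_index_eventually_periodic[OF s]) (use \<Lambda>_module l tk in auto)
    then obtain i j a where ij: "(i, j) \<in> I" "a \<in> A" "(t ^ i - t ^ j) * l = lam * a"
      by (auto simp: I_def algebra_simps)
    have "B = (t ^ i - t ^ j) * (\<Prod>(i, j)\<in>I - {(i, j)}. t ^ i - t ^ j)"
      unfolding B_def using finI ij by (subst prod.remove[of I "(i, j)"]) auto
    then have "B * l = lam * (a * (\<Prod>(i, j)\<in>I - {(i, j)}. t ^ i - t ^ j))" using ij(3) by (simp add: mult_ac)
    then show ?thesis using AD(6)[OF ij(2) prodA] by blast
  qed
  ultimately show ?thesis using prodA unfolding B_def by blast
qed

text \<open>The quotient A/bA is finite, so powers repeat in it. For x = t this puts a nonzero
  polynomial in t with constant coefficients into every nonzero ideal.\<close>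

lemma ideal_contains_periodic:
  assumes b: "b \<in> A" "b \<noteq> 0" and x: "x \<in> A"
  shows "\<exists>i j. i < j \<and> (\<exists>a\<in>A. x ^ i - x ^ j = b * a)"
proof -
  have "\<exists>s. \<forall>S. S \<subseteq> A \<longrightarrow> finite S \<longrightarrow> (\<forall>x\<in>S. \<forall>y\<in>S. \<forall>a\<in>A. x - y = b * a \<longrightarrow> x = y) \<longrightarrow> card S \<le> s"
    by (rule finite_index[where r = 1]) (use AD b count_le in auto)
  then obtain s where s: "\<And>S. S \<subseteq> A \<Longrightarrow> finite S \<Longrightarrow> (\<forall>x\<in>S. \<forall>y\<in>S. \<forall>a\<in>A. x - y = b * a \<longrightarrow> x = y) \<Longrightarrow> card S \<le> s"
    by blast
  show ?thesis
    using finite_index_eventually_periodic[OF s, where v = "\<lambda>i. x ^ i"] power_in_subring[OF A(1) x] by blast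
qed

end

lemma has_sum_finite_UN:
  fixes f :: "'a \<Rightarrow> 'b::topological_comm_monoid_add"
  assumes "finite V" "\<And>v. v \<in> V \<Longrightarrow> (f has_sum g v) (S v)"
    and "\<And>v v'. v \<in> V \<Longrightarrow> v' \<in> V \<Longrightarrow> v \<noteq> v' \<Longrightarrow> S v \<inter> S v' = {}"
  shows "(f has_sum (\<Sum>v\<in>V. g v)) (\<Union>v\<in>V. S v)"
  using assms
proof (induction V rule: finite_induct)
  case (insert v V)
  have "(f has_sum (g v + (\<Sum>v\<in>V. g v))) (S v \<union> (\<Union>v\<in>V. S v))"
    using insert by (intro has_sum_Un_disjoint) blast+
  then show ?case using insert.hyps by simp
qed simp

section \<open>Characters and Gauss sums\<close>

context rank_one_module
begin

abbreviation "\<N> \<equiv> phi_span H A \<Phi>"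

lemma \<N>_compose:
  assumes "f \<in> \<N>" "a \<in> A"
  shows "(\<lambda>w. f (\<Phi> a w)) \<in> \<N>"
  using assms(1)
proof induction
  case (step f h b)
  have "(\<lambda>w. f (\<Phi> a w) + h * \<Phi> (b * a) w) \<in> \<N>"
    using step assms(2) AD by (intro phi_span.step) auto
  then show ?case using step assms(2) by (simp add: \<Phi>_mult)
qed (auto intro: phi_span.zero)

end

text \<open>The relation \<open>twist\<close> says that the motive is generated by \<open>1\<close> away from the point with
  \<open>t\<close>-coordinate \<open>\<alpha>\<close>.\<close>

locale twisted_module = rank_one_module F A H D q t x1 \<Phi> E \<rho>
  for F A H D :: "'c::complete_nonarch_field set" and q t x1 \<Phi> E \<rho> +
  fixes \<alpha> :: 'c and \<nu> :: "'c \<Rightarrow> 'c"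
  assumes \<alpha>: "\<alpha> \<in> H" "absv \<alpha> > 1"
    and \<nu>: "\<nu> \<in> phi_span H A \<Phi>"
    and twist: "\<And>w. \<Phi> t w ^ q = \<alpha> * w ^ q + \<nu> w"
begin

lemma twist_power: "\<exists>f\<in>\<N>. \<forall>w. \<Phi> (t ^ i) w ^ q = \<alpha> ^ i * w ^ q + f w"
proof (induction i)
  case 0
  show ?case using \<Phi>_const[of 1] FD by (intro bexI[OF _ phi_span.zero]) auto
next
  case (Suc i)
  then obtain f where f: "f \<in> \<N>" "\<And>w. \<Phi> (t ^ i) w ^ q = \<alpha> ^ i * w ^ q + f w" by blast
  have "\<Phi> (t ^ Suc i) w ^ q = \<alpha> ^ Suc i * w ^ q + (\<alpha> ^ i * \<nu> w + f (\<Phi> t w))" for w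
    using \<Phi>_mult[OF power_in_subring[OF A(1) A(3)] A(3), of i w] f(2)[of "\<Phi> t w"]
    by (simp add: twist algebra_simps)
  moreover have "(\<lambda>w. \<alpha> ^ i * \<nu> w + f (\<Phi> t w)) \<in> \<N>"
    using f \<nu> \<alpha> A(3) power_in_subring[OF HD(7)]
    by (intro phi_span_add phi_span_smult[OF HD(7)] \<N>_compose) auto
  ultimately show ?case by (intro bexI[of _ "\<lambda>w. \<alpha> ^ i * \<nu> w + f (\<Phi> t w)"]) auto
qed

text \<open>Let \<open>A \<rightarrow> W\<close>, \<open>a \<mapsto> \<omega> a\<close> be a finite cyclic module of torsion points. On \<open>W\<close> the Frobenius
  agrees with an element of the span of the \<open>\<Phi> a\<close>, so that all \<open>v^(q^i)\<close> lie in a space of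
  functions of dimension \<open>dim W\<close>.\<close>

lemma torsion_polynomial_over_H:
  assumes add: "\<And>a b. a \<in> A \<Longrightarrow> b \<in> A \<Longrightarrow> \<omega> (a + b) = \<omega> a + \<omega> b"
    and mul: "\<And>a b. a \<in> A \<Longrightarrow> b \<in> A \<Longrightarrow> \<omega> (a * b) = \<Phi> a (\<omega> b)"
    and fin: "finite (\<omega> ` A)"
  shows "(\<Prod>v\<in>\<omega> ` A. [:- v, 1:]) \<in> polys_over H"
proof -
  define W where "W = \<omega> ` A"
  have W: "finite W" using fin by (simp add: W_def)
  have WI: "\<omega> a \<in> W" if "a \<in> A" for a using that by (simp add: W_def)
  have w0: "\<omega> 0 = 0" using add[of 0 0] AD by (metis add.right_neutral add_left_cancel)
  have "fspace F W" unfolding fspace_def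
  proof (intro conjI ballI)
    show "0 \<in> W" using WI[of 0] w0 AD by simp
    fix x assume "x \<in> W"
    then obtain a where a: "a \<in> A" "x = \<omega> a" by (auto simp: W_def)
    { fix c assume "c \<in> F"
      then have "c * x = \<omega> (c * a)" using a A(2) mul[of c a] \<Phi>_const by auto
      then show "c * x \<in> W" using a A(2) \<open>c \<in> F\<close> AD WI by auto }
    fix y assume "y \<in> W"
    then obtain b where b: "b \<in> A" "y = \<omega> b" by (auto simp: W_def)
    show "x + y \<in> W" using a b WI[of "a + b"] AD add by simp
  qed
  then obtain r v where v: "\<forall>i<r. v i \<in> W" "W = {\<Sum>i<r. c i * v i | c. \<forall>i<r. c i \<in> F}" "card W = q ^ r"
    using fspace_basis[OF F _ W] unfolding q_def by blast
  have "\<forall>i\<in>{..<r}. \<exists>b. b \<in> A \<and> v i = \<omega> b" using v(1) by (auto simp: W_def)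
  then obtain b where b: "\<And>i. i < r \<Longrightarrow> b i \<in> A" "\<And>i. i < r \<Longrightarrow> v i = \<omega> (b i)" by (metis lessThan_iff)
  \<comment> \<open>On \<open>W\<close> the map \<open>\<Phi> a\<close> depends on
    \<open>\<omega> a\<close> alone, because \<Phi>_a(\<omega> x) = \<Phi>_x(\<omega> a) by
    commutativity. A basis of \<open>W\<close> therefore yields generators for the
    restrictions.\<close>
  have span: "\<exists>g. (\<forall>i<r. g i \<in> H) \<and> (\<forall>v\<in>W. f v = (\<Sum>i<r. g i * \<Phi> (b i) v))" if f: "f \<in> \<N>" for f
    using f
  proof induction
    case zero
    show ?case using HD by (intro exI[of _ "\<lambda>_. 0"]) auto
  next
    case (step f h a)
    then obtain g where g: "\<forall>i<r. g i \<in> H" "\<forall>v\<in>W. f v = (\<Sum>i<r. g i * \<Phi> (b i) v)" by blast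
    obtain c where c: "\<forall>i<r. c i \<in> F" "\<omega> a = (\<Sum>i<r. c i * v i)" using v(2) WI[OF step(3)] by blast
    have "\<Phi> a v' = (\<Sum>i<r. c i * \<Phi> (b i) v')" if v': "v' \<in> W" for v'
    proof -
      obtain x where x: "x \<in> A" "v' = \<omega> x" using v' by (auto simp: W_def)
      have "\<Phi> a v' = \<Phi> x (\<omega> a)" using mul[of a x] mul[of x a] step(3) x by (simp add: mult.commute)
      also have "\<dots> = (\<Sum>i<r. c i * \<Phi> x (\<omega> (b i)))" using x c(1) b by (simp add: c(2) \<Phi>_sum \<Phi>_F)
      also have "\<dots> = (\<Sum>i<r. c i * \<Phi> (b i) v')"
      proof (rule sum.cong)
        fix i assume "i \<in> {..<r}"
        then show "c i * \<Phi> x (\<omega> (b i)) = c i * \<Phi> (b i) v'"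
          using mul[of x "b i"] mul[of "b i" x] b x by (simp add: mult.commute)
      qed simp
      finally show ?thesis .
    qed
    then have "\<forall>v\<in>W. f v + h * \<Phi> a v = (\<Sum>i<r. (g i + h * c i) * \<Phi> (b i) v)"
      using g(2) by (simp add: sum.distrib sum_distrib_left algebra_simps)
    moreover have "\<forall>i<r. g i + h * c i \<in> H" using g(1) c(1) step(2) H(2) A(2) by (auto intro!: HD(4) HD(6))
    ultimately show ?case by (intro exI[of _ "\<lambda>i. g i + h * c i"]) auto
  qed
  have "\<exists>f\<in>\<N>. \<forall>v\<in>W. v ^ q = f v"
  proof -
    have tA: "t ^ i \<in> A" for i by (rule power_in_subring[OF A(1) A(3)])
    \<comment> \<open>As \<open>W\<close> is finite, t^i and t^j act on it in the same way for some
      i < j. Subtracting the two relations of \<open>twist_power\<close> isolates v^q with the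
      factor \<alpha>^i - \<alpha>^j, which is nonzero because |\<alpha>| > 1.\<close>
    have "\<not> inj (\<lambda>i::nat. \<omega> (t ^ i))"
    proof
      assume "inj (\<lambda>i::nat. \<omega> (t ^ i))"
      moreover have "range (\<lambda>i::nat. \<omega> (t ^ i)) \<subseteq> W" using tA WI by auto
      ultimately show False using W finite_subset finite_imageD by blast
    qed
    then obtain i j :: nat where ij: "\<omega> (t ^ i) = \<omega> (t ^ j)" "i < j" unfolding inj_def by (metis nat_neq_iff)
    obtain f where f: "f \<in> \<N>" "\<And>w. \<Phi> (t ^ i) w ^ q = \<alpha> ^ i * w ^ q + f w" using twist_power by blast
    obtain g where g: "g \<in> \<N>" "\<And>w. \<Phi> (t ^ j) w ^ q = \<alpha> ^ j * w ^ q + g w" using twist_power by blast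
    have "absv \<alpha> ^ i < absv \<alpha> ^ j" using \<alpha> ij by (intro power_strict_increasing) auto
    then have "\<alpha> ^ i \<noteq> \<alpha> ^ j" by (metis absv_power less_irrefl)
    then have ne: "\<alpha> ^ i - \<alpha> ^ j \<noteq> 0" by simp
    have "v ^ q = inverse (\<alpha> ^ i - \<alpha> ^ j) * (g v - f v)" if "v \<in> W" for v
    proof -
      obtain x where x: "x \<in> A" "v = \<omega> x" using \<open>v \<in> W\<close> by (auto simp: W_def)
      have "\<Phi> (t ^ i) v = \<Phi> (t ^ j) v"
        using mul[of "t ^ i" x] mul[of x "t ^ i"] mul[of "t ^ j" x] mul[of x "t ^ j"] ij(1) tA x
        by (simp add: mult.commute)
      then have "\<alpha> ^ i * v ^ q + f v = \<alpha> ^ j * v ^ q + g v" by (metis f(2) g(2))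
      then have "(\<alpha> ^ i - \<alpha> ^ j) * v ^ q = g v - f v" by (simp add: algebra_simps)
      then show ?thesis using ne by (metis left_inverse mult.assoc mult_1)
    qed
    moreover have "(\<lambda>v. inverse (\<alpha> ^ i - \<alpha> ^ j) * (g v - f v)) \<in> \<N>"
      using f g \<alpha> HD power_in_subring[OF HD(7)] by (intro phi_span_smult[OF HD(7)] phi_span_diff[OF HD(7)]) auto
    ultimately show ?thesis by (intro bexI[of _ "\<lambda>v. inverse (\<alpha> ^ i - \<alpha> ^ j) * (g v - f v)"]) auto
  qed
  then obtain \<tau> where \<tau>: "\<tau> \<in> \<N>" "\<And>v. v \<in> W \<Longrightarrow> v ^ q = \<tau> v" by blast
  have \<Phi>W: "\<Phi> a v \<in> W" if "a \<in> A" "v \<in> W" for a v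
  proof -
    obtain x where "x \<in> A" "v = \<omega> x" using \<open>v \<in> W\<close> by (auto simp: W_def)
    then show ?thesis using mul[of a x] WI[of "a * x"] AD that by simp
  qed
  have frobN: "\<exists>g\<in>\<N>. \<forall>v\<in>W. f v ^ q = g v" if "f \<in> \<N>" for f
    using that
  proof induction
    case zero
    show ?case using q2 by (intro bexI[OF _ phi_span.zero]) (auto simp: power_0_left)
  next
    case (step f h a)
    then obtain g where g: "g \<in> \<N>" "\<forall>v\<in>W. f v ^ q = g v" by blast
    have "(f v + h * \<Phi> a v) ^ q = g v + h ^ q * \<tau> (\<Phi> a v)" if "v \<in> W" for v
      using g(2) that \<tau>(2)[OF \<Phi>W[OF step(3) that]] by (simp add: frob_add1 power_mult_distrib)
    moreover have "(\<lambda>v. g v + h ^ q * \<tau> (\<Phi> a v)) \<in> \<N>"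
      using g \<tau> step power_in_subring[OF HD(7)] by (intro phi_span_add phi_span_smult[OF HD(7)] \<N>_compose) auto
    ultimately show ?case by (intro bexI[of _ "\<lambda>v. g v + h ^ q * \<tau> (\<Phi> a v)"]) auto
  qed
  have "\<exists>f\<in>\<N>. \<forall>v\<in>W. v ^ (q ^ i) = f v" for i
  proof (induction i)
    case 0
    have "(\<lambda>v. 1 * \<Phi> 1 v) \<in> \<N>" using HD AD by (intro phi_span_single) auto
    then show ?case using \<Phi>_const[of 1] FD by (intro bexI[of _ "\<lambda>v. 1 * \<Phi> 1 v"]) auto
  next
    case (Suc i)
    then obtain f where f: "f \<in> \<N>" "\<forall>v\<in>W. v ^ (q ^ i) = f v" by blast
    obtain g where g: "g \<in> \<N>" "\<forall>v\<in>W. f v ^ q = g v" using frobN[OF f(1)] by blast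
    have "v ^ (q ^ Suc i) = g v" if "v \<in> W" for v
      using f(2) g(2) that by (metis mult.commute power_Suc power_mult)
    then show ?case using g(1) by blast
  qed
  then have "\<exists>g. (\<forall>j<r. g j \<in> H) \<and> (\<forall>v\<in>W. v ^ (q ^ i) = (\<Sum>j<r. g j * \<Phi> (b j) v))" for i
    using span by metis
  then obtain g where g: "\<And>i j. j < r \<Longrightarrow> g i j \<in> H"
      "\<And>i v. v \<in> W \<Longrightarrow> v ^ (q ^ i) = (\<Sum>j<r. g i j * \<Phi> (b j) v)" by metis
  \<comment> \<open>The r + 1 functions v^(q^i) with i <= r lie in the span of r functions over
    \<open>H\<close>. A relation among them is a polynomial of degree at most q^r =
    \<open>card W\<close> vanishing on \<open>W\<close>, hence a constant multiple of the
    product.\<close>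
  obtain c where c: "\<forall>i\<in>{..r}. c i \<in> H" "\<exists>i\<in>{..r}. c i \<noteq> 0" "\<forall>j\<in>{..<r}. (\<Sum>i\<le>r. c i * g i j) = 0"
    using linear_dependence[OF H(1), of "{..<r}" "{..r}" g] g(1) by auto
  define f where "f = (\<Sum>i\<le>r. monom (c i) (q ^ i))"
  have inj: "q ^ i = q ^ j \<longleftrightarrow> i = j" for i j using q2 by (simp add: power_inject_exp)
  have cf: "coeff f (q ^ i) = c i" if "i \<le> r" for i
    using that by (simp add: f_def coeff_sum inj)
  have fH: "f \<in> polys_over H" using c(1) HD unfolding f_def polys_over_def
    by (auto simp: coeff_sum intro!: sum_in_subring)
  have f0: "f \<noteq> 0" using c(2) cf by (metis atMost_iff coeff_0)
  have df: "degree f \<le> q ^ r"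
    unfolding f_def using q2
    by (intro degree_sum_le) (auto intro!: order_trans[OF degree_monom_le] power_increasing)
  have fv: "poly f v = 0" if "v \<in> W" for v
  proof -
    have "poly f v = (\<Sum>i\<le>r. c i * (\<Sum>j<r. g i j * \<Phi> (b j) v))"
      using g(2)[OF that] by (simp add: f_def poly_sum poly_monom)
    also have "\<dots> = (\<Sum>j<r. (\<Sum>i\<le>r. c i * g i j) * \<Phi> (b j) v)"
      by (simp add: sum_distrib_left sum_distrib_right sum.swap[of _ "{..r}"] mult.assoc)
    finally show ?thesis using c(3) by simp
  qed
  define P where "P = (\<Prod>v\<in>W. [:- v, 1:])"
  have dP: "degree P = q ^ r" unfolding P_def using v(3) by (subst degree_prod_eq_sum_degree) auto
  have lP: "lead_coeff P = 1" unfolding P_def by (simp add: lead_coeff_prod)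
  obtain Q where Q: "f = P * Q" using prod_linear_factors_dvd[OF W fv] by (auto simp: P_def elim: dvdE)
  have "Q \<noteq> 0" "P \<noteq> 0" using f0 Q by auto
  then have "degree Q = 0" using df dP Q by (simp add: degree_mult_eq)
  then obtain e where e: "Q = [:e:]" by (rule degree_eq_zeroE)
  have "e \<noteq> 0" using \<open>Q \<noteq> 0\<close> e by simp
  have fe: "f = smult e P" using Q e by simp
  then have "e = lead_coeff f" using lP by simp
  then have "e \<in> H" using fH by (simp add: polys_over_def)
  have "P = smult (inverse e) f" using fe \<open>e \<noteq> 0\<close> by simp
  then have "P \<in> polys_over H"
    using polys_over_closed(8)[OF HD(7) HD(8)[OF \<open>e \<in> H\<close>] fH] by simp
  then show ?thesis by (simp add: P_def W_def)
qed

section \<open>Characters of A with values in a finite field\<close>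

definition is_char :: "('c \<Rightarrow> 'c) \<Rightarrow> bool" where
  "is_char \<chi> \<longleftrightarrow> (\<forall>a\<in>A. \<forall>b\<in>A. \<chi> (a + b) = \<chi> a + \<chi> b \<and> \<chi> (a * b) = \<chi> a * \<chi> b) \<and>
     (\<forall>c\<in>F. \<chi> c = c) \<and> finite (\<chi> ` A) \<and> (\<exists>b\<in>A. b \<noteq> 0 \<and> \<chi> b = 0)"

lemma is_charD:
  assumes "is_char \<chi>"
  shows "a \<in> A \<Longrightarrow> b \<in> A \<Longrightarrow> \<chi> (a + b) = \<chi> a + \<chi> b" "a \<in> A \<Longrightarrow> b \<in> A \<Longrightarrow> \<chi> (a * b) = \<chi> a * \<chi> b"
    "c \<in> F \<Longrightarrow> \<chi> c = c" "finite (\<chi> ` A)" "\<exists>b\<in>A. b \<noteq> 0 \<and> \<chi> b = 0"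
    "a \<in> A \<Longrightarrow> b \<in> A \<Longrightarrow> \<chi> (a - b) = \<chi> a - \<chi> b"
    "\<chi> 0 = 0" "\<chi> 1 = 1"
    "is_subfield (\<chi> ` A)"
proof -
  show add: "a \<in> A \<Longrightarrow> b \<in> A \<Longrightarrow> \<chi> (a + b) = \<chi> a + \<chi> b" for a b using assms by (simp add: is_char_def)
  show mul: "a \<in> A \<Longrightarrow> b \<in> A \<Longrightarrow> \<chi> (a * b) = \<chi> a * \<chi> b" for a b using assms by (simp add: is_char_def)
  show "c \<in> F \<Longrightarrow> \<chi> c = c" for c using assms by (simp add: is_char_def)
  then show "\<chi> 0 = 0" and one: "\<chi> 1 = 1" using FD by auto
  show fin: "finite (\<chi> ` A)" using assms by (simp add: is_char_def)
  show "\<exists>b\<in>A. b \<noteq> 0 \<and> \<chi> b = 0" using assms by (simp add: is_char_def)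
  show diff: "\<chi> (a - b) = \<chi> a - \<chi> b" if "a \<in> A" "b \<in> A" for a b
    using add[of "a - b" b] that AD by simp
  have "is_subring (\<chi> ` A)"
    unfolding is_subring_def
  proof (intro conjI ballI)
    show "1 \<in> \<chi> ` A" using one AD by (metis imageI)
    fix x y assume "x \<in> \<chi> ` A" "y \<in> \<chi> ` A"
    then obtain a b where ab: "a \<in> A" "b \<in> A" "x = \<chi> a" "y = \<chi> b" by auto
    then show "x - y \<in> \<chi> ` A" using diff[of a b] AD by (metis imageI)
    show "x * y \<in> \<chi> ` A" using ab mul[of a b] AD by (metis imageI)
  qed
  then show "is_subfield (\<chi> ` A)" using fin by (rule finite_subring_is_subfield)
qed

lemma char_sum:
  assumes "is_char \<chi>" "\<And>i. i \<in> I \<Longrightarrow> f i \<in> A"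
  shows "\<chi> (sum f I) = (\<Sum>i\<in>I. \<chi> (f i))"
  using assms(2)
proof (induction I rule: infinite_finite_induct)
  case (insert i I)
  then have "sum f I \<in> A" by (intro sum_in_subring[OF A(1)]) auto
  then show ?case using insert by (simp add: is_charD[OF assms(1)])
qed (auto simp: is_charD[OF assms(1)])

text \<open>Powers of an element of the finite image repeat, so its absolute value cannot exceed 1.
  Since |\<alpha>| > 1, this separates the eigenvalue of t from \<alpha>.\<close>

lemma absv_char_le_1:
  assumes "is_char \<chi>" "a \<in> A"
  shows "absv (\<chi> a) \<le> 1"
proof (rule ccontr)
  assume "\<not> absv (\<chi> a) \<le> 1"
  then have 1: "absv (\<chi> a) > 1" by simp
  have "inj (\<lambda>n. \<chi> a ^ n)"
  proof (rule injI)
    fix m n assume "\<chi> a ^ m = \<chi> a ^ n"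
    then have "absv (\<chi> a) ^ m = absv (\<chi> a) ^ n" by (metis absv_power)
    then show "m = n" using 1 by (simp add: power_inject_exp)
  qed
  moreover have "range (\<lambda>n. \<chi> a ^ n) \<subseteq> \<chi> ` A"
    using power_in_subring[OF is_subfieldD(1)[OF is_charD(9)[OF assms(1)]]] assms(2) by auto
  ultimately show False using is_charD(4)[OF assms(1)] finite_subset finite_imageD by blast
qed

text \<open>The substitution d -> b d in a Gauss sum: if \<chi> b is nonzero, b R represents the
  nonzero classes again. The general \<open>f\<close> allows its use both for \<psi> and for the
  q-th power of \<psi>.\<close>

lemma gauss_shift:
  assumes \<chi>: "is_char \<chi>" and R: "R \<subseteq> A" "bij_betw \<chi> R (\<chi> ` A - {0})"
    and f: "\<And>a b. a \<in> A \<Longrightarrow> b \<in> A \<Longrightarrow> \<chi> a = \<chi> b \<Longrightarrow> f a = f b" "\<And>a. a \<in> A \<Longrightarrow> \<chi> a = 0 \<Longrightarrow> f a = 0"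
    and b: "b \<in> A"
  shows "(\<Sum>d\<in>R. inverse (\<chi> d) * f (b * d)) = \<chi> b * (\<Sum>d\<in>R. inverse (\<chi> d) * f d)"
proof (cases "\<chi> b = 0")
  case True
  then have "f (b * d) = 0" if "d \<in> R" for d
    using that R(1) b AD \<chi> by (intro f(2)) (auto simp: is_charD)
  then show ?thesis using True by simp
next
  case False
  let ?k = "\<chi> ` A - {0}"
  note kD = is_subfieldD[OF is_charD(9)[OF \<chi>]]
  note kD' = is_subringD[OF kD(1)]
  define g where "g \<kappa> = f (inv_into R \<chi> \<kappa>)" for \<kappa>
  have g: "f a = g (\<chi> a)" if "a \<in> A" "\<chi> a \<noteq> 0" for a
  proof -
    have "\<chi> a \<in> \<chi> ` R" using R(2) that by (auto simp: bij_betw_def)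
    then have "\<chi> (inv_into R \<chi> (\<chi> a)) = \<chi> a" "inv_into R \<chi> (\<chi> a) \<in> R"
      by (auto intro: f_inv_into_f inv_into_into)
    then show ?thesis unfolding g_def using R(1) that by (intro f(1)) auto
  qed
  have nz: "\<chi> d \<noteq> 0" "d \<in> A" if "d \<in> R" for d using R that by (auto simp: bij_betw_def)
  have "(\<Sum>d\<in>R. inverse (\<chi> d) * f (b * d)) = (\<Sum>d\<in>R. inverse (\<chi> d) * g (\<chi> b * \<chi> d))"
    using nz b AD False \<chi> by (intro sum.cong) (auto simp: g is_charD)
  also have "\<dots> = (\<Sum>\<kappa>\<in>?k. inverse \<kappa> * g (\<chi> b * \<kappa>))"
    by (rule sum.reindex_bij_betw[OF R(2)])
  also have "\<dots> = (\<Sum>\<kappa>\<in>?k. \<chi> b * (inverse \<kappa> * g \<kappa>))"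
  proof (rule sum.reindex_bij_witness[where i = "\<lambda>\<kappa>. inverse (\<chi> b) * \<kappa>" and j = "\<lambda>\<kappa>. \<chi> b * \<kappa>"])
    fix \<kappa> assume "\<kappa> \<in> ?k"
    then show "inverse (\<chi> b) * \<kappa> \<in> ?k" "\<chi> b * \<kappa> \<in> ?k" using False kD kD' b by auto
  qed (use False in auto)
  also have "\<dots> = \<chi> b * (\<Sum>d\<in>R. inverse (\<chi> d) * g (\<chi> d))"
    by (subst sum.reindex_bij_betw[OF R(2), symmetric]) (simp add: sum_distrib_left)
  also have "(\<Sum>d\<in>R. inverse (\<chi> d) * g (\<chi> d)) = (\<Sum>d\<in>R. inverse (\<chi> d) * f d)"
    using nz by (intro sum.cong) (auto simp: g)
  finally show ?thesis .
qed

end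

locale gauss_setting = twisted_module F A H D q t x1 \<Phi> E \<rho> \<alpha> \<nu>
  for F A H D :: "'c::complete_nonarch_field set" and q t x1 \<Phi> E \<rho> \<alpha> \<nu> +
  fixes lam z :: 'c and R Z :: "'c set"
  assumes lam: "lam \<in> \<Lambda>" "lam \<noteq> 0" and z: "\<And>a. a \<in> Z \<Longrightarrow> z * a \<in> A" and R: "R \<subseteq> A"
    and Ez: "E (z * lam) \<noteq> 0"
begin

text \<open>Frobenius twists of \<chi> have the same kernel \<open>Z\<close>, and \<open>R\<close>
  still represents the nonzero classes. Fixing both in the locale lets one \<psi> serve all
  twists.\<close>

definition adapted :: "('c \<Rightarrow> 'c) \<Rightarrow> bool" where
  "adapted \<chi> \<longleftrightarrow> is_char \<chi> \<and> {a \<in> A. \<chi> a = 0} = Z \<and> bij_betw \<chi> R (\<chi> ` A - {0})"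

definition \<psi> :: "'c \<Rightarrow> 'c" where "\<psi> a = E (a * z * lam)"

text \<open>The negative of the Gauss sum, taken over representatives instead of cosets.\<close>

definition gs :: "('c \<Rightarrow> 'c) \<Rightarrow> 'c" where "gs \<chi> = (\<Sum>d\<in>R. inverse (\<chi> d) * \<psi> d)"

lemma \<psi>_props:
  "\<psi> (a + b) = \<psi> a + \<psi> b" "\<psi> (a - b) = \<psi> a - \<psi> b" "c \<in> F \<Longrightarrow> \<psi> (c * a) = c * \<psi> a"
  "\<psi> (sum f I) = (\<Sum>i\<in>I. \<psi> (f i))" "a \<in> A \<Longrightarrow> \<psi> (a * b) = \<Phi> a (\<psi> b)" "\<psi> 0 = 0"
  by (auto simp: \<psi>_def E_add[symmetric] E_diff[symmetric] E_\<Phi>[symmetric] E_F[symmetric] E_sum[symmetric] algebra_simps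
      sum_distrib_left sum_distrib_right)

lemma \<psi>_zero:
  assumes "a \<in> Z"
  shows "\<psi> a = 0"
proof -
  have "\<psi> a = E ((z * a) * lam)" by (simp add: \<psi>_def mult_ac)
  also have "\<dots> = \<Phi> (z * a) (E lam)" using z[OF assms] by (rule E_\<Phi>)
  finally show ?thesis using lam(1) z[OF assms] by (simp add: \<Lambda>_def)
qed

lemma adaptedD:
  assumes "adapted \<chi>"
  shows "is_char \<chi>" "a \<in> A \<Longrightarrow> \<chi> a = 0 \<Longrightarrow> \<psi> a = 0"
    "a \<in> A \<Longrightarrow> b \<in> A \<Longrightarrow> \<chi> a = \<chi> b \<Longrightarrow> \<psi> a = \<psi> b" "bij_betw \<chi> R (\<chi> ` A - {0})" "finite R"
    "d \<in> R \<Longrightarrow> \<chi> d \<noteq> 0" "d \<in> R \<Longrightarrow> d \<in> A"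
proof -
  show ch: "is_char \<chi>" using assms by (simp add: adapted_def)
  show z0: "a \<in> A \<Longrightarrow> \<chi> a = 0 \<Longrightarrow> \<psi> a = 0" for a using assms \<psi>_zero by (auto simp: adapted_def)
  show "\<psi> a = \<psi> b" if "a \<in> A" "b \<in> A" "\<chi> a = \<chi> b"
    using z0[of "a - b"] that AD is_charD(6)[OF ch] \<psi>_props(2)[of a b] by simp
  show bij: "bij_betw \<chi> R (\<chi> ` A - {0})" using assms by (simp add: adapted_def)
  show "finite R" using bij_betw_finite[OF bij] is_charD(4)[OF ch] by simp
  show "d \<in> R \<Longrightarrow> \<chi> d \<noteq> 0" using bij by (auto simp: bij_betw_def)
  show "d \<in> R \<Longrightarrow> d \<in> A" using R by auto
qed

lemma gs_shift:
  assumes "adapted \<chi>" "b \<in> A"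
  shows "(\<Sum>d\<in>R. inverse (\<chi> d) * \<psi> (b * d)) = \<chi> b * gs \<chi>"
  unfolding gs_def
  by (rule gauss_shift[OF adaptedD(1)[OF assms(1)] R adaptedD(4)[OF assms(1)] adaptedD(3)[OF assms(1)]
        adaptedD(2)[OF assms(1)] assms(2)])

text \<open>The \<open>L\<close>-series is a finite combination of the partial fraction expansions of \<open>1/E\<close> at the
  torsion points in \<open>W\<close>, and \<open>gs \<chi> * \<chi> a\<close> is a polynomial in the torsion point attached to \<open>a\<close>.\<close>

lemma L_series_1:
  assumes \<chi>: "adapted \<chi>" and L: "is_subfield L" "H \<subseteq> L" "\<chi> ` A \<subseteq> L"
  shows "\<exists>S. ((\<lambda>a. \<chi> a / a) has_sum S) (A - {0}) \<and> gs \<chi> * S / lam \<in> L"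
proof -
  note ch = adaptedD(1)[OF \<chi>]
  note chD = is_charD[OF ch]
  note LD = is_subringD[OF is_subfieldD(1)[OF L(1)]] is_subfieldD[OF L(1)]
  obtain B0 where B0: "B0 \<in> A" "B0 \<noteq> 0" "\<And>l. l \<in> \<Lambda> \<Longrightarrow> \<exists>a\<in>A. B0 * l = lam * a"
    using lattice_multiplier[OF lam] by blast
  obtain b0 where b0: "b0 \<in> A" "b0 \<noteq> 0" "\<chi> b0 = 0" using chD(5) by blast
  \<comment> \<open>\<open>B0\<close> carries the periods into lam A, and \<open>b0\<close> then
    into lam times the kernel of \<chi>. This is why \<omega> a = \<omega> b will force \<chi> a =
    \<chi> b.\<close>
  define B where "B = b0 * B0"
  have B: "B \<in> A" "B \<noteq> 0" "\<chi> B = 0" using B0 b0 AD chD by (auto simp: B_def)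
  have B\<Lambda>: "\<exists>a\<in>A. B * l = lam * a \<and> \<chi> a = 0" if l: "l \<in> \<Lambda>" for l
  proof -
    obtain a where "a \<in> A" "B0 * l = lam * a" using B0(3)[OF l] by blast
    then show ?thesis using b0 AD chD by (intro bexI[of _ "b0 * a"]) (auto simp: B_def)
  qed
  define \<omega> where "\<omega> a = E (lam * a / B)" for a
  have \<omega>_add: "\<omega> (a + b) = \<omega> a + \<omega> b" for a b
    by (simp add: \<omega>_def E_add[symmetric] distrib_left add_divide_distrib)
  have \<omega>_mul: "\<omega> (a * b) = \<Phi> a (\<omega> b)" if "a \<in> A" for a b
    using E_\<Phi>[OF that, of "lam * b / B"] by (simp add: \<omega>_def mult_ac)
  define W where "W = \<omega> ` A"
  have finW: "finite W"
  proof -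
    obtain p where p: "\<And>w. \<Phi> B w = poly p w" using \<Phi>_poly[OF B(1)] by blast
    \<comment> \<open>Otherwise E would vanish at every point B s, but it is an isometry near
      0.\<close>
    have "p \<noteq> 0"
    proof
      assume "p = 0"
      then have 0: "E (B * s) = 0" for s using E_\<Phi>[OF B(1)] p by simp
      obtain k where k: "1 / \<rho> < real q ^ (2 * k)" using exists_large_power by blast
      define s where "s = inverse (t ^ k)"
      have s0: "s \<noteq> 0" using t_nonzero by (simp add: s_def)
      have "absv s = 1 / real q ^ (2 * k)" unfolding s_def absv_inverse absv_t_power by (simp add: divide_inverse)
      moreover have "1 / real q ^ (2 * k) < \<rho>" using k \<rho> q2 by (simp add: pos_divide_less_eq mult.commute)
      ultimately have "absv s < \<rho>" by simp
      then have "absv (E s) = absv s" by (rule absv_E)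
      then show False using 0[of "s / B"] B(2) s0 by simp
    qed
    moreover have "\<Phi> B (\<omega> a) = 0" if "a \<in> A" for a
    proof -
      have "\<Phi> B (\<omega> a) = E (a * lam)" using E_\<Phi>[OF B(1), of "lam * a / B"] B(2) by (simp add: \<omega>_def mult.commute)
      then show ?thesis using \<Lambda>_module(1)[OF lam(1) that] by (simp add: \<Lambda>_def)
    qed
    ultimately have "W \<subseteq> {w. poly p w = 0}" by (auto simp: W_def p)
    then show ?thesis using poly_roots_finite[OF \<open>p \<noteq> 0\<close>] finite_subset by blast
  qed
  have RW: "(\<Prod>v\<in>W. [:- v, 1:]) \<in> polys_over L"
    using torsion_polynomial_over_H[of \<omega>, OF \<omega>_add \<omega>_mul] finW L(2) by (auto simp: W_def polys_over_def)
  have \<omega>_\<chi>: "\<chi> a = \<chi> b" if ab: "a \<in> A" "b \<in> A" "\<omega> a = \<omega> b" for a b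
  proof -
    have "lam * (a - b) / B \<in> \<Lambda>"
      using ab(3) by (simp add: \<Lambda>_def \<omega>_def E_diff right_diff_distrib diff_divide_distrib)
    then obtain c where c: "c \<in> A" "B * (lam * (a - b) / B) = lam * c" "\<chi> c = 0" using B\<Lambda> by blast
    then have "a - b = c" using B(2) lam(2) by simp
    then show ?thesis using chD(6)[OF ab(1,2)] c(3) by simp
  qed
  have "\<forall>a\<in>A. \<exists>p\<in>polys_over H. \<forall>w. \<Phi> a w = poly p w" using \<Phi>_poly by blast
  then obtain p where p: "\<And>a. a \<in> A \<Longrightarrow> p a \<in> polys_over H" "\<And>a w. a \<in> A \<Longrightarrow> \<Phi> a w = poly (p a) w" by metis
  \<comment> \<open>\<Phi> of z B d sends the point E(lam a/B) to E(a d z lam) = \<psi>(a d), so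
    T(\<omega> a) is the Gauss sum shifted by a. The product z B lies in A because B lies in
    \<open>Z\<close>.\<close>
  define T where "T = (\<Sum>d\<in>R. smult (inverse (\<chi> d)) (p (z * B * d)))"
  have zB: "z * B \<in> A" using z[of B] B \<chi> by (auto simp: adapted_def)
  have zBd: "z * B * d \<in> A" if "d \<in> R" for d using zB that R AD by auto
  have T\<omega>: "poly T (\<omega> a) = gs \<chi> * \<chi> a" if a: "a \<in> A" for a
  proof -
    have "poly T (\<omega> a) = (\<Sum>d\<in>R. inverse (\<chi> d) * \<Phi> (z * B * d) (\<omega> a))"
      by (simp add: T_def poly_sum p(2)[OF zBd])
    also have "\<dots> = (\<Sum>d\<in>R. inverse (\<chi> d) * \<psi> (a * d))"
    proof (rule sum.cong)
      fix d assume d: "d \<in> R"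
      have "\<Phi> (z * B * d) (\<omega> a) = E (z * B * d * (lam * a / B))" unfolding \<omega>_def by (rule E_\<Phi>[OF zBd[OF d], symmetric])
      also have "z * B * d * (lam * a / B) = a * d * z * lam" using B(2) by simp
      finally show "inverse (\<chi> d) * \<Phi> (z * B * d) (\<omega> a) = inverse (\<chi> d) * \<psi> (a * d)" by (simp add: \<psi>_def)
    qed simp
    finally show ?thesis using gs_shift[OF \<chi> a] by (simp add: mult.commute)
  qed
  have TL: "T \<in> polys_over L"
  proof -
    have "smult (inverse (\<chi> d)) (p (z * B * d)) \<in> polys_over L" if "d \<in> R" for d
      using p(1)[OF zBd[OF that]] L adaptedD(7)[OF \<chi> that]
      by (intro polys_over_closed(8)[OF LD(7)] LD(8)) (auto simp: polys_over_def)
    then show ?thesis by (auto simp: T_def polys_over_def coeff_sum intro!: sum_in_subring[OF LD(7)])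
  qed
  have \<omega>0: "\<omega> 0 = 0" by (simp add: \<omega>_def)
  have "poly T 0 = 0" using T\<omega>[of 0] chD AD \<omega>0 by simp
  \<comment> \<open>Without constant term, T(v)/v is a polynomial in v, and its sum over
    \<open>W\<close> is a symmetric function of the torsion points.\<close>
  then obtain T' where T': "T = pCons 0 T'" by (cases T) auto
  have T'L: "T' \<in> polys_over L" unfolding polys_over_def
  proof safe
    fix n show "coeff T' n \<in> L" using TL by (metis T' coeff_pCons_Suc mem_Collect_eq polys_over_def)
  qed
  have W0: "0 \<in> W" using \<omega>0 AD unfolding W_def by (metis imageI)
  have "(\<Sum>v\<in>W - {0}. poly T v / v) = (\<Sum>v\<in>W - {0}. poly T' v)"
    by (rule sum.cong) (auto simp: T')
  also have "\<dots> = (\<Sum>v\<in>W. poly T' v) - poly T' 0" using finW W0 by (simp add: sum_diff1)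
  also have "\<dots> \<in> L"
    using sum_poly_over_roots_in_subring[OF LD(7) finW RW T'L] poly_in_subring[OF LD(7) T'L LD(1)] LD(5) by blast
  finally have sumL: "(\<Sum>v\<in>W - {0}. poly T v / v) \<in> L" .
  define rep where "rep v = (SOME a. a \<in> A \<and> \<omega> a = v)" for v
  have rep: "rep v \<in> A" "\<omega> (rep v) = v" if "v \<in> W" for v
  proof -
    have "\<exists>a. a \<in> A \<and> \<omega> a = v" using that by (auto simp: W_def)
    then have "rep v \<in> A \<and> \<omega> (rep v) = v" unfolding rep_def by (rule someI_ex)
    then show "rep v \<in> A" "\<omega> (rep v) = v" by auto
  qed
  define S where "S v = {a \<in> A. \<omega> a = v}" for v
  have part: "((\<lambda>a. \<chi> a / a) has_sum (\<chi> (rep v) * lam / (B * v))) (S v)" if v: "v \<in> W - {0}" for v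
  proof -
    define a0 where "a0 = rep v"
    have a0: "a0 \<in> A" "\<omega> a0 = v" using rep[of v] v by (auto simp: a0_def)
    have "((\<lambda>l. 1 / (lam * a0 / B + l)) has_sum (1 / v)) \<Lambda>"
      using has_sum_inverse_E[of "lam * a0 / B"] a0(2) v by (simp add: \<omega>_def)
    then have "((\<lambda>l. (\<chi> a0 * lam / B) * (1 / (lam * a0 / B + l))) has_sum ((\<chi> a0 * lam / B) * (1 / v))) \<Lambda>"
      by (rule has_sum_cmult_right)
    \<comment> \<open>The fibre of \<omega> over v is a0 + (B/lam) \<Lambda>, so the expansion of
      1/E at lam a0/B becomes a sum over that fibre, on which \<chi> is constant.\<close>
    moreover have "bij_betw (\<lambda>l. a0 + B * l / lam) \<Lambda> (S v)"
    proof (rule bij_betw_imageI)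
      show "inj_on (\<lambda>l. a0 + B * l / lam) \<Lambda>" using B(2) lam(2) by (auto simp: inj_on_def)
      show "(\<lambda>l. a0 + B * l / lam) ` \<Lambda> = S v"
      proof safe
        fix l assume l: "l \<in> \<Lambda>"
        then obtain a where a: "a \<in> A" "B * l = lam * a" using B\<Lambda> by blast
        then have "a0 + B * l / lam \<in> A" using a0 AD lam(2) by simp
        moreover have "\<omega> (a0 + B * l / lam) = v"
          using l a0(2) B(2) lam(2) by (simp add: \<omega>_add) (simp add: \<omega>_def \<Lambda>_def)
        ultimately show "a0 + B * l / lam \<in> S v" by (simp add: S_def)
      next
        fix a assume a: "a \<in> S v"
        have "lam * (a - a0) / B \<in> \<Lambda>" using a a0(2)
          by (simp add: S_def \<Lambda>_def \<omega>_def right_diff_distrib diff_divide_distrib E_diff)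
        moreover have "a = a0 + B * (lam * (a - a0) / B) / lam" using B(2) lam(2) by simp
        ultimately show "a \<in> (\<lambda>l. a0 + B * l / lam) ` \<Lambda>" by blast
      qed
    qed
    moreover have "(\<chi> a0 * lam / B) * (1 / (lam * a0 / B + l)) = (\<lambda>a. \<chi> a0 / a) (a0 + B * l / lam)" for l
    proof -
      have "lam * a0 / B + l = (lam / B) * (a0 + B * l / lam)" using B(2) lam(2) by (simp add: field_simps)
      then show ?thesis using B(2) lam(2) by simp
    qed
    ultimately have "((\<lambda>a. \<chi> a0 / a) has_sum (\<chi> a0 * lam / B) * (1 / v)) (S v)"
      using has_sum_reindex_bij_betw[of "\<lambda>l. a0 + B * l / lam" \<Lambda> "S v" "\<lambda>a. \<chi> a0 / a"] by simp
    moreover have "\<chi> a = \<chi> a0" if "a \<in> S v" for a using that a0 \<omega>_\<chi>[of a a0] by (auto simp: S_def)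
    moreover have "(\<chi> a0 * lam / B) * (1 / v) = \<chi> a0 * lam / (B * v)" by simp
    ultimately show ?thesis
      using has_sum_cong[of "S v" "\<lambda>a. \<chi> a / a" "\<lambda>a. \<chi> a0 / a"] by (simp add: a0_def)
  qed
  have un: "((\<lambda>a. \<chi> a / a) has_sum (\<Sum>v\<in>W - {0}. \<chi> (rep v) * lam / (B * v))) (\<Union>v\<in>W - {0}. S v)"
    by (rule has_sum_finite_UN) (use finW part in \<open>auto simp: S_def\<close>)
  have "((\<lambda>a. \<chi> a / a) has_sum (\<Sum>v\<in>W - {0}. \<chi> (rep v) * lam / (B * v))) (A - {0})"
  proof (rule has_sum_cong_neutral[THEN iffD1, OF _ _ _ un])
    \<comment> \<open>The terms left out lie over the torsion point 0, where \<chi>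
      vanishes.\<close>
    fix a assume "a \<in> (A - {0}) - (\<Union>v\<in>W - {0}. S v)"
    then have "a \<in> A" "\<omega> a = \<omega> 0" using \<omega>0 by (auto simp: S_def W_def)
    then have "\<chi> a = 0" using \<omega>_\<chi>[of a 0] AD chD by auto
    then show "\<chi> a / a = 0" by simp
  qed (auto simp: S_def \<omega>0)
  moreover have "gs \<chi> * (\<Sum>v\<in>W - {0}. \<chi> (rep v) * lam / (B * v)) / lam \<in> L"
  proof -
    have "gs \<chi> * (\<Sum>v\<in>W - {0}. \<chi> (rep v) * lam / (B * v)) / lam = (\<Sum>v\<in>W - {0}. poly T v / v) / B"
      unfolding sum_distrib_left sum_divide_distrib
    proof (rule sum.cong)
      fix v assume v: "v \<in> W - {0}"
      then have "poly T v = gs \<chi> * \<chi> (rep v)" using T\<omega>[of "rep v"] rep[of v] by simp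
      then show "gs \<chi> * (\<chi> (rep v) * lam / (B * v)) / lam = poly T v / v / B"
        using lam(2) B(2) v by (simp only:) (simp add: field_simps)
    qed simp
    moreover have "B \<in> L" using B(1) H(2) L(2) by blast
    ultimately show ?thesis using LD(9)[OF sumL] by simp
  qed
  ultimately show ?thesis by blast
qed

lemma char_frobenius:
  assumes "adapted \<chi>"
  shows "adapted (\<lambda>a. \<chi> a ^ (q ^ n))"
proof -
  note chD = is_charD[OF adaptedD(1)[OF assms]]
  have inj: "inj (\<lambda>x::'c. x ^ (q ^ n))"
  proof (rule injI)
    fix x y :: 'c assume "x ^ (q ^ n) = y ^ (q ^ n)"
    then have "(x - y) ^ (q ^ n) = 0" by (simp add: frob_diff)
    then show "x = y" by simp
  qed
  have q0: "q ^ n > 0" using q2 by simp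
  have im: "(\<lambda>a. \<chi> a ^ (q ^ n)) ` A = (\<lambda>x. x ^ (q ^ n)) ` \<chi> ` A" by (simp add: image_image)
  have "is_char (\<lambda>a. \<chi> a ^ (q ^ n))"
    unfolding is_char_def
  proof (intro conjI ballI)
    show "finite ((\<lambda>a. \<chi> a ^ (q ^ n)) ` A)" unfolding im using chD(4) by simp
    show "\<exists>b\<in>A. b \<noteq> 0 \<and> \<chi> b ^ (q ^ n) = 0" using chD(5) q0 by (auto simp: power_0_left)
  qed (auto simp: chD frob_add frob_F power_mult_distrib)
  moreover have "{a \<in> A. \<chi> a ^ (q ^ n) = 0} = Z" using assms q0 by (auto simp: adapted_def power_0_left)
  moreover have "bij_betw (\<lambda>a. \<chi> a ^ (q ^ n)) R ((\<lambda>a. \<chi> a ^ (q ^ n)) ` A - {0})"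
  proof -
    have "bij_betw ((\<lambda>x. x ^ (q ^ n)) \<circ> \<chi>) R ((\<lambda>x. x ^ (q ^ n)) ` (\<chi> ` A - {0}))"
      by (rule bij_betw_trans[OF adaptedD(4)[OF assms]]) (use inj in \<open>auto simp: bij_betw_def intro: inj_on_subset\<close>)
    moreover have "(\<lambda>x. x ^ (q ^ n)) ` (\<chi> ` A - {0}) = (\<lambda>a. \<chi> a ^ (q ^ n)) ` A - {0}"
      unfolding im using q0 by (auto simp: power_0_left)
    ultimately show ?thesis by (simp add: comp_def)
  qed
  ultimately show ?thesis by (simp add: adapted_def)
qed

text \<open>A shift by t multiplies gs(\<chi>)^q by \<chi>(t)^q. By \<open>twist\<close> the same
  sum is \<alpha> gs(\<chi>)^q plus a term in which \<psi> occurs linearly, a multiple of the Gauss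
  sum of the twist. As \<chi>(t)^q differs from \<alpha>, one can solve for gs(\<chi>)^q.\<close>

lemma gs_frobenius:
  assumes \<chi>: "adapted \<chi>" and L: "is_subfield L" "H \<subseteq> L" "\<chi> ` A \<subseteq> L"
  shows "\<exists>c\<in>L. gs \<chi> ^ q = c * gs (\<lambda>a. \<chi> a ^ q)"
proof -
  let ?\<chi> = "\<lambda>a. \<chi> a ^ q"
  note LD = is_subringD[OF is_subfieldD(1)[OF L(1)]] is_subfieldD[OF L(1)]
  have \<chi>': "adapted ?\<chi>" using char_frobenius[OF \<chi>, of 1] by simp
  note ch' = adaptedD[OF \<chi>']
  have \<chi>'L: "?\<chi> a \<in> L" if "a \<in> A" for a using L(3) that power_in_subring[OF LD(7)] by auto
  \<comment> \<open>By the shift, a summand h \<Phi>_a of f contributes h \<chi>(a)^q times the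
    Gauss sum of the twist.\<close>
  have "\<exists>c\<in>L. (\<Sum>d\<in>R. inverse (?\<chi> d) * f (\<psi> d)) = c * gs ?\<chi>" if "f \<in> \<N>" for f
    using that
  proof induction
    case zero
    show ?case using LD by (intro bexI[of _ 0]) auto
  next
    case (step f h a)
    then obtain c where c: "c \<in> L" "(\<Sum>d\<in>R. inverse (?\<chi> d) * f (\<psi> d)) = c * gs ?\<chi>" by blast
    have "(\<Sum>d\<in>R. inverse (?\<chi> d) * (f (\<psi> d) + h * \<Phi> a (\<psi> d))) =
        (\<Sum>d\<in>R. inverse (?\<chi> d) * f (\<psi> d)) + h * (\<Sum>d\<in>R. inverse (?\<chi> d) * \<psi> (a * d))"
      using step(3) by (simp add: \<psi>_props distrib_left sum.distrib sum_distrib_left mult.left_commute)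
    also have "\<dots> = (c + h * ?\<chi> a) * gs ?\<chi>" unfolding c(2) gs_shift[OF \<chi>' step(3)] by (simp add: algebra_simps)
    finally show ?case
      using LD(4)[OF c(1) LD(6)[OF subsetD[OF L(2) step(2)] \<chi>'L[OF step(3)]]] by (intro bexI[of _ "c + h * ?\<chi> a"])
  qed
  then obtain c where c: "c \<in> L" "(\<Sum>d\<in>R. inverse (?\<chi> d) * \<nu> (\<psi> d)) = c * gs ?\<chi>" using \<nu> by blast
  have gq: "gs \<chi> ^ q = (\<Sum>d\<in>R. inverse (?\<chi> d) * \<psi> d ^ q)"
    using frob_sum[of "\<lambda>d. inverse (\<chi> d) * \<psi> d" R 1] by (simp add: gs_def power_mult_distrib power_inverse)
  have "?\<chi> t * gs \<chi> ^ q = (\<Sum>d\<in>R. inverse (?\<chi> d) * \<psi> (t * d) ^ q)"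
    unfolding gq
  proof (rule gauss_shift[OF ch'(1) R ch'(4), symmetric])
    show "\<psi> a ^ q = \<psi> b ^ q" if "a \<in> A" "b \<in> A" "?\<chi> a = ?\<chi> b" for a b
      using ch'(3)[OF that] by simp
    show "\<psi> a ^ q = 0" if "a \<in> A" "?\<chi> a = 0" for a
      using ch'(2)[OF that] q2 by (simp add: power_0_left)
  qed (rule A(3))
  also have "\<dots> = (\<Sum>d\<in>R. inverse (?\<chi> d) * (\<alpha> * \<psi> d ^ q + \<nu> (\<psi> d)))"
    using A(3) by (simp add: \<psi>_props twist)
  also have "\<dots> = \<alpha> * gs \<chi> ^ q + c * gs ?\<chi>"
    unfolding gq c(2)[symmetric] by (simp add: distrib_left sum.distrib sum_distrib_left mult.left_commute)
  finally have "(?\<chi> t - \<alpha>) * gs \<chi> ^ q = c * gs ?\<chi>" by (simp add: algebra_simps)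
  moreover have "?\<chi> t \<noteq> \<alpha>" using absv_char_le_1[OF ch'(1) A(3)] \<alpha>(2) by auto
  ultimately have "gs \<chi> ^ q = c / (?\<chi> t - \<alpha>) * gs ?\<chi>" by (simp add: field_simps)
  moreover have "c / (?\<chi> t - \<alpha>) \<in> L" using c(1) \<chi>'L[OF A(3)] \<alpha>(1) L(2) LD by auto
  ultimately show ?thesis by blast
qed

lemma gs_frobenius_power:
  assumes \<chi>: "adapted \<chi>" and L: "is_subfield L" "H \<subseteq> L" "\<chi> ` A \<subseteq> L"
  shows "\<exists>c\<in>L. gs \<chi> ^ (q ^ n) = c * gs (\<lambda>a. \<chi> a ^ (q ^ n))"
proof (induction n)
  note LD = is_subringD[OF is_subfieldD(1)[OF L(1)]] is_subfieldD[OF L(1)]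
  case 0
  show ?case using LD by (intro bexI[of _ 1]) auto
next
  note LD = is_subringD[OF is_subfieldD(1)[OF L(1)]] is_subfieldD[OF L(1)]
  case (Suc n)
  then obtain c where c: "c \<in> L" "gs \<chi> ^ (q ^ n) = c * gs (\<lambda>a. \<chi> a ^ (q ^ n))" by blast
  have "(\<lambda>a. \<chi> a ^ (q ^ n)) ` A \<subseteq> L" using L(3) power_in_subring[OF LD(7)] by auto
  then obtain d where d: "d \<in> L" "gs (\<lambda>a. \<chi> a ^ (q ^ n)) ^ q = d * gs (\<lambda>a. (\<chi> a ^ (q ^ n)) ^ q)"
    using gs_frobenius[OF char_frobenius[OF \<chi>, of n] L(1,2)] by blast
  have "gs \<chi> ^ (q ^ Suc n) = (gs \<chi> ^ (q ^ n)) ^ q" by (simp add: power_mult[symmetric] mult.commute)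
  also have "\<dots> = (c ^ q * d) * gs (\<lambda>a. \<chi> a ^ (q ^ Suc n))"
    unfolding c(2) power_mult_distrib d(2) by (simp add: power_mult[symmetric] mult_ac)
  finally show ?case
    using LD(6)[OF power_in_subring[OF LD(7) c(1)] d(1)] by (intro bexI[of _ "c ^ q * d"])
qed

lemma char_period:
  assumes "adapted \<chi>"
  shows "\<exists>m>0. \<forall>a\<in>A. \<chi> a ^ (q ^ m) = \<chi> a"
proof -
  note chD = is_charD[OF adaptedD(1)[OF assms]]
  note kD = is_subringD[OF is_subfieldD(1)[OF chD(9)]]
  have "F \<subseteq> \<chi> ` A" using A(2) chD(3) by (metis imageI subset_iff)
  then have "fspace F (\<chi> ` A)" using kD by (auto simp: fspace_def)
  then obtain r where r: "card (\<chi> ` A) = q ^ r" using fspace_basis[OF F _ chD(4)] q_def by blast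
  have "card (\<chi> ` A) \<ge> 2" using card_finite_subfield(3)[OF chD(9,4)] .
  then have "r > 0" using r by (cases r) auto
  moreover have "\<chi> a ^ (q ^ r) = \<chi> a" if "a \<in> A" for a
    using finite_subfield_power_card[OF chD(9,4)] that r by auto
  ultimately show ?thesis by blast
qed

text \<open>A vanishing Gauss sum would make those of all twists vanish. Adding them up replaces
  \<chi>(d)^-1 by its trace, a constant, which the linear \<psi> can absorb: \<psi>(s) = 0 for some
  s in A with \<chi>(s) = -1. Then \<psi>(1) = \<psi>(s + 1) - \<psi>(s) = 0, contrary to
  \<open>Ez\<close>.\<close>

lemma gs_nonzero:
  assumes \<chi>: "adapted \<chi>"
  shows "gs \<chi> \<noteq> 0"
proof
  assume g0: "gs \<chi> = 0"
  note chD = is_charD[OF adaptedD(1)[OF \<chi>]]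
  note kD = is_subringD[OF is_subfieldD(1)[OF chD(9)]] is_subfieldD[OF chD(9)]
  define P where "P m \<longleftrightarrow> m > 0 \<and> (\<forall>a\<in>A. \<chi> a ^ (q ^ m) = \<chi> a)" for m
  \<comment> \<open>The least period, so that for 0 < j < m the map x -> x^(q^j) is not the identity
    on the image of \<chi>.\<close>
  define m where "m = (LEAST m. P m)"
  have "\<exists>m. P m" using char_period[OF \<chi>] by (auto simp: P_def)
  then have Pm: "P m" unfolding m_def by (metis LeastI)
  have minm: "\<not> P j" if "j < m" for j using that not_less_Least unfolding m_def by blast
  have per: "\<chi> a ^ (q ^ m) = \<chi> a" if "a \<in> A" for a using Pm that by (simp add: P_def)
  have gz: "gs (\<lambda>a. \<chi> a ^ (q ^ j)) = 0" if "j < m" for j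
  proof -
    let ?\<chi> = "\<lambda>a. \<chi> a ^ (q ^ j)"
    \<comment> \<open>Twisting m - j more times leads back to \<chi>, so a power of this Gauss sum
      is a multiple of \<open>gs \<chi>\<close>. Where the factor lies is irrelevant, hence
      \<open>UNIV\<close> as the field.\<close>
    have "\<exists>c\<in>UNIV. gs ?\<chi> ^ (q ^ (m - j)) = c * gs (\<lambda>a. ?\<chi> a ^ (q ^ (m - j)))"
      by (rule gs_frobenius_power[OF char_frobenius[OF \<chi>]]) (auto simp: is_subfield_def is_subring_def)
    then obtain c where "gs ?\<chi> ^ (q ^ (m - j)) = c * gs (\<lambda>a. ?\<chi> a ^ (q ^ (m - j)))" by blast
    also have "gs (\<lambda>a. ?\<chi> a ^ (q ^ (m - j))) = gs \<chi>"
      unfolding gs_def using that adaptedD(7)[OF \<chi>]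
      by (intro sum.cong) (auto simp: power_mult[symmetric] power_add[symmetric] per)
    finally show ?thesis using g0 by simp
  qed
  let ?k = "\<chi> ` A - {0}"
  define Tr where "Tr x = (\<Sum>j<m. x ^ (q ^ j))" for x :: 'c
  have TrF: "Tr (inverse (\<chi> d)) \<in> F" if "d \<in> A" for d
  proof (rule mem_finite_subfieldI[OF F])
    let ?x = "inverse (\<chi> d)"
    have "Tr ?x ^ card F = (\<Sum>j<m. ?x ^ (q ^ Suc j))"
      using frob_sum[of "\<lambda>j. ?x ^ (q ^ j)" "{..<m}" 1]
      by (simp add: Tr_def q_def[symmetric] power_mult[symmetric] mult.commute)
    moreover have "?x ^ (q ^ 0) + (\<Sum>j<m. ?x ^ (q ^ Suc j)) = Tr ?x + ?x ^ (q ^ m)"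
      unfolding Tr_def using sum.lessThan_Suc_shift[of "\<lambda>j. ?x ^ (q ^ j)" m] sum.lessThan_Suc[of "\<lambda>j. ?x ^ (q ^ j)" m]
      by (simp only:)
    moreover have "?x ^ (q ^ m) = ?x" using per[OF that] by (simp add: power_inverse)
    ultimately show "Tr ?x ^ card F = Tr ?x" by simp
  qed
  define s where "s = (\<Sum>d\<in>R. Tr (inverse (\<chi> d)) * d)"
  have RA: "d \<in> A" if "d \<in> R" for d using adaptedD(7)[OF \<chi> that] .
  have TrA: "Tr (inverse (\<chi> d)) \<in> A" if "d \<in> R" for d using TrF[OF RA[OF that]] A(2) by auto
  have sA: "s \<in> A" unfolding s_def using RA TrA AD by (intro sum_in_subring[OF A(1)]) auto
  have "\<psi> s = (\<Sum>d\<in>R. Tr (inverse (\<chi> d)) * \<psi> d)"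
    unfolding s_def using TrF RA by (simp add: \<psi>_props)
  also have "\<dots> = (\<Sum>j<m. gs (\<lambda>a. \<chi> a ^ (q ^ j)))"
    by (simp add: Tr_def gs_def sum_distrib_right sum.swap[of _ R] power_inverse)
  also have "\<dots> = 0" using gz by simp
  finally have "\<psi> s = 0" .
  have "\<chi> s = (\<Sum>d\<in>R. Tr (inverse (\<chi> d)) * \<chi> d)"
    unfolding s_def using RA TrA AD TrF by (subst char_sum[OF adaptedD(1)[OF \<chi>]]) (auto simp: chD)
  also have "\<dots> = (\<Sum>\<kappa>\<in>?k. Tr (inverse \<kappa>) * \<kappa>)" by (rule sum.reindex_bij_betw[OF adaptedD(4)[OF \<chi>]])
  also have "\<dots> = (\<Sum>j<m. \<Sum>\<kappa>\<in>?k. inverse \<kappa> ^ (q ^ j) * \<kappa>)"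
    by (simp add: Tr_def sum_distrib_right sum.swap[of _ ?k])
  \<comment> \<open>Orthogonality: for j > 0 the summand is a nontrivial character of the
    multiplicative group, so replacing \<kappa> by a multiple scales the sum by some u \<noteq> 1.
    For j = 0 one counts the units, whose number is -1 in the field.\<close>
  also have "\<dots> = (\<Sum>j<m. if j = 0 then - 1 else 0)"
  proof (rule sum.cong)
    fix j assume j: "j \<in> {..<m}"
    show "(\<Sum>\<kappa>\<in>?k. inverse \<kappa> ^ (q ^ j) * \<kappa>) = (if j = 0 then - 1 else 0)"
    proof (cases "j = 0")
      case True
      have "(\<Sum>\<kappa>\<in>?k. inverse \<kappa> ^ (q ^ j) * \<kappa>) = (\<Sum>\<kappa>\<in>?k. 1)" using True by (intro sum.cong) auto
      also have "\<dots> = of_nat (card (\<chi> ` A) - 1)" using chD(4) kD(1) by (simp add: card_Diff_singleton)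
      also have "\<dots> = - 1"
        using card_finite_subfield(3,4)[OF chD(9,4)] by (simp add: of_nat_diff)
      finally show ?thesis using True by simp
    next
      case False
      then have "\<not> P j" "j > 0" using j minm by auto
      then obtain a where a: "a \<in> A" "\<chi> a ^ (q ^ j) \<noteq> \<chi> a" by (auto simp: P_def)
      define u where "u = inverse (\<chi> a) ^ (q ^ j) * \<chi> a"
      have a0: "\<chi> a \<noteq> 0" using a(2) q2 by (auto simp: power_0_left)
      have "u \<noteq> 1"
      proof
        assume "u = 1"
        then have "\<chi> a ^ (q ^ j) * (inverse (\<chi> a) ^ (q ^ j) * \<chi> a) = \<chi> a ^ (q ^ j) * 1" by (simp only: u_def)
        moreover have "\<chi> a ^ (q ^ j) * inverse (\<chi> a) ^ (q ^ j) = 1" using a0 by (simp flip: power_mult_distrib)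
        ultimately show False using a(2) by (simp only: mult.assoc[symmetric] mult_1 mult_1_right) simp
      qed
      have "(\<Sum>\<kappa>\<in>?k. inverse \<kappa> ^ (q ^ j) * \<kappa>) = (\<Sum>\<kappa>\<in>?k. u * (inverse \<kappa> ^ (q ^ j) * \<kappa>))"
      proof (rule sum.reindex_bij_witness[where i = "\<lambda>\<kappa>. \<chi> a * \<kappa>" and j = "\<lambda>\<kappa>. inverse (\<chi> a) * \<kappa>"])
        fix \<kappa> assume k: "\<kappa> \<in> ?k"
        then show "\<chi> a * \<kappa> \<in> ?k" "inverse (\<chi> a) * \<kappa> \<in> ?k" using a0 a(1) kD by auto
        show "u * (inverse (inverse (\<chi> a) * \<kappa>) ^ (q ^ j) * (inverse (\<chi> a) * \<kappa>)) = inverse \<kappa> ^ (q ^ j) * \<kappa>"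
        proof -
          have 1: "inverse (\<chi> a) ^ (q ^ j) * \<chi> a ^ (q ^ j) = 1" using a0 by (simp flip: power_mult_distrib)
          have 2: "\<chi> a * inverse (\<chi> a) = 1" using a0 by simp
          have "u * (inverse (inverse (\<chi> a) * \<kappa>) ^ (q ^ j) * (inverse (\<chi> a) * \<kappa>)) =
              (inverse (\<chi> a) ^ (q ^ j) * \<chi> a ^ (q ^ j)) * (\<chi> a * inverse (\<chi> a)) * (inverse \<kappa> ^ (q ^ j) * \<kappa>)"
            by (simp only: u_def inverse_mult_distrib inverse_inverse_eq power_mult_distrib mult_ac)
          then show ?thesis by (simp only: 1 2 mult_1)
        qed
      qed (use a0 in auto)
      also have "\<dots> = u * (\<Sum>\<kappa>\<in>?k. inverse \<kappa> ^ (q ^ j) * \<kappa>)" by (simp add: sum_distrib_left)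
      finally have "(u - 1) * (\<Sum>\<kappa>\<in>?k. inverse \<kappa> ^ (q ^ j) * \<kappa>) = 0" by (simp add: algebra_simps)
      then show ?thesis using \<open>u \<noteq> 1\<close> False by simp
    qed
  qed simp
  also have "\<dots> = - 1" using Pm by (simp add: P_def)
  finally have "\<chi> (s + 1) = 0" using chD(1)[OF sA AD(2)] chD(8) by simp
  then have "\<psi> (s + 1) = 0" using adaptedD(2)[OF \<chi>] sA AD by auto
  then have "\<psi> 1 = 0" using \<psi>_props(1)[of s 1] \<open>\<psi> s = 0\<close> by simp
  then show False using Ez by (simp add: \<psi>_def)
qed

text \<open>The q^n-th power map is additive and continuous, so it carries the series at 1 of a
  twist of \<chi> to the series at q^n of a further twist. The first twist is chosen such that the
  second is \<chi> itself, and \<open>gs_frobenius_power\<close> converts the Gauss sums.\<close>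

lemma L_series:
  assumes \<chi>: "adapted \<chi>" and L: "is_subfield L" "H \<subseteq> L" "\<chi> ` A \<subseteq> L"
  shows "\<exists>S k. ((\<lambda>a. \<chi> a / a ^ (q ^ n)) has_sum S) (A - {0}) \<and> k \<in> L \<and> S = k * (lam ^ (q ^ n) / gs \<chi>)"
proof -
  note LD = is_subringD[OF is_subfieldD(1)[OF L(1)]] is_subfieldD[OF L(1)]
  obtain m where m: "m > 0" "\<And>a. a \<in> A \<Longrightarrow> \<chi> a ^ (q ^ m) = \<chi> a" using char_period[OF \<chi>] by blast
  have per: "\<chi> a ^ (q ^ (i * m)) = \<chi> a" if "a \<in> A" for a i
    by (induction i) (use m(2)[OF that] in \<open>auto simp: power_add power_mult\<close>)
  \<comment> \<open>Twisting by \<open>j\<close> and then by \<open>n\<close> makes n full periods.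
    The subtraction is not truncated because m > 0.\<close>
  define j where "j = n * m - n"
  have jn: "j + n = n * m" using m(1) by (simp add: j_def)
  let ?\<chi> = "\<lambda>a. \<chi> a ^ (q ^ j)"
  have untwist: "?\<chi> a ^ (q ^ n) = \<chi> a" if "a \<in> A" for a
    using per[OF that, of n] by (simp add: power_mult[symmetric] power_add[symmetric] jn)
  have \<chi>': "adapted ?\<chi>" by (rule char_frobenius[OF \<chi>])
  have \<chi>'L: "?\<chi> ` A \<subseteq> L" using L(3) power_in_subring[OF LD(7)] by auto
  obtain S where S: "((\<lambda>a. ?\<chi> a / a) has_sum S) (A - {0})" "gs ?\<chi> * S / lam \<in> L"
    using L_series_1[OF \<chi>' L(1,2) \<chi>'L] by blast
  have cont: "(\<lambda>x::'c. x ^ k) \<midarrow>x\<rightarrow> x ^ k" for x k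
    by (induction k) (auto intro!: tendsto_mult tendsto_const tendsto_ident_at)
  have "((\<lambda>x. x ^ (q ^ n)) \<circ> (\<lambda>a. ?\<chi> a / a) has_sum S ^ (q ^ n)) (A - {0})"
    using S(1) cont by (intro has_sum_comm_additive_general) (auto simp: frob_sum)
  then have sum: "((\<lambda>a. \<chi> a / a ^ (q ^ n)) has_sum S ^ (q ^ n)) (A - {0})"
    by (rule has_sum_cong[THEN iffD1, rotated]) (auto simp: power_divide untwist)
  obtain c where c: "c \<in> L" "gs ?\<chi> ^ (q ^ n) = c * gs (\<lambda>a. ?\<chi> a ^ (q ^ n))"
    using gs_frobenius_power[OF \<chi>' L(1,2) \<chi>'L] by blast
  have "gs (\<lambda>a. ?\<chi> a ^ (q ^ n)) = gs \<chi>"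
    unfolding gs_def using adaptedD(7)[OF \<chi>] by (intro sum.cong) (auto simp: untwist)
  then have gc: "gs ?\<chi> ^ (q ^ n) = c * gs \<chi>" using c(2) by simp
  have nz: "gs ?\<chi> \<noteq> 0" "gs \<chi> \<noteq> 0" using gs_nonzero \<chi> \<chi>' by auto
  then have "c \<noteq> 0" using gc by auto
  define k where "k = (gs ?\<chi> * S / lam) ^ (q ^ n) / c"
  have "k \<in> L" unfolding k_def by (intro LD(9) power_in_subring[OF LD(7)] S(2) c(1))
  moreover have "S ^ (q ^ n) = k * (lam ^ (q ^ n) / gs \<chi>)"
    using lam(2) nz \<open>c \<noteq> 0\<close> gc by (simp add: k_def power_mult_distrib power_divide field_simps)
  ultimately show ?thesis using sum by blast
qed

end

section \<open>The point where the motive is not generated by 1\<close>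

lemma degree_sum_distinct:
  fixes p :: "'j \<Rightarrow> 'a::comm_ring_1 poly"
  assumes "finite J" "J \<noteq> {}" "inj_on (\<lambda>j. degree (p j)) J"
  shows "\<exists>j\<in>J. degree (\<Sum>j\<in>J. p j) = degree (p j)"
  using assms
proof (induction J rule: finite_ne_induct)
  case (insert j J)
  then obtain k where k: "k \<in> J" "degree (\<Sum>j\<in>J. p j) = degree (p k)" by (auto simp: inj_on_def)
  have "degree (p j) \<noteq> degree (p k)" using insert k by (auto simp: inj_on_def)
  then have "degree (p j + (\<Sum>j\<in>J. p j)) \<in> {degree (p j), degree (p k)}"
    using degree_add_eq_left[of "\<Sum>j\<in>J. p j" "p j"] degree_add_eq_right[of "p j" "\<Sum>j\<in>J. p j"] k(2)
    by (cases "degree (p j) < degree (p k)") auto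
  then show ?case using insert k by auto
qed simp

locale elliptic_module = rank_one_module F A H D q t x1 \<Phi> E \<rho>
  for F A H D :: "'c::complete_nonarch_field set" and q t x1 \<Phi> E \<rho> +
  fixes y y1 y2 :: 'c
  assumes y: "y \<in> A" and coeffs: "x1 \<in> H" "y1 \<in> H" "y2 \<in> H"
    and \<Phi>_y: "\<And>w. \<Phi> y w = y * w + y1 * w ^ q + y2 * w ^ (q ^ 2) + w ^ (q ^ 3)"
    and basis: "\<And>a. a \<in> A \<Longrightarrow> \<exists>n c d. (\<forall>i. c i \<in> F \<and> d i \<in> F) \<and> (\<forall>i\<ge>n. c i = 0 \<and> d i = 0) \<and>
      a = (\<Sum>i<n. c i * t ^ i + d i * (t ^ i * y))"
begin

lemma tA: "t ^ i \<in> A" "t ^ i * y \<in> A"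
  using power_in_subring[OF A(1) A(3)] y AD by auto

text \<open>The powers of t have different absolute values, so the field is infinite.\<close>

lemma poly_fun_eq:
  assumes "\<And>w. poly p w = poly r (w::'c)"
  shows "p = r"
proof (rule ccontr)
  assume "p \<noteq> r"
  then have "finite {w. poly (p - r) w = 0}" by (intro poly_roots_finite) simp
  then have "finite (UNIV :: 'c set)" using assms by simp
  moreover have "inj (\<lambda>i::nat. t ^ i)"
  proof (rule injI)
    fix i j assume "t ^ i = t ^ j"
    then have "real q ^ (2 * i) = real q ^ (2 * j)" by (metis absv_t_power)
    then show "i = j" using q2 by (simp add: power_inject_exp)
  qed
  ultimately show False using finite_imageD[of "\<lambda>i::nat. t ^ i" UNIV] finite_subset[OF subset_UNIV] by blast
qed

lemma \<Phi>_combination: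
  assumes "\<And>i. c i \<in> F \<and> d i \<in> F"
  shows "\<Phi> (\<Sum>i<n. c i * t ^ i + d i * (t ^ i * y)) w = (\<Sum>i<n. c i * \<Phi> (t ^ i) w + d i * \<Phi> (t ^ i * y) w)"
proof (induction n)
  case 0
  show ?case using \<Phi>_const[of 0 w] FD by simp
next
  case (Suc n)
  have inA: "c i * t ^ i \<in> A" "d i * (t ^ i * y) \<in> A" for i
    using assms A(2) tA by (auto intro!: AD(6)[of "c i"] AD(6)[of "d i"])
  have "(\<Sum>i<n. c i * t ^ i + d i * (t ^ i * y)) \<in> A" using inA AD by (intro sum_in_subring[OF A(1)]) auto
  moreover have "\<Phi> (c n * t ^ n) w = c n * \<Phi> (t ^ n) w" "\<Phi> (d n * (t ^ n * y)) w = d n * \<Phi> (t ^ n * y) w"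
    using \<Phi>_mult[of "c n" "t ^ n" w] \<Phi>_mult[of "d n" "t ^ n * y" w] assms A(2) tA by (auto simp: \<Phi>_const subset_iff)
  ultimately show ?case using Suc inA AD by (simp add: \<Phi>_add_left)
qed

lemma \<N>_normal_form:
  assumes "f \<in> \<N>"
  shows "\<exists>n g h. (\<forall>i\<ge>n. g i = 0 \<and> h i = 0) \<and> (\<forall>w. f w = (\<Sum>i<n. g i * \<Phi> (t ^ i) w + h i * \<Phi> (t ^ i * y) w))"
  using assms
proof induction
  case zero
  show ?case by (intro exI[of _ 0] exI[of _ "\<lambda>_. 0"]) auto
next
  case (step f u a)
  then obtain n g h where n: "\<forall>i\<ge>n. g i = 0 \<and> h i = 0"
    "\<And>w. f w = (\<Sum>i<n. g i * \<Phi> (t ^ i) w + h i * \<Phi> (t ^ i * y) w)" by blast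
  obtain m c d where m: "\<forall>i. c i \<in> F \<and> d i \<in> F" "\<forall>i\<ge>m. c i = 0 \<and> d i = 0"
    "a = (\<Sum>i<m. c i * t ^ i + d i * (t ^ i * y))" using basis[OF step(3)] by blast
  define N where "N = max n m"
  have "f w = (\<Sum>i<N. g i * \<Phi> (t ^ i) w + h i * \<Phi> (t ^ i * y) w)" for w
    unfolding n(2) by (rule sum.mono_neutral_left) (use n(1) in \<open>auto simp: N_def\<close>)
  moreover have "\<Phi> a w = (\<Sum>i<N. c i * \<Phi> (t ^ i) w + d i * \<Phi> (t ^ i * y) w)" for w
  proof -
    have "\<Phi> a w = (\<Sum>i<m. c i * \<Phi> (t ^ i) w + d i * \<Phi> (t ^ i * y) w)"
      unfolding m(3) by (rule \<Phi>_combination) (use m(1) in blast)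
    also have "\<dots> = (\<Sum>i<N. c i * \<Phi> (t ^ i) w + d i * \<Phi> (t ^ i * y) w)"
      by (rule sum.mono_neutral_left) (use m(2) in \<open>auto simp: N_def\<close>)
    finally show ?thesis .
  qed
  ultimately have "f w + u * \<Phi> a w = (\<Sum>i<N. (g i + u * c i) * \<Phi> (t ^ i) w + (h i + u * d i) * \<Phi> (t ^ i * y) w)" for w
    by (simp add: sum.distrib sum_distrib_left algebra_simps)
  moreover have "\<forall>i\<ge>N. g i + u * c i = 0 \<and> h i + u * d i = 0" using n(1) m(2) by (simp add: N_def)
  ultimately show ?case by (intro exI[of _ N] exI[of _ "\<lambda>i. g i + u * c i"] exI[of _ "\<lambda>i. h i + u * d i"]) auto
qed

text \<open>The degrees \<open>2i\<close> and \<open>2i+3\<close> of \<open>\<Phi> (t^i)\<close> and \<open>\<Phi> (t^i y)\<close> are distinct and never equal to 1.\<close>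

lemma frobenius_notin_\<N>:
  assumes "(\<lambda>w. s * w ^ q) \<in> \<N>"
  shows "s = 0"
proof (rule ccontr)
  assume s: "s \<noteq> 0"
  obtain n g h where gh: "\<And>w. s * w ^ q = (\<Sum>i<n. g i * \<Phi> (t ^ i) w + h i * \<Phi> (t ^ i * y) w)"
    using \<N>_normal_form[OF assms] by blast
  have "\<forall>i. \<exists>p. degree p = q ^ (2 * i) \<and> (\<forall>w. \<Phi> (t ^ i) w = poly p w)" using \<Phi>_t_power_poly by blast
  then obtain p where p: "\<And>i. degree (p i) = q ^ (2 * i)" "\<And>i w. \<Phi> (t ^ i) w = poly (p i) w" by metis
  define P where "P = monom y 1 + monom y1 q + monom y2 (q ^ 2) + monom 1 (q ^ 3)"
  have qq: "1 < q" "q < q ^ 3" "q ^ 2 < q ^ 3" "1 < q ^ 3"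
    using q2 power_strict_increasing[of 1 3 q] power_strict_increasing[of 2 3 q] power_strict_increasing[of 0 3 q] by auto
  have dP: "degree P = q ^ 3" using qq by (intro antisym degree_le le_degree) (auto simp: P_def)
  have \<Phi>ty: "\<Phi> (t ^ i * y) w = poly (pcompose (p i) P) w" for i w
    using tA y by (simp add: \<Phi>_mult p(2) poly_pcompose) (simp add: \<Phi>_y P_def poly_monom)
  \<comment> \<open>The Boolean in the index separates the multiples of \<Phi>(t^i), of degree
    q^(2i), from those of \<Phi>(t^i y), of degree q^(2i+3).\<close>
  define r where "r j = (if fst j then smult (g (snd j)) (p (snd j)) else smult (h (snd j)) (pcompose (p (snd j)) P))" for j
  define J where "J = {j \<in> UNIV \<times> {..<n}. r j \<noteq> 0}"
  have finJ: "finite J" by (simp add: J_def)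
  have "(\<Sum>j\<in>UNIV \<times> {..<n}. r j) = (\<Sum>j\<in>J. r j)"
    by (rule sum.mono_neutral_right) (auto simp: J_def)
  moreover have "(\<Sum>j\<in>UNIV \<times> {..<n}. r j) = (\<Sum>i<n. smult (g i) (p i) + smult (h i) (pcompose (p i) P))"
  proof -
    have "(\<Sum>j\<in>UNIV \<times> {..<n}. r j) = (\<Sum>b\<in>UNIV. \<Sum>i<n. r (b, i))" by (simp add: sum.cartesian_product)
    then show ?thesis by (simp add: UNIV_bool r_def sum.distrib add.commute)
  qed
  moreover have "monom s q = (\<Sum>i<n. smult (g i) (p i) + smult (h i) (pcompose (p i) P))"
    by (rule poly_fun_eq) (simp add: poly_monom gh p(2) \<Phi>ty poly_sum)
  ultimately have eq: "monom s q = (\<Sum>j\<in>J. r j)" by simp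
  have deg: "degree (r j) = q ^ (if fst j then 2 * snd j else 2 * snd j + 3)" if "j \<in> J" for j
    using that by (auto simp: J_def r_def degree_pcompose p(1) dP power_add split: if_splits)
  have qinj: "m = k" if "q ^ m = q ^ k" for m k using that q2 by (simp add: power_inject_exp)
  have "inj_on (\<lambda>j. degree (r j)) J"
  proof (rule inj_onI)
    fix j k assume jk: "j \<in> J" "k \<in> J" "degree (r j) = degree (r k)"
    have "(if fst j then 2 * snd j else 2 * snd j + 3) = (if fst k then 2 * snd k else 2 * snd k + 3)"
      by (intro qinj[OF jk(3)[unfolded deg[OF jk(1)] deg[OF jk(2)]]])
    then show "j = k" by (cases "fst j"; cases "fst k"; simp add: prod_eq_iff; presburger)
  qed
  moreover have "J \<noteq> {}" using eq s by auto
  ultimately obtain j where j: "j \<in> J" "degree (monom s q) = degree (r j)"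
    using degree_sum_distinct[OF finJ, of r] eq by auto
  have "q = q ^ (if fst j then 2 * snd j else 2 * snd j + 3)"
    using j(2) unfolding deg[OF j(1)] degree_monom_eq[OF s] .
  then have "1 = (if fst j then 2 * snd j else 2 * snd j + 3)" by (intro qinj[of 1]) (subst power_one_right)
  then show False by (cases "fst j"; simp; presburger)
qed

text \<open>The coordinate of \<open>f\<close> on the line spanned by the class of \<tau> modulo
  \<open>\<N>\<close>. Composition with the \<Phi>_a on the right acts on this line by scalars,
  which define the point (\<alpha>, \<beta>).\<close>

definition modN :: "('c \<Rightarrow> 'c) \<Rightarrow> 'c \<Rightarrow> bool" where
  "modN f s \<longleftrightarrow> s \<in> H \<and> (\<lambda>w. f w - s * w ^ q) \<in> \<N>"

lemma modN_unique: "modN f s \<Longrightarrow> modN f s' \<Longrightarrow> s = s'"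
  using frobenius_notin_\<N>[of "s' - s"] phi_span_diff[OF HD(7), of "\<lambda>w. f w - s * w ^ q" A \<Phi> "\<lambda>w. f w - s' * w ^ q"]
  by (auto simp: modN_def algebra_simps)

lemma modN_add: "modN f s \<Longrightarrow> modN g s' \<Longrightarrow> modN (\<lambda>w. f w + g w) (s + s')"
  using phi_span_add[of "\<lambda>w. f w - s * w ^ q" H A \<Phi> "\<lambda>w. g w - s' * w ^ q"] HD
  by (auto simp: modN_def algebra_simps)

lemma modN_smult: "modN f s \<Longrightarrow> c \<in> H \<Longrightarrow> modN (\<lambda>w. c * f w) (c * s)"
  using phi_span_smult[OF HD(7), of "\<lambda>w. f w - s * w ^ q" A \<Phi> c] HD
  by (auto simp: modN_def algebra_simps)

lemma modN_diff: "modN f s \<Longrightarrow> modN g s' \<Longrightarrow> modN (\<lambda>w. f w - g w) (s - s')"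
  using modN_add[of f s "\<lambda>w. (- 1) * g w" "(- 1) * s'"] modN_smult[of g s' "- 1"] HD by simp

lemma modN_\<N>: "f \<in> \<N> \<Longrightarrow> modN f 0"
  using HD by (simp add: modN_def)

lemma modN_frobenius: "modN (\<lambda>w. w ^ q) 1"
  using HD phi_span.zero by (simp add: modN_def)

lemma modN_\<Phi>: "a \<in> A \<Longrightarrow> modN (\<Phi> a) 0"
  using phi_span_single[of 1 H a A \<Phi>] HD by (intro modN_\<N>) simp

lemma modN_sum: "(\<And>i. i < n \<Longrightarrow> modN (f i) (s i)) \<Longrightarrow> modN (\<lambda>w. \<Sum>i<n. f i w) (\<Sum>i<(n::nat). s i)"
proof (induction n)
  case 0 then show ?case using modN_\<N>[OF phi_span.zero] by simp
next
  case (Suc n) then show ?case using modN_add[of "\<lambda>w. \<Sum>i<n. f i w" "\<Sum>i<n. s i" "f n" "s n"] by simp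
qed

text \<open>Modulo \<open>\<N>\<close>, \<tau>\<Phi>_a\<Phi>_b is s \<tau>\<Phi>_b, because
  \<open>\<N>\<close> is stable under composition with \<Phi>_b on the right; and \<tau>\<Phi>_b is
  s' \<tau>.\<close>

lemma modN_mult:
  assumes "modN (\<lambda>w. \<Phi> a w ^ q) s" "modN (\<lambda>w. \<Phi> b w ^ q) s'" "a \<in> A" "b \<in> A"
  shows "modN (\<lambda>w. \<Phi> (a * b) w ^ q) (s * s')"
proof -
  have "(\<lambda>w. \<Phi> a (\<Phi> b w) ^ q - s * \<Phi> b w ^ q) \<in> \<N>"
    using \<N>_compose[of "\<lambda>w. \<Phi> a w ^ q - s * w ^ q" b] assms by (auto simp: modN_def)
  moreover have "(\<lambda>w. s * (\<Phi> b w ^ q - s' * w ^ q)) \<in> \<N>"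
    using assms by (intro phi_span_smult[OF HD(7)]) (auto simp: modN_def)
  ultimately have "(\<lambda>w. (\<Phi> a (\<Phi> b w) ^ q - s * \<Phi> b w ^ q) + s * (\<Phi> b w ^ q - s' * w ^ q)) \<in> \<N>"
    by (rule phi_span_add)
  then show ?thesis using assms HD by (auto simp: modN_def \<Phi>_mult algebra_simps)
qed

lemma modN_id: "modN (\<lambda>w. w) 0"
proof -
  have "\<Phi> 1 = (\<lambda>w. w)" using \<Phi>_const[of 1] FD(2) by (simp add: fun_eq_iff)
  then show ?thesis using modN_\<Phi>[of 1] AD(2) by simp
qed

text \<open>Powers of \<tau> are reduced to multiples of \<tau>: \<Phi>_t takes care of \<tau>^2 and
  \<Phi>_y of \<tau>^3, which suffices for \<tau>\<Phi>_t. The term \<tau>^4 of \<tau>\<Phi>_y comes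
  from \<Phi>_t\<Phi>_t, where \<tau>\<Phi>_t enters with its coordinate \<alpha>.\<close>

lemma modN_t_y: "\<exists>\<alpha> \<beta>. modN (\<lambda>w. \<Phi> t w ^ q) \<alpha> \<and> modN (\<lambda>w. \<Phi> y w ^ q) \<beta>"
proof -
  note tH = subsetD[OF H(2) A(3)] and yH = subsetD[OF H(2) y]
  note pH = power_in_subring[OF HD(7)]
  have "modN (\<lambda>w. \<Phi> t w - t * w - x1 * w ^ q) (0 - t * 0 - x1 * 1)"
    by (intro modN_diff modN_smult modN_\<Phi> modN_id modN_frobenius tH coeffs A(3))
  then obtain s2 where s2: "modN (\<lambda>w. w ^ (q ^ 2)) s2" by (auto simp: \<Phi>_t)
  have "modN (\<lambda>w. \<Phi> y w - y * w - y1 * w ^ q - y2 * w ^ (q ^ 2)) (0 - y * 0 - y1 * 1 - y2 * s2)"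
    by (intro modN_diff modN_smult modN_\<Phi> modN_id modN_frobenius s2 yH coeffs y)
  then obtain s3 where s3: "modN (\<lambda>w. w ^ (q ^ 3)) s3" by (auto simp: \<Phi>_y)
  have tq: "\<Phi> t w ^ q = t ^ q * w ^ q + x1 ^ q * w ^ (q ^ 2) + w ^ (q ^ 3)" for w
    by (simp add: \<Phi>_t frob_add1 power_mult_distrib power_mult[symmetric] power2_eq_square power3_eq_cube)
  have "modN (\<lambda>w. \<Phi> t w ^ q) (t ^ q * 1 + x1 ^ q * s2 + s3)"
    unfolding tq by (intro modN_add modN_smult modN_frobenius s2 s3 pH tH coeffs)
  then obtain \<alpha> where \<alpha>: "modN (\<lambda>w. \<Phi> t w ^ q) \<alpha>" by blast
  have "modN (\<lambda>w. \<Phi> (t * t) w - t * \<Phi> t w - x1 * \<Phi> t w ^ q - t ^ (q ^ 2) * w ^ (q ^ 2) - x1 ^ (q ^ 2) * w ^ (q ^ 3))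
     (0 - t * 0 - x1 * \<alpha> - t ^ (q ^ 2) * s2 - x1 ^ (q ^ 2) * s3)"
    by (intro modN_diff modN_smult modN_\<Phi> \<alpha> s2 s3 pH tH coeffs A(3) AD(6))
  moreover have "\<Phi> (t * t) w - t * \<Phi> t w - x1 * \<Phi> t w ^ q - t ^ (q ^ 2) * w ^ (q ^ 2) - x1 ^ (q ^ 2) * w ^ (q ^ 3) = w ^ (q ^ 4)" for w
  proof -
    have "\<Phi> (t * t) w = t * \<Phi> t w + x1 * \<Phi> t w ^ q + \<Phi> t w ^ (q ^ 2)"
      using A(3) by (simp only: \<Phi>_mult) (simp only: \<Phi>_t)
    moreover have "\<Phi> t w ^ (q ^ 2) = t ^ (q ^ 2) * w ^ (q ^ 2) + x1 ^ (q ^ 2) * w ^ (q ^ 3) + w ^ (q ^ 4)"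
      by (simp add: \<Phi>_t frob_add power_mult_distrib power_mult[symmetric] power_add[symmetric] flip: power_Suc)
    ultimately show ?thesis by simp
  qed
  ultimately obtain s4 where s4: "modN (\<lambda>w. w ^ (q ^ 4)) s4" by auto
  have yq: "\<Phi> y w ^ q = y ^ q * w ^ q + y1 ^ q * w ^ (q ^ 2) + y2 ^ q * w ^ (q ^ 3) + w ^ (q ^ 4)" for w
    by (simp add: \<Phi>_y frob_add1 power_mult_distrib power_mult[symmetric] power2_eq_square power3_eq_cube power4_eq_xxxx mult.assoc)
  have "modN (\<lambda>w. \<Phi> y w ^ q) (y ^ q * 1 + y1 ^ q * s2 + y2 ^ q * s3 + s4)"
    unfolding yq by (intro modN_add modN_smult modN_frobenius s2 s3 s4 pH yH coeffs)
  then show ?thesis using \<alpha> by blast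
qed

lemma modN_F: "c \<in> F \<Longrightarrow> modN (\<lambda>w. \<Phi> c w ^ q) c"
  using modN_smult[OF modN_frobenius, of c] A(2) H(2) frob_F[of c 1] by (auto simp: \<Phi>_const power_mult_distrib)

lemma modN_add_left:
  "modN (\<lambda>w. \<Phi> a w ^ q) s \<Longrightarrow> modN (\<lambda>w. \<Phi> b w ^ q) s' \<Longrightarrow> a \<in> A \<Longrightarrow> b \<in> A \<Longrightarrow> modN (\<lambda>w. \<Phi> (a + b) w ^ q) (s + s')"
  using modN_add[of "\<lambda>w. \<Phi> a w ^ q" s "\<lambda>w. \<Phi> b w ^ q" s'] by (simp add: \<Phi>_add_left frob_add1)

lemma modN_power_t: "modN (\<lambda>w. \<Phi> t w ^ q) \<alpha> \<Longrightarrow> modN (\<lambda>w. \<Phi> (t ^ i) w ^ q) (\<alpha> ^ i)"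
proof (induction i)
  case 0 then show ?case using modN_F[of 1] FD by simp
next
  case (Suc i) then show ?case using modN_mult[of t \<alpha> "t ^ i" "\<alpha> ^ i"] A(3) tA by simp
qed

text \<open>\<alpha> and \<beta> are the images of t and y under a ring homomorphism fixing the
  constants, so the equation carries over, and \<open>modN_unique\<close> compares its two
  sides.\<close>

lemma modN_weierstrass:
  assumes a: "modN (\<lambda>w. \<Phi> t w ^ q) \<alpha>" and b: "modN (\<lambda>w. \<Phi> y w ^ q) \<beta>"
    and c: "c1 \<in> F" "c2 \<in> F" "c3 \<in> F" "c4 \<in> F" "c6 \<in> F"
    and W: "y ^ 2 + c1 * t * y + c3 * y = t ^ 3 + c2 * t ^ 2 + c4 * t + c6"
  shows "\<beta> ^ 2 + c1 * \<alpha> * \<beta> + c3 * \<beta> = \<alpha> ^ 3 + c2 * \<alpha> ^ 2 + c4 * \<alpha> + c6"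
proof -
  note cA = c[THEN subsetD[OF A(2)]]
  note m = modN_add_left modN_mult modN_F modN_power_t[OF a] a b
  have "modN (\<lambda>w. \<Phi> (y * y + c1 * t * y + c3 * y) w ^ q) (\<beta> * \<beta> + c1 * \<alpha> * \<beta> + c3 * \<beta>)"
    by (intro m AD(4,6) c cA y A(3))
  moreover have "modN (\<lambda>w. \<Phi> (t ^ 3 + c2 * t ^ 2 + c4 * t + c6) w ^ q) (\<alpha> ^ 3 + c2 * \<alpha> ^ 2 + c4 * \<alpha> + c6)"
    by (intro m AD(4,6) c cA y A(3) tA(1))
  ultimately show ?thesis using W modN_unique by (simp add: power2_eq_square)
qed

text \<open>The function in \<open>N\<close> is the action on \<tau> of an element of A \<otimes> H,
  and its coordinate is the value of that element at (\<alpha>, \<beta>).\<close>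

lemma modN_vanish:
  assumes a: "modN (\<lambda>w. \<Phi> t w ^ q) \<alpha>" and b: "modN (\<lambda>w. \<Phi> y w ^ q) \<beta>"
    and gh: "\<And>i. g i \<in> H \<and> h i \<in> H"
    and N: "(\<lambda>w. \<Sum>i<n. g i * \<Phi> (t ^ i) w ^ q + h i * \<Phi> (t ^ i * y) w ^ q) \<in> \<N>"
  shows "(\<Sum>i<n. g i * \<alpha> ^ i + h i * (\<alpha> ^ i * \<beta>)) = 0"
proof -
  have "modN (\<lambda>w. \<Sum>i<n. g i * \<Phi> (t ^ i) w ^ q + h i * \<Phi> (t ^ i * y) w ^ q) (\<Sum>i<n. g i * \<alpha> ^ i + h i * (\<alpha> ^ i * \<beta>))"
    using gh by (intro modN_sum modN_add modN_smult modN_mult modN_power_t[OF a] b tA y) auto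
  then show ?thesis using modN_unique[OF _ modN_\<N>[OF N]] by simp
qed

end

section \<open>Twisted polynomials as functions\<close>

context
  fixes F :: "'c::field set" and q :: nat
  assumes F: "is_subfield F" "finite F" and q: "q = card F"
begin

lemma tw_eval_extend:
  assumes "degree f \<le> n"
  shows "tw_eval q f w = (\<Sum>i\<le>n. coeff f i * w ^ (q ^ i))"
  unfolding tw_eval_def by (rule sum.mono_neutral_left) (use assms in \<open>auto simp: coeff_eq_0\<close>)

lemma tw_eval_add: "tw_eval q (f + g) w = tw_eval q f w + tw_eval q g w"
proof -
  define n where "n = max (degree f) (degree g)"
  have "degree f \<le> n" "degree g \<le> n" "degree (f + g) \<le> n" by (auto simp: n_def degree_add_le)
  then show ?thesis by (simp add: tw_eval_extend[of _ n] distrib_right sum.distrib)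
qed

lemma tw_eval_0 [simp]: "tw_eval q 0 w = 0"
  by (simp add: tw_eval_def)

lemma tw_eval_sum: "tw_eval q (sum f I) w = (\<Sum>i\<in>I. tw_eval q (f i) w)"
  by (induction I rule: infinite_finite_induct) (auto simp: tw_eval_add)

lemma tw_eval_smult: "tw_eval q (smult c f) w = c * tw_eval q f w"
  by (simp add: tw_eval_extend[OF degree_smult_le] tw_eval_def sum_distrib_left mult.assoc)

lemma tw_eval_monom: "tw_eval q (monom c n) w = c * w ^ (q ^ n)"
  by (simp add: tw_eval_extend[OF degree_monom_le] if_distrib[of "\<lambda>x. x * _"] cong: if_cong)

lemma tw_eval_1: "tw_eval q 1 w = w"
  using tw_eval_monom[of 1 0 w] by simp

lemma tw_eval_mult: "tw_eval q (tw_mult q f g) w = tw_eval q f (tw_eval q g (w::'c))"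
proof -
  have "tw_eval q (tw_mult q f g) w =
      (\<Sum>i\<le>degree f. \<Sum>j\<le>degree g. coeff f i * coeff g j ^ (q ^ i) * w ^ (q ^ (i + j)))"
    by (simp add: tw_mult_def tw_eval_sum tw_eval_monom)
  also have "\<dots> = (\<Sum>i\<le>degree f. coeff f i * (\<Sum>j\<le>degree g. coeff g j * w ^ (q ^ j)) ^ (q ^ i))"
    unfolding q frobenius_sum[OF F]
    by (simp add: sum_distrib_left power_mult_distrib power_mult[symmetric] power_add mult_ac)
  finally show ?thesis by (simp add: tw_eval_def)
qed

lemma tw_eval_add_right: "tw_eval q f (w + w'::'c) = tw_eval q f w + tw_eval q f w'"
  unfolding tw_eval_def q by (simp add: frobenius_add[OF F] distrib_left sum.distrib)

lemma tw_eval_poly: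
  assumes "f \<in> polys_over H" "is_subring H"
  shows "\<exists>p\<in>polys_over H. \<forall>w. tw_eval q f w = poly p w"
proof (intro bexI allI)
  show "tw_eval q f w = poly (\<Sum>i\<le>degree f. monom (coeff f i) (q ^ i)) w" for w
    by (simp add: tw_eval_def poly_sum poly_monom)
  show "(\<Sum>i\<le>degree f. monom (coeff f i) (q ^ i)) \<in> polys_over H"
    using assms is_subringD[OF assms(2)] by (auto simp: polys_over_def coeff_sum intro!: sum_in_subring)
qed

end

section \<open>The coordinate ring\<close>

definition point_eval :: "'c::field \<Rightarrow> 'c \<Rightarrow> 'c reg \<Rightarrow> 'c" where
  "point_eval a b x = poly (fst x) a + poly (snd x) a * b"

definition on_curve :: "'c::field curve_data \<Rightarrow> 'c \<Rightarrow> 'c \<Rightarrow> bool" where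
  "on_curve X a b \<longleftrightarrow> b ^ 2 + wa1 X * a * b + wa3 X * b = a ^ 3 + wa2 X * a ^ 2 + wa4 X * a + wa6 X"

lemma emb_eq_point_eval: "emb X = point_eval (t_elt X) (y_elt X)"
  by (simp add: fun_eq_iff emb_def point_eval_def)

lemma point_eval_add: "point_eval a b (x + x') = point_eval a b x + point_eval a b x'"
  by (simp add: point_eval_def algebra_simps)

lemma point_eval_diff: "point_eval a b (x - x') = point_eval a b x - point_eval a b x'"
  by (simp add: point_eval_def algebra_simps)

lemma point_eval_simps [simp]: "point_eval a b 0 = 0" "point_eval a b (1, 0) = 1" "point_eval a b ([:c:], 0) = c"
  by (simp_all add: point_eval_def)

lemma point_eval_mult:
  assumes "on_curve X a b"
  shows "point_eval a b (reg_mult X x x') = point_eval a b x * point_eval a b x'"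
proof -
  obtain f g f' g' where x: "x = (f, g)" "x' = (f', g')" by (cases x; cases x')
  let ?f = "poly f a" and ?g = "poly g a" and ?f' = "poly f' a" and ?g' = "poly g' a"
  have b: "b * b = a ^ 3 + wa2 X * a ^ 2 + wa4 X * a + wa6 X - wa1 X * a * b - wa3 X * b"
    using assms by (simp add: on_curve_def power2_eq_square algebra_simps)
  have "point_eval a b x * point_eval a b x' = ?f * ?f' + (?f * ?g' + ?g * ?f') * b + ?g * ?g' * (b * b)"
    by (simp add: x point_eval_def algebra_simps)
  also have "\<dots> = point_eval a b (reg_mult X x x')"
    unfolding b by (simp add: x point_eval_def reg_mult_def power2_eq_square power3_eq_cube algebra_simps)
  finally show ?thesis by simp
qed

lemma point_eval_in_subring:
  assumes "is_subring L" "x \<in> polys_over L \<times> polys_over L" "a \<in> L" "b \<in> L"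
  shows "point_eval a b x \<in> L"
  unfolding point_eval_def using assms(2-)
  by (intro is_subringD(4,6)[OF assms(1)] poly_in_subring[OF assms(1)]) auto

lemma point_eval_as_sum:
  assumes "degree (fst x) < n" "degree (snd x) < n"
  shows "point_eval a b x = (\<Sum>i<n. coeff (fst x) i * a ^ i + coeff (snd x) i * (a ^ i * b))"
proof -
  have "poly p a = (\<Sum>i<n. coeff p i * a ^ i)" if "degree p < n" for p
    unfolding poly_altdef by (rule sum.mono_neutral_left) (use that in \<open>auto simp: coeff_eq_0\<close>)
  then show ?thesis using assms by (simp add: point_eval_def sum.distrib sum_distrib_right mult.assoc)
qed

lemma coord_ring_simps [simp]:
  "carrier (coord_ring X L) = polys_over L \<times> polys_over L" "mult (coord_ring X L) = reg_mult X"
  "one (coord_ring X L) = (1, 0)" "zero (coord_ring X L) = 0" "add (coord_ring X L) = (+)"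
  by (simp_all add: coord_ring_def)

definition truncated_polys :: "'c::field set \<Rightarrow> nat \<Rightarrow> 'c poly set" where
  "truncated_polys F k = {p \<in> polys_over F. \<forall>n\<ge>k. coeff p n = 0}"

lemma truncated_polys_Suc:
  "truncated_polys F (Suc k) = (\<lambda>(c, p). pCons c p) ` (F \<times> truncated_polys F k)"
proof safe
  fix p assume p: "p \<in> truncated_polys F (Suc k)"
  obtain c r where r: "p = pCons c r" by (cases p)
  have "coeff p 0 \<in> F" "\<And>n. coeff p (Suc n) \<in> F" "\<And>n. n \<ge> k \<Longrightarrow> coeff p (Suc n) = 0"
    using p by (auto simp: truncated_polys_def polys_over_def)
  then have "c \<in> F" "r \<in> truncated_polys F k" by (auto simp: r truncated_polys_def polys_over_def)
  then show "p \<in> (\<lambda>(c, p). pCons c p) ` (F \<times> truncated_polys F k)" using r by auto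
qed (auto simp: truncated_polys_def polys_over_def coeff_pCons split: nat.splits)

lemma card_truncated_polys:
  assumes "finite F" "0 \<in> F"
  shows "finite (truncated_polys F k)" "card (truncated_polys F k) = card F ^ k"
proof (induction k)
  case 0
  have "truncated_polys F 0 = {0}" using assms(2) by (auto simp: truncated_polys_def polys_over_def poly_eq_iff)
  { case 1 show ?case using \<open>truncated_polys F 0 = {0}\<close> by simp
  next case 2 show ?case using \<open>truncated_polys F 0 = {0}\<close> by simp }
next
  case (Suc k)
  have inj: "inj_on (\<lambda>(c, p). pCons c p) (F \<times> truncated_polys F k)" by (auto simp: inj_on_def)
  { case 1 show ?case unfolding truncated_polys_Suc using Suc assms by simp
  next case 2 show ?case unfolding truncated_polys_Suc using Suc assms
      by (simp add: card_image[OF inj] card_cartesian_product) }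
qed

locale elliptic_data =
  fixes X :: "'c::complete_nonarch_field curve_data"
  assumes setting: "elliptic_setting X"
begin

abbreviation "\<F> \<equiv> const_field X"
abbreviation "q \<equiv> qq X"
abbreviation "CA \<equiv> polys_over \<F> \<times> polys_over \<F>"
abbreviation "A \<equiv> emb X ` CA"

lemma F_subfield: "is_subfield \<F>" "finite \<F>"
  using setting by (auto simp: elliptic_setting_def elliptic_curve_def)

lemmas FD = is_subringD[OF is_subfieldD(1)[OF F_subfield(1)]] is_subfieldD[OF F_subfield(1)]
lemmas polyF = polys_over_closed[OF FD(7)]

lemma weier_F: "wa1 X \<in> \<F>" "wa2 X \<in> \<F>" "wa3 X \<in> \<F>" "wa4 X \<in> \<F>" "wa6 X \<in> \<F>"
  using setting by (auto simp: elliptic_setting_def elliptic_curve_def)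

lemma on_curve_generic: "on_curve X (t_elt X) (y_elt X)"
  using setting by (simp add: elliptic_setting_def on_curve_def)

lemma q_eq: "q = card \<F>"
  by (simp add: qq_def)

lemma q2: "q \<ge> 2"
  unfolding q_eq by (rule card_finite_subfield[OF F_subfield])

lemma absv_emb: "a \<in> CA \<Longrightarrow> a \<noteq> 0 \<Longrightarrow> absv (emb X a) = real q ^ pole_order a"
  using setting unfolding elliptic_setting_def coord_ring_simps(1) by blast

lemma emb_add: "emb X (a + b) = emb X a + emb X b"
  and emb_diff: "emb X (a - b) = emb X a - emb X b"
  and emb_mult: "emb X (reg_mult X a b) = emb X a * emb X b"
  and emb_simps [simp]: "emb X 0 = 0" "emb X (1, 0) = 1" "emb X ([:c:], 0) = c"
  unfolding emb_eq_point_eval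
  by (simp_all add: point_eval_add point_eval_diff point_eval_mult[OF on_curve_generic])

lemma emb_monom: "emb X (monom 1 i, 0) = t_elt X ^ i" "emb X (0, monom 1 i) = t_elt X ^ i * y_elt X"
  by (simp_all add: emb_def poly_monom)

lemma CA_closed: "a \<in> CA \<Longrightarrow> b \<in> CA \<Longrightarrow> a + b \<in> CA" "a \<in> CA \<Longrightarrow> b \<in> CA \<Longrightarrow> a - b \<in> CA"
  "a \<in> CA \<Longrightarrow> b \<in> CA \<Longrightarrow> reg_mult X a b \<in> CA" "(1, 0) \<in> CA" "0 \<in> CA" "c \<in> \<F> \<Longrightarrow> ([:c:], 0) \<in> CA"
  "(monom 1 i, 0) \<in> CA" "(0, monom 1 i) \<in> CA"
  using polyF weier_F FD by (auto simp: reg_mult_def zero_prod_def simp del: mult_pCons_right)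

lemma inj_emb: "inj_on (emb X) CA"
proof (rule inj_onI)
  fix a b assume ab: "a \<in> CA" "b \<in> CA" "emb X a = emb X b"
  then have 0: "emb X (a - b) = 0" "a - b \<in> CA" using CA_closed by (auto simp: emb_diff)
  show "a = b"
  proof (rule ccontr)
    assume "a \<noteq> b"
    then have "absv (emb X (a - b)) = real q ^ pole_order (a - b)" using 0 by (intro absv_emb) auto
    then show False using 0(1) q2 by simp
  qed
qed

lemma A_subring: "is_subring A"
  unfolding is_subring_def
proof (intro conjI ballI)
  show "1 \<in> A" using CA_closed(4) emb_simps(2) by (metis imageI)
  fix x x' assume "x \<in> A" "x' \<in> A"
  then obtain a b where ab: "a \<in> CA" "b \<in> CA" "x = emb X a" "x' = emb X b" by auto
  show "x - x' \<in> A" using ab CA_closed(2)[OF ab(1,2)] by (metis emb_diff imageI)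
  show "x * x' \<in> A" using ab CA_closed(3)[OF ab(1,2)] by (metis emb_mult imageI)
qed

lemma F_subset_A: "\<F> \<subseteq> A"
  using CA_closed(6) emb_simps(3) by (metis imageI subsetI)

lemma t_y_in_A: "t_elt X \<in> A" "y_elt X \<in> A"
  using CA_closed(7)[of 1] CA_closed(8)[of 0] emb_monom(1)[of 1] emb_monom(2)[of 0]
  by (metis imageI power_one_right, metis imageI power_0 mult_1)

lemma absv_t: "absv (t_elt X) = real q ^ 2"
proof -
  have "monom (1::'c) 1 \<noteq> 0" by simp
  then have "(monom (1::'c) 1, 0::'c poly) \<noteq> 0" by (simp add: zero_prod_def)
  then have "absv (emb X (monom 1 1, 0)) = real q ^ pole_order (monom (1::'c) 1, 0::'c poly)"
    using CA_closed(7)[of 1] by (rule absv_emb[rotated])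
  then show ?thesis by (simp add: emb_monom pole_order_def degree_monom_eq)
qed

text \<open>Both bounds count the f + g y with f and g of degree below k. Every element of absolute
  value less than q^(2k) has this form, while the pole order of such an f + g y can reach 2(k - 1) +
  3 = 2k + 1; whence the different exponents.\<close>

lemma A_count:
  shows "finite {a \<in> A. absv a < real q ^ (2 * k)}" (is "finite ?S")
    and "card {a \<in> A. absv a < real q ^ (2 * k)} \<le> q ^ (2 * k)"
    and "q ^ (2 * k) \<le> card {a \<in> A. absv a < real q ^ (2 * k + 2)}"
proof -
  let ?T = "\<lambda>k. truncated_polys \<F> k \<times> truncated_polys \<F> k"
  have fin: "finite (?T k)" and card: "card (?T k) = q ^ (2 * k)" for k
    using card_truncated_polys[OF F_subfield(2) FD(1), of k]
    by (simp_all add: card_cartesian_product q_eq mult_2 power_add)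
  have q1: "real q > 1" using q2 by simp
  have small: "{a \<in> A. absv a < real q ^ (2 * k)} \<subseteq> emb X ` ?T k" for k
  proof safe
    fix f g assume fg: "f \<in> polys_over \<F>" "g \<in> polys_over \<F>" "absv (emb X (f, g)) < real q ^ (2 * k)"
    have "(f, g) \<in> ?T k"
    proof (cases "(f, g) = (0, 0)")
      case True then show ?thesis using polyF by (auto simp: truncated_polys_def)
    next
      case False
      then have "real q ^ pole_order (f, g) < real q ^ (2 * k)"
        using absv_emb[of "(f, g)"] fg by (auto simp: zero_prod_def)
      then have p: "pole_order (f, g) < 2 * k" using q1 by (simp add: power_strict_increasing_iff)
      have "coeff f n = 0" if "n \<ge> k" for n using p that by (intro coeff_eq_0) (auto simp: pole_order_def)
      moreover have "coeff g n = 0" if "n \<ge> k" for n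
        using p that by (cases "g = 0") (auto simp: pole_order_def intro!: coeff_eq_0)
      ultimately show ?thesis using fg by (auto simp: truncated_polys_def)
    qed
    then show "emb X (f, g) \<in> emb X ` ?T k" by blast
  qed
  show "finite ?S" using small[of k] fin finite_subset by blast
  show "card ?S \<le> q ^ (2 * k)"
    using card_mono[OF finite_imageI[OF fin] small[of k]] card_image_le[OF fin[of k], of "emb X"] card[of k] by simp
  have sub: "emb X ` ?T k \<subseteq> {a \<in> A. absv a < real q ^ (2 * k + 2)}"
  proof safe
    fix f g assume fg: "f \<in> truncated_polys \<F> k" "g \<in> truncated_polys \<F> k"
    then have inA: "(f, g) \<in> CA" by (auto simp: truncated_polys_def)
    show "emb X (f, g) \<in> A" using inA by blast
    show "absv (emb X (f, g)) < real q ^ (2 * k + 2)"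
    proof (cases "(f, g) = (0, 0)")
      case True then show ?thesis using emb_simps(1) q1 by (simp add: zero_prod_def)
    next
      case False
      have "f = 0 \<or> degree f < k" "g = 0 \<or> degree g < k"
        using fg by (auto simp: truncated_polys_def) (metis leading_coeff_0_iff not_le)+
      then have "pole_order (f, g) < 2 * k + 2" by (auto simp: pole_order_def)
      then have "real q ^ pole_order (f, g) < real q ^ (2 * k + 2)" using q1 by (intro power_strict_increasing)
      then show ?thesis using absv_emb[OF inA] False by (simp add: zero_prod_def)
    qed
  qed
  have crd: "card (emb X ` ?T k) = q ^ (2 * k)"
    using card card_image[of "emb X" "?T k"] inj_on_subset[OF inj_emb, of "?T k"] by (auto simp: truncated_polys_def)
  have fin2: "finite {a \<in> A. absv a < real q ^ (2 * k + 2)}"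
    using finite_subset[OF small[of "Suc k"] finite_imageI[OF fin]] by (simp add: algebra_simps)
  show "q ^ (2 * k) \<le> card {a \<in> A. absv a < real q ^ (2 * k + 2)}"
    using card_mono[OF fin2 sub] unfolding crd .
qed

lemma A_basis:
  assumes "a \<in> A"
  shows "\<exists>n c d. (\<forall>i. c i \<in> \<F> \<and> d i \<in> \<F>) \<and> (\<forall>i\<ge>n. c i = 0 \<and> d i = 0) \<and>
    a = (\<Sum>i<n. c i * t_elt X ^ i + d i * (t_elt X ^ i * y_elt X))"
proof -
  obtain x where x: "x \<in> CA" "a = emb X x" using assms by auto
  define n where "n = Suc (max (degree (fst x)) (degree (snd x)))"
  have "a = (\<Sum>i<n. coeff (fst x) i * t_elt X ^ i + coeff (snd x) i * (t_elt X ^ i * y_elt X))"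
    unfolding x emb_eq_point_eval by (rule point_eval_as_sum) (auto simp: n_def)
  moreover have "\<forall>i. coeff (fst x) i \<in> \<F> \<and> coeff (snd x) i \<in> \<F>" using x(1) by (auto simp: polys_over_def)
  moreover have "\<forall>i\<ge>n. coeff (fst x) i = 0 \<and> coeff (snd x) i = 0" by (auto simp: n_def coeff_eq_0)
  ultimately show ?thesis by blast
qed

abbreviation "Kbar \<equiv> algebraic_closure_in (field_K X)"

lemma Fbar_subset_Kbar: "Fbar X \<subseteq> Kbar"
proof -
  have "c \<in> field_K X" if "c \<in> \<F>" for c
  proof -
    have "c = emb X ([:c:], 0) / emb X (1, 0)" by simp
    moreover have "(1, 0) \<noteq> (0 :: 'c reg)" by (simp add: zero_prod_def)
    ultimately show ?thesis unfolding field_K_def coord_ring_simps(1)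
      by (intro CollectI exI[of _ "([:c:], 0)"] exI[of _ "(1, 0)"] conjI CA_closed(4) CA_closed(6)[OF that])
  qed
  then show ?thesis by (auto simp: Fbar_def algebraic_closure_in_def polys_over_def)
qed

lemma Fbar_subring: "is_subring (Fbar X)"
  unfolding Fbar_def by (rule algebraic_closure_finite_subring[OF FD(7) F_subfield(2)])

lemma F_subset_Fbar: "\<F> \<subseteq> Fbar X"
  unfolding Fbar_def using FD(7) F_subfield(2) by (auto simp: algebraic_closure_finite_iff)

lemma Kbar_root: "p \<in> polys_over Kbar \<Longrightarrow> degree p > 0 \<Longrightarrow> \<exists>x. poly p x = 0"
  using setting by (auto simp: elliptic_setting_def)

text \<open>The setting supplies a root only in the closure of K; being algebraic over
  \<open>Fbar X\<close>, it lies in \<open>Fbar X\<close>.\<close>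

lemma Fbar_root:
  assumes "p \<in> polys_over (Fbar X)" "degree p > 0"
  shows "\<exists>x\<in>Fbar X. poly p x = 0"
proof -
  have "p \<in> polys_over Kbar" using assms(1) Fbar_subset_Kbar by (auto simp: polys_over_def)
  then obtain x where x: "poly p x = 0" using Kbar_root assms(2) by blast
  moreover have "p \<noteq> 0" using assms(2) by auto
  ultimately have "x \<in> Fbar X"
    using algebraic_closure_finite_root[OF FD(7) F_subfield(2)] assms(1) by (simp add: Fbar_def)
  then show ?thesis using x by blast
qed

lemma Kbar_dense: "closure Kbar = UNIV" "1 \<in> Kbar" "0 \<in> Kbar"
  using setting Fbar_subset_Kbar is_subringD[OF Fbar_subring] by (auto simp: elliptic_setting_def)

end

section \<open>The Hayes module as an instance of the abstract rank one setting\<close>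

locale hayes_setting = elliptic_data X for X :: "'c::complete_nonarch_field curve_data" +
  fixes \<phi> :: "'c reg \<Rightarrow> 'c poly" and e :: "nat \<Rightarrow> 'c"
  assumes hayes: "drinfeld_hayes X \<phi>" and exponential: "is_exponential X \<phi> e"
begin

abbreviation "H \<equiv> hilbert_class_field X"

lemma H_subfield: "is_subfield H"
  unfolding hilbert_class_field_def by (rule is_subfield_hull)

lemmas HD = is_subringD[OF is_subfieldD(1)[OF H_subfield]] is_subfieldD[OF H_subfield]

lemma \<phi>_closed: "a \<in> CA \<Longrightarrow> \<phi> a \<in> polys_over H"
  and \<phi>_add: "a \<in> CA \<Longrightarrow> b \<in> CA \<Longrightarrow> \<phi> (a + b) = \<phi> a + \<phi> b"
  and \<phi>_mult: "a \<in> CA \<Longrightarrow> b \<in> CA \<Longrightarrow> \<phi> (reg_mult X a b) = tw_mult q (\<phi> a) (\<phi> b)"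
proof -
  have h: "\<phi> \<in> ring_hom (ring_A X) (tw_ring q H)" using hayes by (simp add: drinfeld_hayes_def)
  show "a \<in> CA \<Longrightarrow> \<phi> a \<in> polys_over H"
    using ring_hom_closed[OF h, of a] by (simp add: tw_ring_def)
  show "a \<in> CA \<Longrightarrow> b \<in> CA \<Longrightarrow> \<phi> (a + b) = \<phi> a + \<phi> b"
    using ring_hom_add[OF h, of a b] by (simp add: tw_ring_def)
  show "a \<in> CA \<Longrightarrow> b \<in> CA \<Longrightarrow> \<phi> (reg_mult X a b) = tw_mult q (\<phi> a) (\<phi> b)"
    using ring_hom_mult[OF h, of a b] by (simp add: tw_ring_def)
qed

lemma \<phi>_const: "c \<in> \<F> \<Longrightarrow> \<phi> ([:c:], 0) = [:c:]"
  using hayes by (simp add: drinfeld_hayes_def)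

text \<open>The definition of the Hilbert class field as a hull does not show these inclusions
  without class field theory. They are read off the constant coefficients of \<phi>, whose values
  are defined over \<open>H\<close>.\<close>

lemma F_t_y_in_H: "\<F> \<subseteq> H" "t_elt X \<in> H" "y_elt X \<in> H"
proof -
  show "\<F> \<subseteq> H"
  proof
    fix c assume c: "c \<in> \<F>"
    then have "[:c:] \<in> polys_over H" using \<phi>_closed[OF CA_closed(6)[OF c]] \<phi>_const by simp
    then show "c \<in> H" unfolding polys_over_def by (metis coeff_pCons_0 mem_Collect_eq)
  qed
  obtain x1 where "\<phi> ([:0, 1:], 0) = [:t_elt X, x1, 1:]" using hayes by (auto simp: drinfeld_hayes_def)
  then have "[:t_elt X, x1, 1:] \<in> polys_over H"
    using \<phi>_closed[of "([:0, 1:], 0)"] polyF FD by auto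
  then show "t_elt X \<in> H" unfolding polys_over_def by (metis coeff_pCons_0 mem_Collect_eq)
  obtain y1 y2 where "\<phi> (0, 1) = [:y_elt X, y1, y2, 1:]" using hayes by (auto simp: drinfeld_hayes_def)
  then have "[:y_elt X, y1, y2, 1:] \<in> polys_over H" using \<phi>_closed[of "(0, 1)"] polyF FD by auto
  then show "y_elt X \<in> H" unfolding polys_over_def by (metis coeff_pCons_0 mem_Collect_eq)
qed

lemma A_subset_H: "A \<subseteq> H"
proof safe
  fix f g assume "f \<in> polys_over \<F>" "g \<in> polys_over \<F>"
  then have "(f, g) \<in> polys_over H \<times> polys_over H" using F_t_y_in_H(1) by (auto simp: polys_over_def)
  then show "emb X (f, g) \<in> H"
    unfolding emb_eq_point_eval using F_t_y_in_H HD(7) by (intro point_eval_in_subring)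
qed

definition \<Phi> :: "'c \<Rightarrow> 'c \<Rightarrow> 'c" where
  "\<Phi> x w = tw_eval q (\<phi> (inv_into CA (emb X) x)) w"

lemma \<Phi>_emb: "a \<in> CA \<Longrightarrow> \<Phi> (emb X a) w = tw_eval q (\<phi> a) w"
  by (simp add: \<Phi>_def inv_into_f_f[OF inj_emb])

lemmas tw = F_subfield q_eq

abbreviation "E \<equiv> exp_fun X e"

lemma exp_summable: "summable (\<lambda>i. e i * z ^ (q ^ i))"
  using exponential by (simp add: is_exponential_def)

lemma exp_add: "E (z + w) = E z + E w"
proof -
  have "(z + w) ^ (q ^ i) = z ^ (q ^ i) + w ^ (q ^ i)" for i
    unfolding q_eq by (rule frobenius_add[OF F_subfield])
  then show ?thesis
    unfolding exp_fun_def using suminf_add[OF exp_summable[of z] exp_summable[of w]] by (simp add: distrib_left)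
qed

text \<open>Convergence at z = 1 forces the coefficients to tend to 0, so they are bounded by some M
  >= 1. For |z| <= 1 the terms after the first are then at most M |z|^2, which gives \<rho> =
  1/M.\<close>

lemma exp_near_0: "\<exists>\<rho>>0. \<forall>z. absv z < \<rho> \<longrightarrow> absv (E z - z) \<le> absv z * absv z / \<rho>"
proof -
  have "(\<lambda>n. \<Sum>i<n. e i) \<longlonglongrightarrow> E 1" using summable_LIMSEQ[OF exp_summable[of 1]] by (simp add: exp_fun_def)
  moreover from this have "(\<lambda>n. \<Sum>i<Suc n. e i) \<longlonglongrightarrow> E 1" by (rule LIMSEQ_Suc)
  ultimately have "(\<lambda>n. (\<Sum>i<Suc n. e i) - (\<Sum>i<n. e i)) \<longlonglongrightarrow> E 1 - E 1" by (intro tendsto_diff)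
  then have "e \<longlonglongrightarrow> 0" by simp
  then have "bounded (range e)" by (rule convergent_imp_bounded)
  then obtain M0 where M0: "\<And>i. dist 0 (e i) \<le> M0" unfolding bounded_any_center[where a = 0] by auto
  define M where "M = max 1 M0"
  have M: "M \<ge> 1" "\<And>i. absv (e i) \<le> M"
    using M0 by (auto simp: M_def dist_eq_absv le_max_iff_disj)
  show ?thesis
  proof (intro exI[of _ "1 / M"] conjI allI impI)
    show "1 / M > 0" using M by simp
    fix z :: 'c assume z: "absv z < 1 / M"
    let ?f = "\<lambda>i. e i * z ^ (q ^ i)"
    have "1 / M \<le> 1" using M by simp
    then have z1: "absv z \<le> 1" using z by linarith
    have f0: "?f 0 = z" using exponential by (simp add: is_exponential_def)
    have bound: "absv (?f i) \<le> absv z * absv z * M" if "i > 0" for i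
    proof -
      have "2 \<le> q ^ i" using q2 that by (metis One_nat_def Suc_leI order_trans power_increasing power_one_right one_le_numeral)
      then have "absv z ^ (q ^ i) \<le> absv z ^ 2" using z1 by (intro power_decreasing) auto
      then have "absv (e i) * absv z ^ (q ^ i) \<le> M * absv z ^ 2" using M by (intro mult_mono) auto
      then show ?thesis by (simp add: absv_mult absv_power power2_eq_square mult_ac)
    qed
    have "(\<lambda>n. dist (\<Sum>i<n. ?f i) z) \<longlonglongrightarrow> dist (E z) z"
      unfolding exp_fun_def by (intro tendsto_dist summable_LIMSEQ exp_summable tendsto_const)
    then have "dist (E z) z \<le> absv z * absv z * M"
    proof (rule LIMSEQ_le_const2)
      show "\<exists>N. \<forall>n\<ge>N. dist (\<Sum>i<n. ?f i) z \<le> absv z * absv z * M"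
      proof (intro exI[of _ 1] allI impI)
        fix n :: nat assume "n \<ge> 1"
        then have "{..<n} = insert 0 {1..<n}" by auto
        then have "(\<Sum>i<n. ?f i) - z = (\<Sum>i\<in>{1..<n}. ?f i)" using f0 by simp
        moreover have "absv (\<Sum>i\<in>{1..<n}. ?f i) \<le> absv z * absv z * M"
          using M bound by (intro absv_sum_le_bound) auto
        ultimately show "dist (\<Sum>i<n. ?f i) z \<le> absv z * absv z * M" by (simp add: dist_eq_absv)
      qed
    qed
    then show "absv (E z - z) \<le> absv z * absv z / (1 / M)" by (simp add: dist_eq_absv)
  qed
qed

lemma elliptic_module_exists:
  "\<exists>x1 y1 y2 \<rho>. elliptic_module \<F> A H Kbar q (t_elt X) x1 \<Phi> E \<rho> (y_elt X) y1 y2"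
proof -
  obtain x1 where x1: "x1 \<in> H" "\<phi> ([:0, 1:], 0) = [:t_elt X, x1, 1:]"
    using hayes by (auto simp: drinfeld_hayes_def)
  obtain y1 y2 where y12: "y1 \<in> H" "y2 \<in> H" "\<phi> (0, 1) = [:y_elt X, y1, y2, 1:]"
    using hayes by (auto simp: drinfeld_hayes_def)
  obtain \<rho> where \<rho>: "\<rho> > 0" "\<And>z. absv z < \<rho> \<Longrightarrow> absv (E z - z) \<le> absv z * absv z / \<rho>" using exp_near_0 by blast
  have t: "t_elt X = emb X ([:0, 1:], 0)" "([:0, 1:], 0) \<in> CA"
    using emb_monom(1)[of 1] CA_closed(7)[of 1] by (auto simp: monom_altdef)
  have y: "y_elt X = emb X (0, 1)" "(0, 1) \<in> CA"
    using emb_monom(2)[of 0] CA_closed(8)[of 0] by auto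
  have "elliptic_module \<F> A H Kbar q (t_elt X) x1 \<Phi> E \<rho> (y_elt X) y1 y2"
  proof unfold_locales
    show "\<exists>p\<in>polys_over H. \<forall>w. \<Phi> a w = poly p w" if "a \<in> A" for a
    proof -
      obtain x where x: "x \<in> CA" "a = emb X x" using \<open>a \<in> A\<close> by auto
      then show ?thesis using tw_eval_poly[OF tw \<phi>_closed[OF x(1)] HD(7)] by (simp add: \<Phi>_emb)
    qed
    show "\<Phi> (a + b) w = \<Phi> a w + \<Phi> b w" if ab: "a \<in> A" "b \<in> A" for a b w
    proof -
      obtain x x' where x: "x \<in> CA" "a = emb X x" "x' \<in> CA" "b = emb X x'" using ab by auto
      then show ?thesis
        by (simp add: \<Phi>_emb \<phi>_add CA_closed emb_add[symmetric] tw_eval_add[OF tw] del: mem_Sigma_iff)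
    qed
    show "\<Phi> (a * b) w = \<Phi> a (\<Phi> b w)" if ab: "a \<in> A" "b \<in> A" for a b w
    proof -
      obtain x x' where x: "x \<in> CA" "a = emb X x" "x' \<in> CA" "b = emb X x'" using ab by auto
      then show ?thesis
        by (simp add: \<Phi>_emb \<phi>_mult CA_closed emb_mult[symmetric] tw_eval_mult[OF tw] del: mem_Sigma_iff)
    qed
    show "\<Phi> c w = c * w" if "c \<in> \<F>" for c w
      using \<Phi>_emb[OF CA_closed(6)[OF that], of w] that by (simp add: \<phi>_const tw_eval_def)
    show "\<Phi> a (w + w') = \<Phi> a w + \<Phi> a w'" if "a \<in> A" for a w w'
      unfolding \<Phi>_def by (rule tw_eval_add_right[OF tw])
    show "\<Phi> (t_elt X) w = t_elt X * w + x1 * w ^ q + w ^ (q ^ 2)" for w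
      unfolding t(1) using t by (simp add: \<Phi>_emb x1 tw_eval_def numeral_2_eq_2 atMost_Suc del: mem_Sigma_iff)
    show "\<Phi> (y_elt X) w = y_elt X * w + y1 * w ^ q + y2 * w ^ (q ^ 2) + w ^ (q ^ 3)" for w
      unfolding y(1) using y by (simp add: \<Phi>_emb y12 tw_eval_def numeral_2_eq_2 numeral_3_eq_3 atMost_Suc del: mem_Sigma_iff)
    show "E (a * z) = \<Phi> a (E z)" if "a \<in> A" for a z
    proof -
      obtain x where x: "x \<in> CA" "a = emb X x" using \<open>a \<in> A\<close> by auto
      moreover have "\<forall>a\<in>CA. \<forall>z. E (emb X a * z) = tw_eval q (\<phi> a) (E z)"
        using exponential unfolding is_exponential_def coord_ring_simps(1) by blast
      ultimately have "E (emb X x * z) = tw_eval q (\<phi> x) (E z)" by blast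
      then show ?thesis using \<Phi>_emb[OF x(1)] x(2) by simp
    qed
  qed (use F_subfield q_eq A_subring F_subset_A t_y_in_A absv_t A_count H_subfield A_subset_H Kbar_dense Kbar_root
        exp_add \<rho> x1 y12 A_basis in \<open>auto\<close>)
  then show ?thesis by blast
qed

lemma tw_eval_motive_act:
  assumes n: "degree (fst x) < n" "degree (snd x) < n"
  shows "tw_eval q (motive_act X \<phi> x m) w = (\<Sum>i<n. coeff (fst x) i * tw_eval q m (\<Phi> (t_elt X ^ i) w)
    + coeff (snd x) i * tw_eval q m (\<Phi> (t_elt X ^ i * y_elt X) w))"
proof -
  have ext: "(\<Sum>i\<le>degree p. coeff p i * f i) = (\<Sum>i<n. coeff p i * f i)" if "degree p < n" for p and f :: "nat \<Rightarrow> 'c"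
    by (rule sum.mono_neutral_left) (use that in \<open>auto simp: coeff_eq_0\<close>)
  have "tw_eval q (motive_act X \<phi> x m) w =
      (\<Sum>i\<le>degree (fst x). coeff (fst x) i * tw_eval q m (tw_eval q (\<phi> (monom 1 i, 0)) w)) +
      (\<Sum>i\<le>degree (snd x). coeff (snd x) i * tw_eval q m (tw_eval q (\<phi> (0, monom 1 i)) w))"
    by (simp add: motive_act_def tw_eval_add[OF tw] tw_eval_sum[OF tw] tw_eval_smult[OF tw] tw_eval_mult[OF tw])
  also have "\<dots> = (\<Sum>i<n. coeff (fst x) i * tw_eval q m (\<Phi> (emb X (monom 1 i, 0)) w)) +
      (\<Sum>i<n. coeff (snd x) i * tw_eval q m (\<Phi> (emb X (0, monom 1 i)) w))"
    unfolding ext[OF n(1)] ext[OF n(2)] by (simp only: \<Phi>_emb[OF CA_closed(7)] \<Phi>_emb[OF CA_closed(8)])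
  finally show ?thesis by (simp add: emb_monom sum.distrib)
qed

end

section \<open>Points of the spectrum of the Tate algebra\<close>

lemma phi_span_sum:
  "(\<And>i. i < n \<Longrightarrow> f i \<in> phi_span H A \<Phi>) \<Longrightarrow> (\<lambda>w. \<Sum>i<(n::nat). f i w) \<in> phi_span H A \<Phi>"
  by (induction n) (auto intro: phi_span.zero phi_span_add)

lemma tendsto_0_le:
  fixes f g :: "nat \<Rightarrow> real"
  assumes "\<And>n. 0 \<le> f n" "\<And>n. f n \<le> g n" "g \<longlonglongrightarrow> 0"
  shows "f \<longlonglongrightarrow> 0"
  by (rule tendsto_sandwich[OF _ _ tendsto_const assms(3)]) (use assms in auto)

lemma coord_ideal_closed:
  assumes "ideal P (coord_ring X L)" "is_subring L"
  shows "x \<in> P \<Longrightarrow> x' \<in> P \<Longrightarrow> x + x' \<in> P" "x \<in> P \<Longrightarrow> a \<in> polys_over L \<times> polys_over L \<Longrightarrow> reg_mult X a x \<in> P"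
    "0 \<in> P" "x \<in> P \<Longrightarrow> - x \<in> P" "x \<in> P \<Longrightarrow> x' \<in> P \<Longrightarrow> x - x' \<in> P" "P \<subseteq> polys_over L \<times> polys_over L"
proof -
  interpret ideal P "coord_ring X L" by (rule assms(1))
  show a: "x \<in> P \<Longrightarrow> x' \<in> P \<Longrightarrow> x + x' \<in> P" for x x'
    using additive_subgroup.a_closed[OF ideal.axioms(1)[OF assms(1)], of x x'] by simp
  show m: "x \<in> P \<Longrightarrow> a \<in> polys_over L \<times> polys_over L \<Longrightarrow> reg_mult X a x \<in> P" for x a
    using I_l_closed[of x a] by simp
  show "0 \<in> P" using additive_subgroup.zero_closed[OF ideal.axioms(1)[OF assms(1)]] by simp
  show n: "- x \<in> P" if "x \<in> P" for x
  proof -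
    have "reg_mult X ([:-1:], 0) x \<in> P"
      using that polys_over_closed[OF assms(2)] is_subringD[OF assms(2)] by (intro m) auto
    then show ?thesis by (simp add: reg_mult_def uminus_prod_def)
  qed
  show "x - x' \<in> P" if "x \<in> P" "x' \<in> P" using a[OF that(1) n[OF that(2)]] by simp
  show "P \<subseteq> polys_over L \<times> polys_over L" using a_subset by simp
qed

context elliptic_data
begin

lemma absv_F: "c \<in> \<F> \<Longrightarrow> absv c \<le> 1"
proof (cases "c = 0")
  case False
  assume "c \<in> \<F>"
  then have "absv (emb X ([:c:], 0)) = real q ^ pole_order ([:c:], 0::'c poly)"
    using False CA_closed(6) by (intro absv_emb) (auto simp: zero_prod_def)
  then show ?thesis by (simp add: pole_order_def)
qed simp

text \<open>If |b| > 1 and |a| <= 1, then b^2 would exceed all other terms of the Weierstrass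
  equation. So integrality of a point is a condition on its t-coordinate alone.\<close>

lemma on_curve_bounded:
  assumes "on_curve X a b" "absv a \<le> 1"
  shows "absv b \<le> 1"
proof (rule ccontr)
  assume "\<not> absv b \<le> 1"
  then have b: "absv b > 1" by simp
  note w = weier_F[THEN absv_F]
  have p: "absv (a ^ n) \<le> 1" for n using assms(2) by (simp add: absv_power power_le_one)
  have m: "absv (x * x') \<le> 1" if "absv x \<le> 1" "absv x' \<le> 1" for x x' :: 'c
    using that by (simp add: absv_mult mult_le_one)
  have "absv (a ^ 3 + wa2 X * a ^ 2 + wa4 X * a + wa6 X) \<le> 1"
    by (intro absv_add_le_bound m p w assms(2))
  moreover have "absv ((wa1 X * a + wa3 X) * b) \<le> absv b"
  proof -
    have "absv (wa1 X * a + wa3 X) \<le> 1" by (intro absv_add_le_bound m w assms(2))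
    then have "absv (wa1 X * a + wa3 X) * absv b \<le> 1 * absv b" by (intro mult_right_mono) auto
    then show ?thesis by (simp add: absv_mult)
  qed
  moreover have "b ^ 2 = (a ^ 3 + wa2 X * a ^ 2 + wa4 X * a + wa6 X) - (wa1 X * a + wa3 X) * b"
    using assms(1) by (simp add: on_curve_def algebra_simps)
  ultimately have "absv (b ^ 2) \<le> absv b"
    using b absv_diff_le_bound[of "a ^ 3 + wa2 X * a ^ 2 + wa4 X * a + wa6 X" "absv b" "(wa1 X * a + wa3 X) * b"] by simp
  then have "absv b * absv b \<le> absv b * 1" by (simp add: absv_mult power2_eq_square)
  moreover have "absv b * 1 < absv b * absv b" using b by (intro mult_strict_left_mono) auto
  ultimately show False by linarith
qed

context
  fixes a b :: 'c
  assumes ab: "on_curve X a b" "absv a \<le> 1"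
begin

lemma absv_b: "absv b \<le> 1"
  using on_curve_bounded[OF ab] .

lemma absv_point_eval_A:
  assumes "x \<in> CA"
  shows "absv (point_eval a b x) \<le> 1"
proof -
  define n where "n = Suc (max (degree (fst x)) (degree (snd x)))"
  have c: "absv (coeff (fst x) i) \<le> 1" "absv (coeff (snd x) i) \<le> 1" for i
    using assms absv_F by (auto simp: polys_over_def)
  have m: "absv (u * u') \<le> 1" if "absv u \<le> 1" "absv u' \<le> 1" for u u' :: 'c
    using that by (simp add: absv_mult mult_le_one)
  have p: "absv (a ^ i) \<le> 1" for i using ab(2) by (simp add: absv_power power_le_one)
  have "point_eval a b x = (\<Sum>i<n. coeff (fst x) i * a ^ i + coeff (snd x) i * (a ^ i * b))"
    by (rule point_eval_as_sum) (auto simp: n_def)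
  also have "absv \<dots> \<le> 1" by (intro absv_sum_le_bound absv_add_le_bound m c p absv_b) auto
  finally show ?thesis .
qed

text \<open>Elements of A have values of absolute value at most 1 at an integral point, so each
  representation bounds the value by the maximum of its |c_i|. By this continuity, evaluation passes
  to the completion.\<close>

lemma absv_point_eval_le_tens_norm: "absv (point_eval a b x) \<le> tens_norm X x"
  unfolding tens_norm_def
proof (rule cInf_greatest)
  \<comment> \<open>The expansion along t^i and t^i y shows that the infimum is taken over a
    nonempty set.\<close>
  let ?f = "\<lambda>i. ((monom 1 i, 0), coeff (fst x) i)" and ?g = "\<lambda>i. ((0, monom 1 i), coeff (snd x) i)"
  let ?r = "map ?f [0..<Suc (degree (fst x))] @ map ?g [0..<Suc (degree (snd x))]"
  have "(\<Sum>(a, c)\<leftarrow>?r. tens a c) = x"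
    unfolding map_append sum_list_append map_map comp_def interv_sum_list_conv_sum_set_nat
    by (subst (5) reg_decompose) (simp add: atLeast0_lessThan_Suc atLeast0LessThan lessThan_Suc_atMost del: upt_Suc)
  moreover have "\<forall>(a, c)\<in>set ?r. a \<in> carrier (ring_A X)" using CA_closed by auto
  ultimately have "\<exists>r. (\<forall>(a, c)\<in>set r. a \<in> carrier (ring_A X)) \<and> x = (\<Sum>(a, c)\<leftarrow>r. tens a c)"
    by (intro exI[of _ ?r] conjI) simp_all
  then show "{Max (insert 0 ((\<lambda>(a, c). absv c) ` set r)) |r.
      (\<forall>(a, c)\<in>set r. a \<in> carrier (ring_A X)) \<and> x = (\<Sum>(a, c)\<leftarrow>r. tens a c)} \<noteq> {}"
    by (elim exE) (rule ccontr, simp only: not_not, drule equalityD1, blast)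
next
  fix z assume "z \<in> {Max (insert 0 ((\<lambda>(a, c). absv c) ` set r)) |r.
      (\<forall>(a, c)\<in>set r. a \<in> carrier (ring_A X)) \<and> x = (\<Sum>(a, c)\<leftarrow>r. tens a c)}"
  then obtain r where r: "\<forall>(a, c)\<in>set r. a \<in> CA" "x = (\<Sum>(a, c)\<leftarrow>r. tens a c)"
    and z: "z = Max (insert 0 ((\<lambda>(a, c). absv c) ` set r))" by auto
  have z0: "0 \<le> z" unfolding z by (rule Max_ge) auto
  have "absv c \<le> z" if "(x, c) \<in> set r" for x c
    unfolding z using that by (intro Max_ge) (auto intro!: image_eqI)
  with r(1) have "absv (point_eval a b (\<Sum>(a, c)\<leftarrow>r. tens a c)) \<le> z"
  proof (induction r)
    case (Cons xc r)
    obtain x c where xc: "xc = (x, c)" by (cases xc)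
    have "absv (point_eval a b x) \<le> 1" using Cons.prems xc by (intro absv_point_eval_A) auto
    moreover have "absv c \<le> z" using Cons.prems xc by auto
    ultimately have "absv c * absv (point_eval a b x) \<le> z * 1" using z0 by (intro mult_mono) auto
    moreover have "point_eval a b (tens x c) = c * point_eval a b x" by (simp add: tens_def point_eval_def algebra_simps)
    ultimately have "absv (point_eval a b (tens x c)) \<le> z" by (simp add: absv_mult)
    moreover have "absv (point_eval a b (\<Sum>(a, c)\<leftarrow>r. tens a c)) \<le> z"
      using Cons.prems by (intro Cons.IH) auto
    ultimately show ?case by (simp add: xc point_eval_add absv_add_le_bound)
  qed (use z0 in simp)
  then show "absv (point_eval a b x) \<le> z" using r(2) by simp
qed

lemma tens_norm_0: "tens_norm X 0 = 0"
  unfolding tens_norm_def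
proof (rule cInf_eq_minimum)
  show "0 \<in> {Max (insert 0 ((\<lambda>(a, c). absv c) ` set r)) |r.
      (\<forall>(a, c)\<in>set r. a \<in> carrier (ring_A X)) \<and> (0::'c reg) = (\<Sum>(a, c)\<leftarrow>r. tens a c)}"
    by (rule CollectI) (rule exI[of _ "[]"], simp)
qed auto

text \<open>The limit of \<open>s\<close> in the completion has value 0 at (a, b). By
  \<open>vanishing_null\<close> this depends only on the coset of \<open>s\<close>.\<close>

definition vanishing :: "(nat \<Rightarrow> 'c reg) \<Rightarrow> bool" where
  "vanishing s \<longleftrightarrow> (\<lambda>n. absv (point_eval a b (s n))) \<longlonglongrightarrow> 0"

lemma vanishing_add: "vanishing s \<Longrightarrow> vanishing r \<Longrightarrow> vanishing (\<lambda>n. s n + r n)"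
proof -
  assume "vanishing s" "vanishing r"
  then have "(\<lambda>n. absv (point_eval a b (s n)) + absv (point_eval a b (r n))) \<longlonglongrightarrow> 0 + 0"
    unfolding vanishing_def by (rule tendsto_add)
  moreover have "absv (u + u') \<le> absv u + absv u'" for u u' :: 'c
    using absv_add_le[of u u'] absv_nonneg[of u] absv_nonneg[of u'] by linarith
  ultimately show ?thesis
    unfolding vanishing_def point_eval_add
    by - (rule tendsto_0_le[of _ "\<lambda>n. absv (point_eval a b (s n)) + absv (point_eval a b (r n))"], simp_all)
qed

lemma vanishing_null: "s \<in> null_seqs X \<Longrightarrow> vanishing s"
  unfolding vanishing_def null_seqs_def
  by (rule tendsto_0_le[of _ "\<lambda>n. tens_norm X (s n)"]) (auto simp: absv_point_eval_le_tens_norm)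

lemma cauchy_bounded:
  assumes "s \<in> carrier (cauchy_ring X)"
  shows "\<exists>M. \<forall>n. absv (point_eval a b (s n)) \<le> M"
proof -
  have "\<exists>N. \<forall>m\<ge>N. \<forall>n\<ge>N. tens_norm X (s m - s n) < 1" using assms by (simp add: cauchy_ring_def)
  then obtain N where N: "\<And>m n. m \<ge> N \<Longrightarrow> n \<ge> N \<Longrightarrow> tens_norm X (s m - s n) < 1" by blast
  let ?v = "\<lambda>n. absv (point_eval a b (s n))"
  let ?M = "1 + (\<Sum>i\<le>N. ?v i)"
  have le: "?v i \<le> ?M" if "i \<le> N" for i
    using member_le_sum[of i "{..N}" ?v] that by simp
  have "?v n \<le> ?M" for n
  proof (cases "n \<le> N")
    case False
    have "absv (point_eval a b (s n) - point_eval a b (s N)) \<le> 1"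
      using absv_point_eval_le_tens_norm[of "s n - s N"] N[of n N] False by (simp add: point_eval_diff)
    moreover have "1 \<le> ?M" by (simp add: sum_nonneg)
    ultimately have "absv ((point_eval a b (s n) - point_eval a b (s N)) + point_eval a b (s N)) \<le> ?M"
      using le[of N] by (intro absv_add_le_bound) auto
    then show ?thesis by simp
  qed (rule le)
  then show ?thesis by blast
qed

lemma vanishing_mult:
  assumes "\<And>n. absv (point_eval a b (s n)) \<le> M" "vanishing r"
  shows "vanishing (\<lambda>n. reg_mult X (s n) (r n))"
  unfolding vanishing_def point_eval_mult[OF ab(1)] absv_mult
proof (rule tendsto_0_le[of _ "\<lambda>n. M * absv (point_eval a b (r n))"])
  show "(\<lambda>n. M * absv (point_eval a b (r n))) \<longlonglongrightarrow> 0"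
    using tendsto_mult[OF tendsto_const[of M] assms(2)[unfolded vanishing_def]] by simp
qed (use assms(1) in \<open>auto intro: mult_right_mono\<close>)

lemma const_seq_cauchy: "(\<lambda>n. x) \<in> carrier (cauchy_ring X)"
  by (simp add: cauchy_ring_def tens_norm_0 polys_over_def)

lemma zero_seq_null: "(\<lambda>n. 0) \<in> null_seqs X"
  using const_seq_cauchy[of 0] by (simp add: null_seqs_def tens_norm_0)

lemma ring_T_simps:
  "carrier (ring_T X) = {null_seqs X +>\<^bsub>cauchy_ring X\<^esub> s | s. s \<in> carrier (cauchy_ring X)}"
  "mult (ring_T X) c d = (\<Union>s\<in>c. \<Union>r\<in>d. null_seqs X +>\<^bsub>cauchy_ring X\<^esub> (\<lambda>n. reg_mult X (s n) (r n)))"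
  "add (ring_T X) c d = {\<lambda>n. s n + r n | s r. s \<in> c \<and> r \<in> d}"
  "zero (ring_T X) = null_seqs X" "one (ring_T X) = null_seqs X +>\<^bsub>cauchy_ring X\<^esub> (\<lambda>n. (1, 0))"
  by (auto simp: ring_T_def FactRing_def A_RCOSETS_def' rcoset_mult_def set_add_def' cauchy_ring_def)

lemma coset_eq: "null_seqs X +>\<^bsub>cauchy_ring X\<^esub> s = {\<lambda>n. h n + s n | h. h \<in> null_seqs X}"
  by (auto simp: a_r_coset_def' cauchy_ring_def)

text \<open>The elements of the Tate algebra whose value at \<open>(a, b)\<close> is 0 form a proper ideal. If the
  quotient of Cauchy sequences were not a ring, it would have no ideals, and the intersection of
  all ideals would be everything, including the empty set, which is not a coset.\<close>

lemma point_in_Spm_T: "{x. point_eval a b x = 0} \<in> Spm_T X"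
proof -
  let ?m = "{x. point_eval a b x = 0}" and ?T = "ring_T X" and ?R = "ring_AC X"
  have U: "polys_over (UNIV :: 'c set) = UNIV" by (simp add: polys_over_def)
  interpret R: cring ?R by (rule coord_ring_cring) (auto simp: is_subring_def)
  have carR: "carrier ?R = UNIV" by (simp add: U)
  have idm: "ideal ?m ?R"
  proof (rule idealI)
    show "ring ?R" by (rule R.ring_axioms)
    show "subgroup ?m (add_monoid ?R)"
    proof (rule subgroup.intro)
      show "inv\<^bsub>add_monoid ?R\<^esub> x \<in> ?m" if "x \<in> ?m" for x
      proof -
        have "\<ominus>\<^bsub>?R\<^esub> x = - x" by (rule R.minus_equality) (auto simp: U)
        then show ?thesis using that point_eval_diff[of a b 0 x] by (simp add: a_inv_def)
      qed
    qed (auto simp: U point_eval_add)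
  qed (auto simp: point_eval_mult[OF ab(1)])
  have "maximalideal ?m ?R"
  proof (rule maximalidealI[OF idm])
    show "carrier ?R \<noteq> ?m"
    proof
      assume "carrier ?R = ?m"
      then have "(1, 0) \<in> ?m" using carR by blast
      then show False by simp
    qed
    fix J assume J: "ideal J ?R" "?m \<subseteq> J" "J \<subseteq> carrier ?R"
    show "J = ?m \<or> J = carrier ?R"
    proof (cases "J \<subseteq> ?m")
      case False
      \<comment> \<open>Scaled to value 1 at the point, x differs from 1 by an element of
        \<open>?m\<close>, so J contains 1.\<close>
      then obtain x where x: "x \<in> J" "point_eval a b x \<noteq> 0" by auto
      let ?c = "([:inverse (point_eval a b x):], 0) :: 'c reg"
      note Jc = coord_ideal_closed[OF J(1)]
      have "is_subring (UNIV :: 'c set)" by (auto simp: is_subring_def)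
      note Jc = Jc[OF this]
      have "reg_mult X ?c x \<in> J" using x(1) by (intro Jc(2)) (auto simp: U)
      moreover have "(1, 0) - reg_mult X ?c x \<in> J"
        using x(2) J(2) by (auto simp: point_eval_diff point_eval_mult[OF ab(1)])
      ultimately have "(1, 0) - reg_mult X ?c x + reg_mult X ?c x \<in> J" by (intro Jc(1))
      then have "\<one>\<^bsub>?R\<^esub> \<in> J" by simp
      then show ?thesis using ideal.one_imp_carrier[OF J(1)] by simp
    qed (use J in auto)
  qed
  moreover have "Idl\<^bsub>?T\<^esub> (to_T X ` ?m) \<noteq> carrier ?T"
  proof (cases "ring ?T")
    case False
    have "{} \<notin> carrier ?T" using zero_seq_null by (auto simp: ring_T_simps(1) coset_eq)
    moreover have "Idl\<^bsub>?T\<^esub> (to_T X ` ?m) = UNIV"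
      using False ideal.axioms(2) by (auto simp: genideal_def)
    ultimately show ?thesis by auto
  next
    case True
    interpret T: ring ?T by (rule True)
    define J where "J = {c \<in> carrier ?T. \<forall>s\<in>c. vanishing s}"
    have bdd: "\<exists>M. \<forall>n. absv (point_eval a b (s n)) \<le> M" if c: "c \<in> carrier ?T" "s \<in> c" for c s
    proof -
      obtain h s0 where hs: "h \<in> null_seqs X" "s0 \<in> carrier (cauchy_ring X)" "s = (\<lambda>n. h n + s0 n)"
        using c by (auto simp: ring_T_simps(1) coset_eq)
      obtain M where M: "\<And>n. absv (point_eval a b (h n)) \<le> M"
        using cauchy_bounded[of h] hs(1) by (auto simp: null_seqs_def)
      obtain M' where M': "\<And>n. absv (point_eval a b (s0 n)) \<le> M'" using cauchy_bounded[OF hs(2)] by blast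
      have "absv (point_eval a b (s n)) \<le> max M M'" for n
        unfolding hs(3) point_eval_add using M[of n] M'[of n] by (intro absv_add_le_bound) auto
      then show ?thesis by blast
    qed
    have ne: "c \<noteq> {}" if "c \<in> carrier ?T" for c using that zero_seq_null by (auto simp: ring_T_simps(1) coset_eq)
    have mulJ: "c \<otimes>\<^bsub>?T\<^esub> d \<in> J" if cd: "c \<in> carrier ?T" "d \<in> carrier ?T" "c \<in> J \<or> d \<in> J" for c d
    proof -
      have "vanishing r" if r: "r \<in> c \<otimes>\<^bsub>?T\<^esub> d" for r
      proof -
        obtain s u h where s: "s \<in> c" "u \<in> d" "h \<in> null_seqs X" "r = (\<lambda>n. h n + reg_mult X (s n) (u n))"
          using r by (auto simp: ring_T_simps(2) coset_eq)
        have "vanishing (\<lambda>n. reg_mult X (s n) (u n))"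
        proof (cases "d \<in> J")
          case True
          obtain M where "\<And>n. absv (point_eval a b (s n)) \<le> M" using bdd[OF cd(1) s(1)] by blast
          then show ?thesis using True s(2) by (intro vanishing_mult) (auto simp: J_def)
        next
          case False
          obtain M where "\<And>n. absv (point_eval a b (u n)) \<le> M" using bdd[OF cd(2) s(2)] by blast
          then have "vanishing (\<lambda>n. reg_mult X (u n) (s n))"
            using False cd(3) s(1) by (intro vanishing_mult) (auto simp: J_def)
          moreover have "reg_mult X x x' = reg_mult X x' x" for x x' by (simp add: reg_mult_def mult_ac add_ac)
          ultimately show ?thesis by simp
        qed
        then show ?thesis unfolding s(4) by (rule vanishing_add[OF vanishing_null[OF s(3)]])
      qed
      then show ?thesis using T.m_closed[OF cd(1,2)] by (simp add: J_def)
    qed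
    have "ideal J ?T"
    proof (rule idealI)
      show "ring ?T" by (rule True)
      show "subgroup J (add_monoid ?T)"
      proof (rule subgroup.intro)
        show "J \<subseteq> carrier (add_monoid ?T)" by (auto simp: J_def)
        show "\<one>\<^bsub>add_monoid ?T\<^esub> \<in> J" using vanishing_null T.zero_closed by (simp add: J_def ring_T_simps(4))
        show "c \<otimes>\<^bsub>add_monoid ?T\<^esub> d \<in> J" if "c \<in> J" "d \<in> J" for c d
          using that T.a_closed[of c d] by (auto simp: J_def ring_T_simps(3) vanishing_add)
        show "inv\<^bsub>add_monoid ?T\<^esub> c \<in> J" if c: "c \<in> J" for c
        proof -
          have cT: "c \<in> carrier ?T" using c by (simp add: J_def)
          then have dT: "\<ominus>\<^bsub>?T\<^esub> c \<in> carrier ?T" by (rule T.a_inv_closed)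
          obtain s where s: "s \<in> c" using ne[OF cT] by blast
          have "vanishing r" if r: "r \<in> \<ominus>\<^bsub>?T\<^esub> c" for r
          proof -
            have "(\<lambda>n. s n + r n) \<in> c \<oplus>\<^bsub>?T\<^esub> (\<ominus>\<^bsub>?T\<^esub> c)" using s r by (auto simp: ring_T_simps(3))
            then have "vanishing (\<lambda>n. s n + r n)" using T.r_neg[OF cT] vanishing_null by (simp add: ring_T_simps(4))
            moreover have "vanishing (\<lambda>n. - s n)"
              using c s point_eval_diff[of a b 0] by (auto simp: J_def vanishing_def)
            ultimately have "vanishing (\<lambda>n. (s n + r n) + - s n)" by (rule vanishing_add)
            then show ?thesis by simp
          qed
          then show ?thesis using dT by (simp add: J_def a_inv_def)
        qed
      qed
      have JT: "c \<in> carrier ?T" if "c \<in> J" for c using that by (simp add: J_def)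
      show "x \<otimes>\<^bsub>?T\<^esub> c \<in> J" "c \<otimes>\<^bsub>?T\<^esub> x \<in> J" if "c \<in> J" "x \<in> carrier ?T" for c x
        using mulJ[OF that(2) JT[OF that(1)]] mulJ[OF JT[OF that(1)] that(2)] that(1) by simp_all
    qed
    moreover have "to_T X ` ?m \<subseteq> J"
    proof safe
      fix x assume x: "point_eval a b x = 0"
      have "to_T X x \<in> carrier ?T" unfolding to_T_def ring_T_simps(1) using const_seq_cauchy[of x] by blast
      moreover have "vanishing (\<lambda>n. x)" using x by (simp add: vanishing_def)
      ultimately show "to_T X x \<in> J"
        using vanishing_add vanishing_null by (auto simp: J_def to_T_def coset_eq)
    qed
    ultimately have sub: "Idl\<^bsub>?T\<^esub> (to_T X ` ?m) \<subseteq> J" by (rule T.genideal_minimal)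
    have "(\<lambda>n. 0 + (1, 0)) \<in> \<one>\<^bsub>?T\<^esub>" unfolding ring_T_simps(5) coset_eq
      by (rule CollectI, rule exI[of _ "\<lambda>n. 0"]) (use zero_seq_null in simp)
    moreover have "\<not> vanishing (\<lambda>n. 0 + (1, 0))" by (simp add: vanishing_def LIMSEQ_const_iff)
    ultimately have "\<one>\<^bsub>?T\<^esub> \<notin> J" by (auto simp: J_def)
    then show ?thesis using sub T.one_closed by blast
  qed
  ultimately show ?thesis by (simp add: Spm_T_def)
qed

end

lemma V_not_in_Spm_T:
  assumes v: "\<not> V_supported_on_Spm_T X v" and ab: "on_curve X a b" and z: "\<And>x. x \<in> v \<Longrightarrow> point_eval a b x = 0"
  shows "absv a > 1"
proof (rule ccontr)
  assume "\<not> absv a > 1"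
  then have S: "{x. point_eval a b x = 0} \<in> Spm_T X" using ab by (intro point_in_Spm_T) auto
  interpret R: cring "ring_AC X" by (rule coord_ring_cring) (auto simp: is_subring_def)
  have "ideal {x. point_eval a b x = 0} (ring_AC X)" using S maximalideal.axioms(1) by (auto simp: Spm_T_def)
  then have "Idl\<^bsub>ring_AC X\<^esub> v \<subseteq> {x. point_eval a b x = 0}" using z by (intro R.genideal_minimal) auto
  then show False using v S by (auto simp: V_supported_on_Spm_T_def)
qed

end

context hayes_setting
begin

text \<open>For x in v, the element x \<tau> lies in v M = (A \<otimes> H) id, so its coordinate is
  0. This coordinate is the value of x at (\<alpha>, \<beta>), which is thus a point of V.\<close>

lemma V_point:
  assumes em: "elliptic_module \<F> A H Kbar q (t_elt X) x1 \<Phi> E \<rho> (y_elt X) y1 y2" and V: "is_V_ideal X \<phi> v"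
  shows "\<exists>\<alpha> \<beta>. \<alpha> \<in> H \<and> (\<lambda>w. \<Phi> (t_elt X) w ^ q - \<alpha> * w ^ q) \<in> phi_span H A \<Phi> \<and> on_curve X \<alpha> \<beta> \<and>
    (\<forall>x\<in>v. point_eval \<alpha> \<beta> x = 0)"
proof -
  interpret M: elliptic_module \<F> A H Kbar q "t_elt X" x1 \<Phi> E \<rho> "y_elt X" y1 y2 by (rule em)
  obtain \<alpha> \<beta> where \<alpha>: "M.modN (\<lambda>w. \<Phi> (t_elt X) w ^ q) \<alpha>" and \<beta>: "M.modN (\<lambda>w. \<Phi> (y_elt X) w ^ q) \<beta>"
    using M.modN_t_y by blast
  have "on_curve X \<alpha> \<beta>"
    unfolding on_curve_def by (rule M.modN_weierstrass[OF \<alpha> \<beta> weier_F on_curve_generic[unfolded on_curve_def]])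
  moreover have "point_eval \<alpha> \<beta> x = 0" if x: "x \<in> v" for x
  proof -
    let ?\<tau> = "monom 1 1 :: 'c poly"
    let ?R = "coord_ring X H"
    have v: "ideal v ?R" and eq: "{motive_act X \<phi> x 1 | x. x \<in> carrier ?R} =
       {\<Sum>i<n. motive_act X \<phi> (x i) (m i) | (n::nat) x m. \<forall>i<n. x i \<in> v \<and> m i \<in> polys_over H}"
      using V by (auto simp: is_V_ideal_def Let_def)
    have xH: "x \<in> polys_over H \<times> polys_over H" using ideal.Icarr[OF v x] by simp
    have \<tau>H: "?\<tau> \<in> polys_over H" by (rule polys_over_closed(9)[OF HD(7)])
    have "motive_act X \<phi> x ?\<tau> = (\<Sum>i<1::nat. motive_act X \<phi> ((\<lambda>_. x) i) ((\<lambda>_. ?\<tau>) i))" by simp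
    then have "motive_act X \<phi> x ?\<tau> \<in> {\<Sum>i<n. motive_act X \<phi> (x i) (m i) | (n::nat) x m. \<forall>i<n. x i \<in> v \<and> m i \<in> polys_over H}"
      using x \<tau>H by (intro CollectI exI[of _ "1::nat"] exI[of _ "\<lambda>_. x"] exI[of _ "\<lambda>_. ?\<tau>"]) auto
    then obtain x' where x': "x' \<in> polys_over H \<times> polys_over H" "motive_act X \<phi> x ?\<tau> = motive_act X \<phi> x' 1"
      unfolding eq[symmetric] by auto
    define n where "n = Suc (max (max (degree (fst x)) (degree (snd x))) (max (degree (fst x')) (degree (snd x'))))"
    have n: "degree (fst x) < n" "degree (snd x) < n" "degree (fst x') < n" "degree (snd x') < n" by (auto simp: n_def)
    let ?t = "t_elt X" and ?y = "y_elt X"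
    have \<tau>: "tw_eval q ?\<tau> u = u ^ q" for u using tw_eval_monom[OF tw, of 1 1 u] by simp
    have "(\<Sum>i<n. coeff (fst x) i * \<Phi> (?t ^ i) w ^ q + coeff (snd x) i * \<Phi> (?t ^ i * ?y) w ^ q) =
        (\<Sum>i<n. coeff (fst x') i * \<Phi> (?t ^ i) w + coeff (snd x') i * \<Phi> (?t ^ i * ?y) w)" for w
      using tw_eval_motive_act[OF n(1,2), of ?\<tau> w] tw_eval_motive_act[OF n(3,4), of 1 w]
      unfolding x'(2) \<tau> tw_eval_1[OF tw] by (simp only:)
    moreover have "(\<lambda>w. \<Sum>i<n. coeff (fst x') i * \<Phi> (?t ^ i) w + coeff (snd x') i * \<Phi> (?t ^ i * ?y) w) \<in> phi_span H A \<Phi>"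
      using x'(1) by (intro phi_span_sum phi_span_add phi_span_single M.tA) (auto simp: polys_over_def)
    ultimately have "(\<lambda>w. \<Sum>i<n. coeff (fst x) i * \<Phi> (?t ^ i) w ^ q + coeff (snd x) i * \<Phi> (?t ^ i * ?y) w ^ q) \<in> phi_span H A \<Phi>"
      by simp
    then have "(\<Sum>i<n. coeff (fst x) i * \<alpha> ^ i + coeff (snd x) i * (\<alpha> ^ i * \<beta>)) = 0"
      using xH by (intro M.modN_vanish[OF \<alpha> \<beta>]) (auto simp: polys_over_def)
    then show ?thesis using point_eval_as_sum[OF n(1,2)] by simp
  qed
  ultimately show ?thesis using \<alpha>[unfolded M.modN_def] by blast
qed

end

section \<open>Characters attached to maximal ideals\<close>

text \<open>The factor is monic, so the coefficients of \<open>g\<close> are determined from the top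
  by those of the product.\<close>

lemma polys_over_linear_factor:
  assumes S: "is_subring S" "c \<in> S" and "[:- c, 1:] * g \<in> polys_over S"
  shows "g \<in> polys_over S"
proof -
  have "coeff g n \<in> S" for n
  proof (induction "Suc (degree g) - n" arbitrary: n)
    case 0
    then show ?case using is_subringD[OF S(1)] by (simp add: coeff_eq_0)
  next
    case (Suc k)
    have "coeff g (Suc n) \<in> S" by (rule Suc.hyps(1)) (use Suc.hyps(2) in simp)
    moreover have "coeff ([:- c, 1:] * g) (Suc n) \<in> S" using assms(3) unfolding polys_over_def by blast
    moreover have "coeff g n = coeff ([:- c, 1:] * g) (Suc n) + c * coeff g (Suc n)" by simp
    ultimately show ?case using S(2) is_subringD(4,6)[OF S(1)] by metis
  qed
  then show ?thesis by (simp add: polys_over_def)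
qed

context elliptic_data
begin

lemma Fbar_inverse: "c \<in> Fbar X \<Longrightarrow> inverse c \<in> Fbar X"
  unfolding Fbar_def algebraic_closure_finite_iff[OF FD(7) F_subfield(2)]
  using finite_subring_is_subfield is_subfieldD(2) by blast

lemma weier_Fbar: "wa1 X \<in> Fbar X" "wa2 X \<in> Fbar X" "wa3 X \<in> Fbar X" "wa4 X \<in> Fbar X" "wa6 X \<in> Fbar X"
  using weier_F F_subset_Fbar by auto

context
  fixes P :: "'c reg set"
  assumes P: "maximalideal P (coord_ring X (Fbar X))"
begin

abbreviation "CF \<equiv> polys_over (Fbar X) \<times> polys_over (Fbar X)"

lemma CF_cring: "cring (coord_ring X (Fbar X))"
  by (rule coord_ring_cring[OF Fbar_subring]) (use weier_Fbar in auto)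

lemma P_ideal: "ideal P (coord_ring X (Fbar X))"
  using P by (rule maximalideal.axioms(1))

lemmas Pc = coord_ideal_closed[OF P_ideal Fbar_subring]
lemmas FbD = is_subringD[OF Fbar_subring]
lemmas FbP = polys_over_closed[OF Fbar_subring]

lemma P_prime: "x \<in> CF \<Longrightarrow> x' \<in> CF \<Longrightarrow> reg_mult X x x' \<in> P \<Longrightarrow> x \<in> P \<or> x' \<in> P"
  using primeideal.I_prime[OF cring.maximalideal_prime[OF CF_cring P], of x x'] by simp

lemma const_notin_P:
  assumes "c \<in> Fbar X" "([:c:], 0) \<in> P"
  shows "c = 0"
proof (rule ccontr)
  assume c: "c \<noteq> 0"
  have "reg_mult X ([:inverse c:], 0) ([:c:], 0) \<in> P"
    using assms Fbar_inverse FbP FbD by (intro Pc(2)) auto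
  then have "\<one>\<^bsub>coord_ring X (Fbar X)\<^esub> \<in> P" using c by (simp add: reg_mult_def one_pCons)
  then have "P = carrier (coord_ring X (Fbar X))" by (rule ideal.one_imp_carrier[OF P_ideal])
  then show False using maximalideal.I_notcarr[OF P] by simp
qed

text \<open>\<open>f\<close> splits over \<open>Fbar X\<close> and P is prime without nonzero
  constants, so removing linear factors one by one must meet one in P.\<close>

lemma P_contains_linear:
  assumes "f \<in> polys_over (Fbar X)" "f \<noteq> 0" "(f, 0) \<in> P"
  shows "\<exists>\<alpha>\<in>Fbar X. ([:- \<alpha>, 1:], 0) \<in> P"
  using assms
proof (induction "degree f" arbitrary: f rule: less_induct)
  case less
  show ?case
  proof (cases "degree f = 0")
    case True
    then obtain c where c: "f = [:c:]" by (rule degree_eq_zeroE)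
    have "coeff f 0 \<in> Fbar X" using less.prems(1) by (simp add: polys_over_def)
    then have "c = 0" using const_notin_P[of c] less.prems(3) c by simp
    then show ?thesis using less.prems(2) c by simp
  next
    case False
    then obtain \<alpha> where \<alpha>: "\<alpha> \<in> Fbar X" "poly f \<alpha> = 0" using Fbar_root[OF less.prems(1)] by auto
    then obtain g where g: "f = [:- \<alpha>, 1:] * g" by (auto simp: poly_eq_0_iff_dvd elim: dvdE)
    have gF: "g \<in> polys_over (Fbar X)"
      using polys_over_linear_factor[OF Fbar_subring \<alpha>(1), of g] less.prems(1) g by simp
    have g0: "g \<noteq> 0" using less.prems(2) g by auto
    have "reg_mult X ([:- \<alpha>, 1:], 0) (g, 0) \<in> P" using less.prems(3) by (simp add: reg_mult_def g)
    then consider "([:- \<alpha>, 1:], 0) \<in> P" | "(g, 0) \<in> P"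
      using P_prime[of "([:- \<alpha>, 1:], 0)" "(g, 0)"] gF \<alpha>(1) FbP FbD by auto
    then show ?thesis
    proof cases
      case 2
      have "degree f = degree [:- \<alpha>, 1:] + degree g" unfolding g using g0 by (intro degree_mult_eq) auto
      then have "degree g < degree f" by simp
      then show ?thesis using less.hyps[OF _ gF g0 2] by blast
    qed (use \<alpha> in blast)
  qed
qed

text \<open>Once t \<equiv> \<alpha> modulo P, the equation of the curve is a quadratic one for y,
  with roots \<beta> and \<beta>' in \<open>Fbar X\<close>. So (y - \<beta>)(y - \<beta>') lies in
  the prime ideal P, and so does one of the factors.\<close>

lemma P_is_point:
  assumes "f \<in> polys_over (Fbar X)" "f \<noteq> 0" "(f, 0) \<in> P"
  shows "\<exists>\<alpha>\<in>Fbar X. \<exists>\<beta>\<in>Fbar X. on_curve X \<alpha> \<beta> \<and> (\<forall>x\<in>CF. x - ([:point_eval \<alpha> \<beta> x:], 0) \<in> P)"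
proof -
  obtain \<alpha> where \<alpha>: "\<alpha> \<in> Fbar X" "([:- \<alpha>, 1:], 0) \<in> P" using P_contains_linear[OF assms] by blast
  have red1: "(r - [:poly r \<alpha>:], 0) \<in> P" if r: "r \<in> polys_over (Fbar X)" for r
  proof -
    have "poly (r - [:poly r \<alpha>:]) \<alpha> = 0" by simp
    then obtain g where g: "r - [:poly r \<alpha>:] = [:- \<alpha>, 1:] * g" by (auto simp only: poly_eq_0_iff_dvd elim: dvdE)
    have "r - [:poly r \<alpha>:] \<in> polys_over (Fbar X)"
      using r \<alpha>(1) FbP poly_in_subring[OF Fbar_subring] by auto
    then have "g \<in> polys_over (Fbar X)" using polys_over_linear_factor[OF Fbar_subring \<alpha>(1), of g] g by simp
    then have "reg_mult X (g, 0) ([:- \<alpha>, 1:], 0) \<in> P" using \<alpha>(2) FbP by (intro Pc(2)) auto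
    moreover have "reg_mult X (g, 0) ([:- \<alpha>, 1:], 0) = (r - [:poly r \<alpha>:], 0)"
      unfolding g by (simp add: reg_mult_def mult.commute del: mult_pCons_left mult_pCons_right)
    ultimately show ?thesis by simp
  qed
  have red: "(r - [:poly r \<alpha>:], s - [:poly s \<alpha>:]) \<in> P"
    if r: "r \<in> polys_over (Fbar X)" "s \<in> polys_over (Fbar X)" for r s
  proof -
    have "reg_mult X (0, 1) (s - [:poly s \<alpha>:], 0) \<in> P" using red1[OF r(2)] FbP by (intro Pc(2)) auto
    then have "(0, s - [:poly s \<alpha>:]) \<in> P" by (simp add: reg_mult_def)
    then show ?thesis using Pc(1)[OF red1[OF r(1)]] by fastforce
  qed
  define C where "C = [:wa6 X, wa4 X, wa2 X, 1:]"
  define b1 where "b1 = wa1 X * \<alpha> + wa3 X"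
  have CF: "C \<in> polys_over (Fbar X)" unfolding C_def using weier_Fbar FbP FbD by auto
  have b1F: "b1 \<in> Fbar X" "poly C \<alpha> \<in> Fbar X"
    using weier_Fbar \<alpha> FbD poly_in_subring[OF Fbar_subring CF \<alpha>(1)] by (auto simp: b1_def)
  have "[:- poly C \<alpha>, b1, 1:] \<in> polys_over (Fbar X)" using b1F FbP FbD by auto
  then obtain \<beta> where \<beta>: "\<beta> \<in> Fbar X" "poly [:- poly C \<alpha>, b1, 1:] \<beta> = 0" using Fbar_root by force
  define \<beta>' where "\<beta>' = - b1 - \<beta>"
  have \<beta>'F: "\<beta>' \<in> Fbar X" using b1F \<beta> FbD by (auto simp: \<beta>'_def)
  have quad: "\<beta> * \<beta> + b1 * \<beta> = poly C \<alpha>" using \<beta>(2) by (simp add: algebra_simps)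
  have prod: "\<beta> * \<beta>' = - poly C \<alpha>" unfolding quad[symmetric] \<beta>'_def by (simp add: algebra_simps)
  have quad': "\<beta>' * \<beta>' + b1 * \<beta>' = poly C \<alpha>" unfolding quad[symmetric] \<beta>'_def by (simp add: algebra_simps)
  have oc: "on_curve X \<alpha> b" if "b * b + b1 * b = poly C \<alpha>" for b
    using that by (simp add: on_curve_def C_def b1_def algebra_simps power2_eq_square power3_eq_cube)
  let ?W = "[:wa3 X, wa1 X:]"
  \<comment> \<open>In the basis 1, y both coordinates of the product are polynomials minus their
    values at \<alpha>, which is the form that \<open>red\<close> puts into P.\<close>
  have eqW: "reg_mult X ([:- \<beta>:], 1) ([:- \<beta>':], 1) = (C - [:poly C \<alpha>:], - ?W - [:poly (- ?W) \<alpha>:])"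
  proof -
    have "[:- \<beta>:] * [:- \<beta>':] = - [:poly C \<alpha>:]" using prod by (simp add: mult.commute)
    moreover have "[:- \<beta>:] + [:- \<beta>':] = - [:poly (- ?W) \<alpha>:]" by (simp add: \<beta>'_def b1_def algebra_simps)
    ultimately show ?thesis by (simp add: reg_mult_def C_def[symmetric] del: mult_pCons_left mult_pCons_right add_pCons)
  qed
  have WF: "- ?W \<in> polys_over (Fbar X)" using weier_Fbar FbP FbD by auto
  have "reg_mult X ([:- \<beta>:], 1) ([:- \<beta>':], 1) \<in> P" unfolding eqW by (rule red[OF CF WF])
  then have "([:- \<beta>:], 1) \<in> P \<or> ([:- \<beta>':], 1) \<in> P"
    using \<beta> \<beta>'F FbP FbD by (intro P_prime) auto
  then obtain b where b: "b \<in> Fbar X" "on_curve X \<alpha> b" "([:- b:], 1) \<in> P"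
    using oc[OF quad] oc[OF quad'] \<beta>(1) \<beta>'F by blast
  have "x - ([:point_eval \<alpha> b x:], 0) \<in> P" if x: "x \<in> CF" for x
  proof -
    obtain r s where rs: "x = (r, s)" "r \<in> polys_over (Fbar X)" "s \<in> polys_over (Fbar X)" using x by auto
    have "poly s \<alpha> \<in> Fbar X" using poly_in_subring[OF Fbar_subring rs(3) \<alpha>(1)] .
    then have "reg_mult X ([:poly s \<alpha>:], 0) ([:- b:], 1) \<in> P" using b FbP FbD by (intro Pc(2)) auto
    then have "(r - [:poly r \<alpha>:], s - [:poly s \<alpha>:]) + reg_mult X ([:poly s \<alpha>:], 0) ([:- b:], 1) \<in> P"
      using red[OF rs(2,3)] by (intro Pc(1))
    moreover have "(r - [:poly r \<alpha>:], s - [:poly s \<alpha>:]) + reg_mult X ([:poly s \<alpha>:], 0) ([:- b:], 1)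
        = x - ([:point_eval \<alpha> b x:], 0)"
      by (simp add: rs reg_mult_def point_eval_def algebra_simps)
    ultimately show ?thesis by simp
  qed
  then show ?thesis using \<alpha>(1) b by blast
qed

lemma chi_eq_point_eval:
  assumes pt: "\<alpha> \<in> Fbar X" "\<beta> \<in> Fbar X" "\<And>x. x \<in> CF \<Longrightarrow> x - ([:point_eval \<alpha> \<beta> x:], 0) \<in> P" and x: "x \<in> CF"
  shows "chi X P x = point_eval \<alpha> \<beta> x" "x \<in> P \<longleftrightarrow> point_eval \<alpha> \<beta> x = 0"
proof -
  have c: "point_eval \<alpha> \<beta> x \<in> Fbar X" using point_eval_in_subring[OF Fbar_subring x pt(1,2)] .
  have uniq: "c = point_eval \<alpha> \<beta> x" if c': "c \<in> Fbar X" "x - ([:c:], 0) \<in> P" for c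
  proof -
    have "(x - ([:c:], 0)) - (x - ([:point_eval \<alpha> \<beta> x:], 0)) \<in> P" using c'(2) pt(3)[OF x] by (rule Pc(5))
    then have "([:point_eval \<alpha> \<beta> x - c:], 0) \<in> P" by simp
    then show ?thesis using const_notin_P[of "point_eval \<alpha> \<beta> x - c"] c c'(1) FbD by auto
  qed
  show "chi X P x = point_eval \<alpha> \<beta> x"
    unfolding chi_def by (intro the_equality conjI c pt(3)[OF x]) (use uniq in blast)
  show "x \<in> P \<longleftrightarrow> point_eval \<alpha> \<beta> x = 0"
  proof
    assume "x \<in> P"
    then have "x - ([:0:], 0) \<in> P" by (simp flip: zero_prod_def)
    then show "point_eval \<alpha> \<beta> x = 0" using uniq[of 0] FbD by auto
  next
    assume "point_eval \<alpha> \<beta> x = 0"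
    then show "x \<in> P" using pt(3)[OF x] by (simp flip: zero_prod_def)
  qed
qed

end

section \<open>Signs\<close>

lemma emb_tens: "emb X (tens x c) = c * emb X x"
  by (simp add: emb_def tens_def algebra_simps)

lemma sgn_tens: "c \<noteq> 0 \<Longrightarrow> sgn_A (tens x c) = c * sgn_A x"
  by (simp add: sgn_A_def tens_def pole_order_def)

lemma sgn_nonzero: "x \<noteq> 0 \<Longrightarrow> sgn_A x \<noteq> 0"
proof -
  assume x: "x \<noteq> 0"
  obtain f g where fg: "x = (f, g)" by (cases x)
  consider "g = 0" | "g \<noteq> 0" "2 * degree f < 2 * degree g + 3" | "g \<noteq> 0" "2 * degree g + 3 < 2 * degree f"
    by (metis even_add even_mult_iff even_numeral linorder_neqE_nat odd_numeral)
  then show ?thesis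
  proof cases
    case 1
    then have "f \<noteq> 0" using x fg by (simp add: zero_prod_def)
    then show ?thesis using 1 by (simp add: fg sgn_A_def pole_order_def)
  next
    case 2
    then have "pole_order x = 2 * degree g + 3" by (simp add: fg pole_order_def)
    then show ?thesis using 2 by (simp add: fg sgn_A_def)
  next
    case 3
    then have "pole_order x = 2 * degree f" "f \<noteq> 0" by (auto simp: fg pole_order_def)
    then show ?thesis by (simp add: fg sgn_A_def)
  qed
qed

lemma sgn_in_F: "x \<in> CA \<Longrightarrow> sgn_A x \<in> \<F>"
  by (auto simp: sgn_A_def polys_over_def)

text \<open>The nonzero constants act freely on A - {0}, with \<open>A_plus X\<close> as
  representatives, and \<open>f\<close> is invariant; so the full sum is q - 1 = -1 times the sum
  over \<open>A_plus X\<close>. Since summability over \<open>A_plus X\<close> is part of the claim,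
  finite partial sums are compared.\<close>

lemma has_sum_A_plus:
  fixes f :: "'c \<Rightarrow> 'c"
  assumes S: "(f has_sum S) (A - {0})"
    and f: "\<And>c x. c \<in> \<F> \<Longrightarrow> c \<noteq> 0 \<Longrightarrow> x \<in> A \<Longrightarrow> f (c * x) = f x"
  shows "(f has_sum (- S)) (emb X ` A_plus X)"
  unfolding has_sum_def tendsto_iff
proof safe
  fix \<epsilon> :: real assume \<epsilon>: "\<epsilon> > 0"
  let ?Ap = "emb X ` A_plus X" and ?F = "\<F> - {0}"
  have ApA: "?Ap \<subseteq> A - {0}"
  proof safe
    fix x assume x: "x \<in> A_plus X"
    then show "emb X x \<in> A" by (auto simp: A_plus_def)
    assume "emb X x = 0"
    then show False using x inj_onD[OF inj_emb, of x 0] CA_closed(5) by (auto simp: A_plus_def)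
  qed
  have norm: "\<exists>c\<in>?F. c * x \<in> ?Ap" if x: "x \<in> A - {0}" for x
  proof -
    obtain u where u: "u \<in> CA" "x = emb X u" using x by auto
    then have u0: "u \<noteq> 0" using x by auto
    have s: "sgn_A u \<in> \<F>" "sgn_A u \<noteq> 0" using sgn_in_F u sgn_nonzero[OF u0] by auto
    let ?c = "inverse (sgn_A u)"
    have c: "?c \<in> ?F" using s FD by auto
    have "tens u ?c \<in> CA" using tens_in_carrier[OF FD(7) order_refl, of u ?c] u c by simp
    moreover have "tens u ?c \<noteq> 0" using u0 s by (auto simp: tens_def zero_prod_def prod_eq_iff)
    moreover have "sgn_A (tens u ?c) = 1" using s sgn_tens[of ?c u] by simp
    ultimately have "tens u ?c \<in> A_plus X" by (simp add: A_plus_def)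
    then have "?c * x \<in> ?Ap" using emb_tens[of u ?c] u by (metis imageI)
    then show ?thesis using c by blast
  qed
  have uniq: "c = 1" if c: "c \<in> ?F" "x \<in> ?Ap" "c * x \<in> ?Ap" for c x
  proof -
    obtain u where u: "u \<in> A_plus X" "x = emb X u" using c(2) by auto
    obtain w where w: "w \<in> A_plus X" "c * x = emb X w" using c(3) by auto
    have "tens u c \<in> CA" using tens_in_carrier[OF FD(7) order_refl, of u c] u c by (auto simp: A_plus_def)
    then have "tens u c = w" using inj_onD[OF inj_emb, of "tens u c" w] u w by (auto simp: emb_tens A_plus_def)
    then have "c * sgn_A u = sgn_A w" using sgn_tens[of c u] c by auto
    then show ?thesis using u w by (simp add: A_plus_def)
  qed
  have "\<forall>\<^sub>F Y in finite_subsets_at_top (A - {0}). dist (sum f Y) S < \<epsilon>"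
    using S \<epsilon> unfolding has_sum_def tendsto_iff by simp
  then obtain X0 where X0: "finite X0" "X0 \<subseteq> A - {0}"
    "\<And>Y. finite Y \<Longrightarrow> X0 \<subseteq> Y \<Longrightarrow> Y \<subseteq> A - {0} \<Longrightarrow> dist (sum f Y) S < \<epsilon>"
    unfolding eventually_finite_subsets_at_top by metis
  \<comment> \<open>The normalized multiples of the elements of \<open>X0\<close>: as soon as Y
    contains them, the set of all nonzero constant multiples of Y contains
    \<open>X0\<close>.\<close>
  define X1 where "X1 = (\<lambda>(c, x). c * x) ` (?F \<times> X0) \<inter> ?Ap"
  show "\<forall>\<^sub>F Y in finite_subsets_at_top ?Ap. dist (sum f Y) (- S) < \<epsilon>"
    unfolding eventually_finite_subsets_at_top
  proof (intro exI[of _ X1] conjI allI impI)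
    show "finite X1" unfolding X1_def using X0(1) F_subfield(2) by blast
    show "X1 \<subseteq> ?Ap" by (auto simp: X1_def)
    fix Y assume Y: "finite Y \<and> X1 \<subseteq> Y \<and> Y \<subseteq> ?Ap"
    define FY where "FY = (\<lambda>(c, x). c * x) ` (?F \<times> Y)"
    have YA: "x \<in> A" "x \<noteq> 0" if "x \<in> Y" for x using that Y ApA by blast+
    have inj: "inj_on (\<lambda>(c, x). c * x) (?F \<times> Y)"
    proof (rule inj_onI)
      fix u u' assume uu: "u \<in> ?F \<times> Y" "u' \<in> ?F \<times> Y" "(\<lambda>(c, x). c * x) u = (\<lambda>(c, x). c * x) u'"
      obtain c x c' x' where cx: "u = (c, x)" "u' = (c', x')" by (cases u; cases u')
      have h: "c \<in> ?F" "c' \<in> ?F" "x \<in> Y" "x' \<in> Y" "c * x = c' * x'" using uu cx by auto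
      have "(c / c') * x = x'" using h by (simp add: field_simps)
      then have "c / c' = 1" using h Y FD by (intro uniq[of _ x]) auto
      then have "c = c'" using h by (simp add: divide_eq_eq)
      then show "u = u'" using h cx by auto
    qed
    have "finite FY" using Y F_subfield(2) by (simp add: FY_def)
    moreover have "X0 \<subseteq> FY"
    proof
      fix x assume x: "x \<in> X0"
      then obtain c where c: "c \<in> ?F" "c * x \<in> ?Ap" using norm[of x] X0(2) by auto
      then have "c * x \<in> X1" using x by (auto simp: X1_def)
      then have "c * x \<in> Y" using Y by auto
      moreover have "x = inverse c * (c * x)" "inverse c \<in> ?F" using c FD by auto
      ultimately show "x \<in> FY" unfolding FY_def by (auto intro!: image_eqI[of _ _ "(inverse c, c * x)"])
    qed
    moreover have "FY \<subseteq> A - {0}"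
    proof
      fix w assume "w \<in> FY"
      then obtain c x where cx: "w = c * x" "c \<in> ?F" "x \<in> Y" by (auto simp: FY_def)
      have "c * x \<in> A" using is_subringD(6)[OF A_subring, of c x] YA[OF cx(3)] cx(2) F_subset_A by auto
      then show "w \<in> A - {0}" using cx YA[OF cx(3)] by auto
    qed
    ultimately have "dist (sum f FY) S < \<epsilon>" by (rule X0(3))
    moreover have "sum f FY = - sum f Y"
    proof -
      have "sum f FY = (\<Sum>(c, x)\<in>?F \<times> Y. f (c * x))"
        unfolding FY_def by (subst sum.reindex[OF inj]) (auto intro!: sum.cong)
      also have "\<dots> = (\<Sum>c\<in>?F. \<Sum>x\<in>Y. f x)"
        unfolding sum.cartesian_product[symmetric] using f YA by (intro sum.cong) auto
      also have "\<dots> = of_nat (card \<F> - 1) * sum f Y"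
        using F_subfield(2) FD(1) by (simp add: card_Diff_singleton)
      also have "of_nat (card \<F> - 1) = (- 1 :: 'c)"
        using card_finite_subfield(3,4)[OF F_subfield] by (simp add: of_nat_diff)
      finally show ?thesis by simp
    qed
    moreover have "dist (- x) S = dist x (- S)" for x
      using absv_minus[of "x + S"] by (simp add: dist_eq_absv)
    ultimately show "dist (sum f Y) (- S) < \<epsilon>" by metis
  qed
qed

end

theorem theorem6p1:
  fixes X :: "'c::complete_nonarch_field curve_data"
    and \<phi> :: "'c reg \<Rightarrow> 'c poly"
    and v \<pp> P :: "'c reg set"
    and e :: "nat \<Rightarrow> 'c"
    and u :: "'c reg"
    and z lam :: 'c
    and n :: nat
  assumes "elliptic_setting X"
    and "drinfeld_hayes X \<phi>"
    and "is_V_ideal X \<phi> v"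
    and "\<not> V_supported_on_Spm_T X v"
    and "is_exponential X \<phi> e"
    and "primeideal \<pp> (ring_A X)" and "\<pp> \<noteq> {0}"
    and "maximalideal P (coord_ring X (Fbar X))"
    and "P \<inter> carrier (ring_A X) = \<pp>"
    and "is_uniformizer X \<pp> u"
    and "z \<in> inverse_ideal X \<pp>"
    and "emb X u * z - 1 \<in> emb X ` \<pp>"
    and "lam \<in> period_lattice X e" and "lam \<noteq> 0"
    and "lam \<notin> ideal_lattice X \<pp> (period_lattice X e)"
  shows "L_value X P (qq X ^ n) \<in>
    {k * (lam ^ (qq X ^ n) / gauss_sum X e \<pp> P z lam) | k. k \<in> field_Fp_H X P}"
proof -
  interpret hayes_setting X \<phi> e by unfold_locales (use assms in auto)
  obtain x1 y1 y2 \<rho> where em: "elliptic_module \<F> A H Kbar q (t_elt X) x1 \<Phi> E \<rho> (y_elt X) y1 y2"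
    using elliptic_module_exists by blast
  interpret M: elliptic_module \<F> A H Kbar q "t_elt X" x1 \<Phi> E \<rho> "y_elt X" y1 y2 by (rule em)
  obtain \<alpha> \<beta> where \<alpha>: "\<alpha> \<in> H" "(\<lambda>w. \<Phi> (t_elt X) w ^ q - \<alpha> * w ^ q) \<in> phi_span H A \<Phi>"
      "on_curve X \<alpha> \<beta>" "\<And>x. x \<in> v \<Longrightarrow> point_eval \<alpha> \<beta> x = 0"
    using V_point[OF em assms(3)] by blast
  have \<alpha>1: "absv \<alpha> > 1" using V_not_in_Spm_T[OF assms(4) \<alpha>(3,4)] .
  have pp: "\<pp> = P \<inter> CA" using assms(9) by simp
  have id\<pp>: "ideal \<pp> (ring_A X)" using assms(6) by (rule primeideal.axioms(1))
  note ppc = coord_ideal_closed[OF id\<pp> FD(7)]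
  obtain b where b: "b \<in> \<pp>" "b \<noteq> 0" using assms(7) ppc(3) by blast
  have bCA: "b \<in> CA" using b pp by auto
  have emb_b: "emb X b \<in> A" "emb X b \<noteq> 0"
    using bCA b(2) inj_onD[OF inj_emb, of b 0] CA_closed(5) by auto
  have CA_CF: "CA \<subseteq> polys_over (Fbar X) \<times> polys_over (Fbar X)"
    using F_subset_Fbar by (auto simp: polys_over_def)
  obtain \<alpha>\<^sub>0 \<beta>\<^sub>0 where pt: "\<alpha>\<^sub>0 \<in> Fbar X" "\<beta>\<^sub>0 \<in> Fbar X" "on_curve X \<alpha>\<^sub>0 \<beta>\<^sub>0"
      "\<And>x. x \<in> polys_over (Fbar X) \<times> polys_over (Fbar X) \<Longrightarrow> x - ([:point_eval \<alpha>\<^sub>0 \<beta>\<^sub>0 x:], 0) \<in> P"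
  proof -
    \<comment> \<open>A relation between powers of t modulo b gives P the nonzero polynomial in t
      that \<open>P_is_point\<close> asks for.\<close>
    obtain i j a where ij: "i < j" "a \<in> CA" "t_elt X ^ i - t_elt X ^ j = emb X b * emb X a"
      using M.ideal_contains_periodic[OF emb_b t_y_in_A(1)] by auto
    let ?f = "monom 1 i - monom 1 j :: 'c poly"
    have fCA: "(?f, 0) \<in> CA" using polyF by auto
    have "emb X (?f, 0) = t_elt X ^ i - t_elt X ^ j" by (simp add: emb_def poly_monom)
    then have "emb X (?f, 0) = emb X (reg_mult X a b)" using ij(3) by (simp only: emb_mult mult.commute)
    then have "(?f, 0) = reg_mult X a b"
      using inj_onD[OF inj_emb _ fCA CA_closed(3)[OF ij(2) bCA]] by simp
    moreover have "reg_mult X a b \<in> P"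
      using coord_ideal_closed(2)[OF P_ideal[OF assms(8)] Fbar_subring] b pp CA_CF ij(2) by blast
    ultimately have "(?f, 0) \<in> P" by simp
    moreover have "coeff ?f i \<noteq> 0" using ij(1) by simp
    then have "?f \<noteq> 0" by (metis coeff_0)
    moreover have "?f \<in> polys_over (Fbar X)" using polys_over_closed[OF Fbar_subring] by auto
    ultimately show ?thesis using P_is_point[OF assms(8), of ?f] that by blast
  qed
  have chi: "chi X P x = point_eval \<alpha>\<^sub>0 \<beta>\<^sub>0 x" "x \<in> \<pp> \<longleftrightarrow> point_eval \<alpha>\<^sub>0 \<beta>\<^sub>0 x = 0" if x: "x \<in> CA" for x
    using chi_eq_point_eval[OF assms(8) pt(1,2,4), of x] x CA_CF by (auto simp: pp)
  define \<chi> where "\<chi> a = point_eval \<alpha>\<^sub>0 \<beta>\<^sub>0 (inv_into CA (emb X) a)" for a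
  have \<chi>: "\<chi> (emb X x) = point_eval \<alpha>\<^sub>0 \<beta>\<^sub>0 x" if "x \<in> CA" for x
    using that by (simp add: \<chi>_def inv_into_f_f[OF inj_emb])
  have \<chi>_image: "\<chi> ` A = chi X P ` CA"
    unfolding image_image by (rule image_cong) (use \<chi> chi in auto)
  define \<nu> where "\<nu> = (\<lambda>w. \<Phi> (t_elt X) w ^ q - \<alpha> * w ^ q)"
  define Z where "Z = {a \<in> A. \<chi> a = 0}"
  define R where "R = inv_into A \<chi> ` (\<chi> ` A - {0})"
  have Z_pp: "Z = emb X ` \<pp>" using \<chi> chi(2) pp by (auto simp: Z_def)
  have zA: "z * a \<in> A" if "a \<in> Z" for a
    using that assms(11) by (auto simp: Z_pp inverse_ideal_def)
  have RA: "R \<subseteq> A" by (auto simp: R_def intro!: inv_into_into)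
  have bijR: "bij_betw \<chi> R (\<chi> ` A - {0})"
    unfolding R_def by (rule bij_betw_imageI) (auto simp: inj_on_def f_inv_into_f image_image intro!: rev_image_eqI)
  interpret T: twisted_module \<F> A H Kbar q "t_elt X" x1 \<Phi> E \<rho> \<alpha> \<nu>
    by unfold_locales (use \<alpha> \<alpha>1 in \<open>auto simp: \<nu>_def\<close>)
  have lat: "period_lattice X e = M.\<Lambda>" by (simp add: period_lattice_def M.\<Lambda>_def)
  \<comment> \<open>If z lam were a period, then lam = u (z lam) - w lam with u and w in \<pp> would
    lie in \<pp>\<Lambda>.\<close>
  have Ez: "E (z * lam) \<noteq> 0"
  proof
    assume "E (z * lam) = 0"
    then have zl: "z * lam \<in> period_lattice X e" by (simp add: period_lattice_def)
    obtain w where w: "w \<in> \<pp>" "emb X u * z - 1 = emb X w" using assms(12) by auto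
    have u: "u \<in> \<pp>" using assms(10) by (simp add: is_uniformizer_def)
    let ?a = "\<lambda>i::nat. if i = 0 then u else - w" and ?l = "\<lambda>i::nat. if i = 0 then z * lam else lam"
    have "emb X (- w) = - emb X w" using emb_diff[of 0 w] by simp
    then have "lam = emb X u * (z * lam) + emb X (- w) * lam"
      using w(2) by (simp add: algebra_simps)
    also have "\<dots> = (\<Sum>i<2. emb X (?a i) * ?l i)" by (simp add: numeral_2_eq_2)
    finally have "lam \<in> ideal_lattice X \<pp> (period_lattice X e)"
      unfolding ideal_lattice_def using u ppc(4)[OF w(1)] zl assms(13)
      by (intro CollectI exI[of _ 2] exI[of _ ?a] exI[of _ ?l]) auto
    then show False using assms(15) by simp
  qed
  interpret G: gauss_setting \<F> A H Kbar q "t_elt X" x1 \<Phi> E \<rho> \<alpha> \<nu> lam z R Z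
    by unfold_locales (use assms(13,14) lat zA RA Ez in auto)
  have pe_add: "\<chi> (x + x') = \<chi> x + \<chi> x'" "\<chi> (x * x') = \<chi> x * \<chi> x'" if xx: "x \<in> A" "x' \<in> A" for x x'
  proof -
    obtain a a' where a: "a \<in> CA" "a' \<in> CA" "x = emb X a" "x' = emb X a'" using xx by auto
    show "\<chi> (x + x') = \<chi> x + \<chi> x'"
      using \<chi>[OF CA_closed(1)[OF a(1,2)]] \<chi>[OF a(1)] \<chi>[OF a(2)] by (simp add: a emb_add point_eval_add)
    show "\<chi> (x * x') = \<chi> x * \<chi> x'"
      using \<chi>[OF CA_closed(3)[OF a(1,2)]] \<chi>[OF a(1)] \<chi>[OF a(2)] by (simp add: a emb_mult point_eval_mult[OF pt(3)])
  qed
  \<comment> \<open>All values of \<chi> lie in a finite ring containing the constants and both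
    coordinates of the point.\<close>
  have finimg: "finite (\<chi> ` A)"
  proof -
    obtain S where S: "is_subring S" "finite S" "\<F> \<subseteq> S" "\<alpha>\<^sub>0 \<in> S" "\<beta>\<^sub>0 \<in> S"
      using finite_subset_algebraic_closure[OF FD(7) F_subfield(2), of "{\<alpha>\<^sub>0, \<beta>\<^sub>0}"] pt(1,2) by (auto simp: Fbar_def)
    have "\<chi> ` A \<subseteq> S"
    proof safe
      fix f g assume fg: "f \<in> polys_over \<F>" "g \<in> polys_over \<F>"
      then have "(f, g) \<in> polys_over S \<times> polys_over S" using S(3) by (auto simp: polys_over_def)
      then show "\<chi> (emb X (f, g)) \<in> S" using \<chi>[of "(f, g)"] fg point_eval_in_subring[OF S(1) _ S(4,5)] by simp
    qed
    then show ?thesis using S(2) finite_subset by blast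
  qed
  have is_char: "T.is_char \<chi>"
    unfolding T.is_char_def
  proof (intro conjI ballI)
    show "\<chi> c = c" if "c \<in> \<F>" for c using \<chi>[OF CA_closed(6)[OF that]] by simp
    show "\<exists>b\<in>A. b \<noteq> 0 \<and> \<chi> b = 0" using emb_b b(1) chi(2)[OF bCA] \<chi>[OF bCA] by (intro bexI[of _ "emb X b"]) auto
  qed (use pe_add finimg in auto)
  have ad: "G.adapted \<chi>" unfolding G.adapted_def using is_char bijR by (simp add: Z_def)
  let ?L = "field_Fp_H X P"
  have L: "is_subfield ?L" "H \<subseteq> ?L" "\<chi> ` A \<subseteq> ?L"
    unfolding field_Fp_H_def by (auto simp: is_subfield_hull \<chi>_image intro: hull_inc)
  obtain S k where S: "((\<lambda>a. \<chi> a / a ^ (q ^ n)) has_sum S) (A - {0})" "k \<in> ?L" "S = k * (lam ^ (q ^ n) / G.gs \<chi>)"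
    using G.L_series[OF ad L] by blast
  have "((\<lambda>a. \<chi> a / a ^ (q ^ n)) has_sum (- S)) (emb X ` A_plus X)"
  proof (rule has_sum_A_plus[OF S(1)])
    fix c x assume c: "c \<in> \<F>" "c \<noteq> 0" "x \<in> A"
    have "\<chi> (c * x) = c * \<chi> x" using pe_add(2)[of c x] c F_subset_A T.is_charD(3)[OF is_char c(1)] by auto
    then show "\<chi> (c * x) / (c * x) ^ (q ^ n) = \<chi> x / x ^ (q ^ n)"
      using c M.frob_F[OF c(1)] by (simp add: power_mult_distrib)
  qed
  then have "((\<lambda>a. \<chi> a / a ^ (q ^ n)) \<circ> emb X has_sum (- S)) (A_plus X)"
    by (subst has_sum_reindex[symmetric]) (auto intro: inj_on_subset[OF inj_emb] simp: A_plus_def)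
  then have "((\<lambda>a. chi X P a / emb X a ^ (q ^ n)) has_sum (- S)) (A_plus X)"
    by (rule has_sum_cong[THEN iffD1, rotated]) (auto simp: A_plus_def \<chi> chi)
  then have Lv: "L_value X P (q ^ n) = - S" unfolding L_value_def by (rule infsumI)
  \<comment> \<open>The units of A/\<pp> are the classes on which \<chi> is nonzero, and
    \<open>R\<close> represents each once. The sign cancels against the one in
    \<open>Lv\<close>.\<close>
  have "gauss_sum X e \<pp> P z lam = - G.gs \<chi>"
  proof -
    let ?Q = "ring_A X Quot \<pp>"
    let ?c = "\<lambda>a. \<pp> +>\<^bsub>ring_A X\<^esub> a"
    have coset: "?c a = {h + a | h. h \<in> \<pp>}" for a by (auto simp: a_r_coset_def')
    have self: "a \<in> ?c a" for a unfolding coset by (rule CollectI, rule exI[of _ 0]) (use ppc(3) in simp)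
    have pe0: "point_eval \<alpha>\<^sub>0 \<beta>\<^sub>0 h = 0" if "h \<in> \<pp>" for h using chi(2)[of h] that pp by auto
    have cos_eq: "?c a = ?c a' \<longleftrightarrow> chi X P a = chi X P a'" if a: "a \<in> CA" "a' \<in> CA" for a a'
    proof
      assume "?c a = ?c a'"
      then have "a \<in> ?c a'" using self by metis
      then obtain h where "h \<in> \<pp>" "a = h + a'" unfolding coset by auto
      then show "chi X P a = chi X P a'" using a pe0 by (simp add: chi point_eval_add)
    next
      assume "chi X P a = chi X P a'"
      then have d: "a - a' \<in> \<pp>" using chi(2)[of "a - a'"] CA_closed(2)[OF a] a by (simp add: chi point_eval_diff)
      have "h + a \<in> ?c a'" if "h \<in> \<pp>" for h
      proof -
        have "h + a = (h + (a - a')) + a'" by simp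
        then show ?thesis unfolding coset using ppc(1)[OF that d] by blast
      qed
      moreover have "h + a' \<in> ?c a" if "h \<in> \<pp>" for h
      proof -
        have "h + a' = (h - (a - a')) + a" by simp
        then show ?thesis unfolding coset using ppc(5)[OF that d] by blast
      qed
      ultimately show "?c a = ?c a'" unfolding coset[of a] coset[of a'] by (auto simp: coset)
    qed
    have on_chi: "on_coset (chi X P) (?c a) = chi X P a" if a: "a \<in> CA" for a
    proof -
      have "chi X P ` ?c a = {chi X P a}"
      proof
        show "{chi X P a} \<subseteq> chi X P ` ?c a" using self by blast
        show "chi X P ` ?c a \<subseteq> {chi X P a}"
        proof safe
          fix x assume "x \<in> ?c a"
          then obtain h where h: "h \<in> \<pp>" "x = h + a" by (auto simp: coset)
          then have "x \<in> CA" using a pp CA_closed(1) by auto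
          then show "chi X P x = chi X P a" using h a pe0 by (simp add: chi point_eval_add)
        qed
      qed
      then show ?thesis by (simp add: on_coset_def)
    qed
    have on_psi: "psi X e z lam (?c a) = G.\<psi> (emb X a)" if a: "a \<in> CA" for a
    proof -
      have "E (emb X (h + a) * z * lam) = G.\<psi> (emb X a)" if "h \<in> \<pp>" for h
        using G.\<psi>_zero[of "emb X h"] G.\<psi>_props(1)[of "emb X h" "emb X a"] that Z_pp
        by (simp add: emb_add G.\<psi>_def)
      then have "(\<lambda>a. E (emb X a * z * lam)) ` ?c a = {G.\<psi> (emb X a)}"
        using self[of a] G.\<psi>_def[of "emb X a"] unfolding coset by blast
      then show ?thesis by (simp add: psi_def on_coset_def)
    qed
    have carQ: "carrier ?Q = ?c ` CA" by (auto simp: FactRing_def A_RCOSETS_def')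
    have multQ: "?c a \<otimes>\<^bsub>?Q\<^esub> ?c a' = ?c (reg_mult X a a')" if "a \<in> CA" "a' \<in> CA" for a a'
      using ideal.rcoset_mult_add[OF id\<pp>, of a a'] that by (simp add: FactRing_def)
    have oneQ: "\<one>\<^bsub>?Q\<^esub> = ?c (1, 0)" by (simp add: FactRing_def)
    have units: "Units ?Q = ?c ` {a \<in> CA. chi X P a \<noteq> 0}"
    proof (intro equalityI subsetI)
      fix x assume "x \<in> Units ?Q"
      then obtain a a' where a: "a \<in> CA" "a' \<in> CA" "x = ?c a" "?c a' \<otimes>\<^bsub>?Q\<^esub> ?c a = \<one>\<^bsub>?Q\<^esub>"
        unfolding Units_def carQ by blast
      then have "chi X P (reg_mult X a' a) = chi X P (1, 0)"
        using multQ[of a' a] oneQ cos_eq CA_closed by simp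
      then have "point_eval \<alpha>\<^sub>0 \<beta>\<^sub>0 a' * point_eval \<alpha>\<^sub>0 \<beta>\<^sub>0 a = 1"
        using a CA_closed by (simp add: chi point_eval_mult[OF pt(3)])
      then have "chi X P a \<noteq> 0" using a by (auto simp: chi)
      then show "x \<in> ?c ` {a \<in> CA. chi X P a \<noteq> 0}" using a by blast
    next
      fix x assume "x \<in> ?c ` {a \<in> CA. chi X P a \<noteq> 0}"
      then obtain a where a: "a \<in> CA" "chi X P a \<noteq> 0" "x = ?c a" by blast
      have "inverse (\<chi> (emb X a)) \<in> \<chi> ` A"
        using is_subfieldD(2)[OF T.is_charD(9)[OF is_char]] a(1) by blast
      then obtain a' where a': "a' \<in> CA" "inverse (\<chi> (emb X a)) = \<chi> (emb X a')" by auto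
      then have "point_eval \<alpha>\<^sub>0 \<beta>\<^sub>0 a * point_eval \<alpha>\<^sub>0 \<beta>\<^sub>0 a' = 1" using a \<chi> chi(1)[OF a(1)] by (metis right_inverse)
      then have "chi X P (reg_mult X a a') = chi X P (1, 0)" "chi X P (reg_mult X a' a) = chi X P (1, 0)"
        using a a' CA_closed by (simp_all add: chi point_eval_mult[OF pt(3)] mult.commute)
      then have "?c a \<otimes>\<^bsub>?Q\<^esub> ?c a' = \<one>\<^bsub>?Q\<^esub>" "?c a' \<otimes>\<^bsub>?Q\<^esub> ?c a = \<one>\<^bsub>?Q\<^esub>"
        using multQ a a' oneQ cos_eq CA_closed by simp_all
      then show "x \<in> Units ?Q" unfolding Units_def carQ using a a' by blast
    qed
    let ?i = "inv_into CA (emb X)"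
    have iR: "?i r \<in> CA" "emb X (?i r) = r" if "r \<in> R" for r
      using that RA by (auto intro: inv_into_into f_inv_into_f)
    have chi_i: "chi X P (?i r) = \<chi> r" if "r \<in> R" for r using iR[OF that] chi \<chi> by metis
    have bij: "bij_betw (\<lambda>r. ?c (?i r)) R (Units ?Q)"
    proof (rule bij_betw_imageI)
      show "inj_on (\<lambda>r. ?c (?i r)) R"
        using bijR iR(1) cos_eq chi_i by (auto simp: bij_betw_def inj_on_def)
      show "(\<lambda>r. ?c (?i r)) ` R = Units ?Q"
        unfolding units
      proof safe
        fix r assume r: "r \<in> R"
        then have "\<chi> r \<noteq> 0" using bijR by (auto simp: bij_betw_def)
        then show "?c (?i r) \<in> ?c ` {a \<in> CA. chi X P a \<noteq> 0}" using iR[OF r] chi_i[OF r] by auto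
      next
        fix f g assume fg: "f \<in> polys_over \<F>" "g \<in> polys_over \<F>" "chi X P (f, g) \<noteq> 0"
        let ?a = "(f, g)"
        have a: "?a \<in> CA" using fg by auto
        have "\<chi> (emb X ?a) \<noteq> 0" using fg(3) \<chi>[OF a] chi(1)[OF a] by metis
        moreover have "\<chi> (emb X ?a) \<in> \<chi> ` A" using a by blast
        ultimately have "\<chi> (emb X ?a) \<in> \<chi> ` R" using bijR unfolding bij_betw_def by blast
        then obtain r where r: "r \<in> R" "\<chi> r = \<chi> (emb X ?a)" by (metis imageE)
        then have "?c (?i r) = ?c ?a" using cos_eq[OF iR(1)[OF r(1)] a] chi_i[OF r(1)] \<chi>[OF a] chi(1)[OF a] by simp
        then show "?c ?a \<in> (\<lambda>r. ?c (?i r)) ` R" using r(1) by blast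
      qed
    qed
    have "(\<Sum>x\<in>Units ?Q. inverse (on_coset (chi X P) x) * psi X e z lam x) =
        (\<Sum>r\<in>R. inverse (on_coset (chi X P) (?c (?i r))) * psi X e z lam (?c (?i r)))"
      by (rule sum.reindex_bij_betw[OF bij, symmetric])
    also have "\<dots> = G.gs \<chi>"
      unfolding G.gs_def by (rule sum.cong) (use on_chi on_psi iR chi_i in auto)
    finally show ?thesis by (simp add: gauss_sum_def)
  qed
  then have "L_value X P (q ^ n) = k * (lam ^ (q ^ n) / gauss_sum X e \<pp> P z lam)"
    using Lv S(3) by simp
  then show ?thesis using S(2) by blast
qed

end
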